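(* For each $i\in\{4,5,6,7,8\}$, the axiom $\mathrm{F}_i$ of $\mathsf{F}^{-}$ is not derivable from the remaining eight axioms of $\mathsf{F}^{-}$, and the theory axiomatized by these remaining eight axioms has a consistent decidable complete extension, witnessed by a model (whose complete theory is that extension) that is finite or Presburger-definable. Moreover, the containment axiom $\mathrm{F}_9$ is conservative over the rest: if $\varphi$ is a sentence not containing $\sqsubseteq$ and $\mathsf{F}^{-}\vdash\varphi$, then $\mathrm{F}_1,\dots,\mathrm{F}_8\vdash\varphi$.
   Context: The theory $\mathsf{F}^{-}$ is a first-order theory with equality in the language $L=\{\emptyset,\langle\cdot\rangle,\uplus,\sqsubseteq\}$ (constant, unary function, binary function, binary relation), with axioms (all free variables universally quantified): $\mathrm{F}_1$: $(x\uplus y)\uplus z=x\uplus(y\uplus z)$; $\mathrm{F}_2$: $x\uplus y=y\uplus x$; $\mathrm{F}_3$: $x\uplus\emptyset=x$; $\mathrm{F}_4$: $x\uplus z=y\uplus z\rightarrow x=y$; $\mathrm{F}_5$: $\langle x\rangle\ne\emptyset$; $\mathrm{F}_6$: $x\uplus y=\emptyset\rightarrow x=\emptyset$; $\mathrm{F}_7$: $\langle x\rangle=\langle y\rangle\rightarrow x=y$; $\mathrm{F}_8$: $u\uplus v=\langle x\rangle\uplus w\rightarrow\exists w'\,(u=\langle x\rangle\uplus w'\vee v=\langle x\rangle\uplus w')$; $\mathrm{F}_9$: $x\sqsubseteq t\leftrightarrow\bigl(x=t\vee\exists w\,\exists u\,(t=w\uplus\langle u\rangle\wedge x\sqsubseteq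 u)\bigr)$. "Presburger-definable" means first-order definable, or more generally interpretable, without parameters in $(\mathbb{N},+)$. *)

theory Defs
  imports Main "HOL-Library.Nat_Bijection"
begin

section \<open>First-order logic over the language of containment and multiset sum\<close>

text \<open>Variables are de Bruijn indices; the other connectives are the usual classical abbreviations.\<close>

datatype tm =
    Var nat
  | Emp
  | Sing tm
  | Plus tm tm  (infixl "\<uplus>" 65)

datatype fm =
    Eq tm tm  (infix "\<doteq>" 55)
  | Cont tm tm  (infix "\<sqsubseteq>" 55)
  | Bot
  | Imp fm fm  (infixr "\<rightharpoonup>" 45)
  | Forall fm

abbreviation Neg :: "fm \<Rightarrow> fm" where "Neg p \<equiv> p \<rightharpoonup> Bot"
abbreviation Or :: "fm \<Rightarrow> fm \<Rightarrow> fm" where "Or p q \<equiv> Neg p \<rightharpoonup> q"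
abbreviation And :: "fm \<Rightarrow> fm \<Rightarrow> fm" where "And p q \<equiv> Neg (p \<rightharpoonup> Neg q)"
abbreviation Iff :: "fm \<Rightarrow> fm \<Rightarrow> fm" where "Iff p q \<equiv> And (p \<rightharpoonup> q) (q \<rightharpoonup> p)"
abbreviation Exists :: "fm \<Rightarrow> fm" where "Exists p \<equiv> Neg (Forall (Neg p))"

primrec fv_tm :: "tm \<Rightarrow> nat set" where
  "fv_tm (Var n) = {n}"
| "fv_tm Emp = {}"
| "fv_tm (Sing t) = fv_tm t"
| "fv_tm (s \<uplus> t) = fv_tm s \<union> fv_tm t"

primrec fv :: "fm \<Rightarrow> nat set" where
  "fv (s \<doteq> t) = fv_tm s \<union> fv_tm t"
| "fv (s \<sqsubseteq> t) = fv_tm s \<union> fv_tm t"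
| "fv Bot = {}"
| "fv (p \<rightharpoonup> q) = fv p \<union> fv q"
| "fv (Forall p) = {n. Suc n \<in> fv p}"

definition sentence :: "fm \<Rightarrow> bool" where
  "sentence p \<longleftrightarrow> fv p = {}"

primrec cont_free :: "fm \<Rightarrow> bool" where
  "cont_free (s \<doteq> t) = True"
| "cont_free (s \<sqsubseteq> t) = False"
| "cont_free Bot = True"
| "cont_free (p \<rightharpoonup> q) = (cont_free p \<and> cont_free q)"
| "cont_free (Forall p) = cont_free p"

primrec subst_tm :: "(nat \<Rightarrow> tm) \<Rightarrow> tm \<Rightarrow> tm" where
  "subst_tm \<sigma> (Var n) = \<sigma> n"
| "subst_tm \<sigma> Emp = Emp"
| "subst_tm \<sigma> (Sing t) = Sing (subst_tm \<sigma> t)"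
| "subst_tm \<sigma> (s \<uplus> t) = subst_tm \<sigma> s \<uplus> subst_tm \<sigma> t"

primrec subst :: "(nat \<Rightarrow> tm) \<Rightarrow> fm \<Rightarrow> fm" where
  "subst \<sigma> (s \<doteq> t) = (subst_tm \<sigma> s \<doteq> subst_tm \<sigma> t)"
| "subst \<sigma> (s \<sqsubseteq> t) = (subst_tm \<sigma> s \<sqsubseteq> subst_tm \<sigma> t)"
| "subst \<sigma> Bot = Bot"
| "subst \<sigma> (p \<rightharpoonup> q) = (subst \<sigma> p \<rightharpoonup> subst \<sigma> q)"
| "subst \<sigma> (Forall p) =
     Forall (subst (case_nat (Var 0) (\<lambda>n. subst_tm (\<lambda>m. Var (Suc m)) (\<sigma> n))) p)"

abbreviation lift :: "fm \<Rightarrow> fm" where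
  "lift \<equiv> subst (\<lambda>n. Var (Suc n))"

text \<open>Instantiation of the outermost (just stripped) quantifier, index 0, by a term.\<close>

abbreviation inst :: "fm \<Rightarrow> tm \<Rightarrow> fm" where
  "inst p t \<equiv> subst (case_nat t Var) p"

text \<open>Natural deduction for classical first-order logic with equality. In the rule for introducing
  a universal quantifier, lifting the hypotheses expresses the eigenvariable condition.\<close>

inductive derives :: "fm set \<Rightarrow> fm \<Rightarrow> bool"  (infix "\<turnstile>" 40) where
  Assm: "p \<in> H \<Longrightarrow> H \<turnstile> p"
| ImpI: "insert p H \<turnstile> q \<Longrightarrow> H \<turnstile> p \<rightharpoonup> q"
| ImpE: "H \<turnstile> p \<rightharpoonup> q \<Longrightarrow> H \<turnstile> p \<Longrightarrow> H \<turnstile> q"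
| Raa: "insert (Neg p) H \<turnstile> Bot \<Longrightarrow> H \<turnstile> p"
| AllI: "lift ` H \<turnstile> p \<Longrightarrow> H \<turnstile> Forall p"
| AllE: "H \<turnstile> Forall p \<Longrightarrow> H \<turnstile> inst p t"
| EqRefl: "H \<turnstile> t \<doteq> t"
| EqSubst: "H \<turnstile> s \<doteq> t \<Longrightarrow> H \<turnstile> inst p s \<Longrightarrow> H \<turnstile> inst p t"


section \<open>Structures\<close>

record 'a struct =
  universe :: "'a set"
  emp :: 'a
  sing :: "'a \<Rightarrow> 'a"
  plus :: "'a \<Rightarrow> 'a \<Rightarrow> 'a"
  contained :: "'a \<Rightarrow> 'a \<Rightarrow> bool"

definition wf_struct :: "'a struct \<Rightarrow> bool" where
  "wf_struct M \<longleftrightarrow> emp M \<in> universe M \<and> (\<forall>a\<in>universe M. sing M a \<in> universe M) \<and>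
     (\<forall>a\<in>universe M. \<forall>b\<in>universe M. plus M a b \<in> universe M)"

primrec val :: "'a struct \<Rightarrow> (nat \<Rightarrow> 'a) \<Rightarrow> tm \<Rightarrow> 'a" where
  "val M e (Var n) = e n"
| "val M e Emp = emp M"
| "val M e (Sing t) = sing M (val M e t)"
| "val M e (s \<uplus> t) = plus M (val M e s) (val M e t)"

primrec sat :: "'a struct \<Rightarrow> (nat \<Rightarrow> 'a) \<Rightarrow> fm \<Rightarrow> bool" where
  "sat M e (s \<doteq> t) \<longleftrightarrow> val M e s = val M e t"
| "sat M e (s \<sqsubseteq> t) \<longleftrightarrow> contained M (val M e s) (val M e t)"
| "sat M e Bot \<longleftrightarrow> False"
| "sat M e (p \<rightharpoonup> q) \<longleftrightarrow> (sat M e p \<longrightarrow> sat M e q)"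
| "sat M e (Forall p) \<longleftrightarrow> (\<forall>a\<in>universe M. sat M (case_nat a e) p)"

definition holds :: "'a struct \<Rightarrow> fm \<Rightarrow> bool"  (infix "\<Turnstile>" 50) where
  "M \<Turnstile> p \<longleftrightarrow> (\<forall>e. range e \<subseteq> universe M \<longrightarrow> sat M e p)"

definition model_of :: "'a struct \<Rightarrow> fm set \<Rightarrow> bool" where
  "model_of M T \<longleftrightarrow> wf_struct M \<and> (\<forall>p\<in>T. M \<Turnstile> p)"

definition Th :: "'a struct \<Rightarrow> fm set" where
  "Th M = {p. sentence p \<and> M \<Turnstile> p}"


section \<open>Decidable theories\<close>

text \<open>The total recursive functions of arity \<open>n\<close>, acting on argument lists of length \<open>n\<close> (values on
  lists of other lengths are irrelevant). Minimization is only applied to regular functions, so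
  partial functions are not needed.\<close>

inductive recursive :: "nat \<Rightarrow> (nat list \<Rightarrow> nat) \<Rightarrow> bool" where
  Zero: "recursive n (\<lambda>_. 0)"
| Succ: "recursive 1 (\<lambda>xs. Suc (xs ! 0))"
| Proj: "i < n \<Longrightarrow> recursive n (\<lambda>xs. xs ! i)"
| Comp: "recursive (length gs) f \<Longrightarrow> \<forall>g\<in>set gs. recursive n g \<Longrightarrow>
    recursive n (\<lambda>xs. f (map (\<lambda>g. g xs) gs))"
| PrimRec: "recursive n f \<Longrightarrow> recursive (Suc (Suc n)) g \<Longrightarrow>
    recursive (Suc n) (\<lambda>xs. rec_nat (f (tl xs)) (\<lambda>m r. g (m # r # tl xs)) (hd xs))"
| Mu: "recursive (Suc n) f \<Longrightarrow> \<forall>xs. length xs = n \<longrightarrow> (\<exists>m. f (m # xs) = 0) \<Longrightarrow>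
    recursive n (\<lambda>xs. LEAST m. f (m # xs) = 0)"

definition recursive_set :: "nat set \<Rightarrow> bool" where
  "recursive_set A \<longleftrightarrow> (\<exists>f. recursive 1 f \<and> (\<forall>n. f [n] = (if n \<in> A then 1 else 0)))"

primrec code_tm :: "tm \<Rightarrow> nat" where
  "code_tm (Var n) = prod_encode (0, n)"
| "code_tm Emp = prod_encode (1, 0)"
| "code_tm (Sing t) = prod_encode (2, code_tm t)"
| "code_tm (s \<uplus> t) = prod_encode (3, prod_encode (code_tm s, code_tm t))"

primrec code_fm :: "fm \<Rightarrow> nat" where
  "code_fm (s \<doteq> t) = prod_encode (0, prod_encode (code_tm s, code_tm t))"
| "code_fm (s \<sqsubseteq> t) = prod_encode (1, prod_encode (code_tm s, code_tm t))"
| "code_fm Bot = prod_encode (2, 0)"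
| "code_fm (p \<rightharpoonup> q) = prod_encode (3, prod_encode (code_fm p, code_fm q))"
| "code_fm (Forall p) = prod_encode (4, code_fm p)"

definition decidable_theory :: "fm set \<Rightarrow> bool" where
  "decidable_theory T \<longleftrightarrow> recursive_set (code_fm ` {p. sentence p \<and> T \<turnstile> p})"

definition consistent_theory :: "fm set \<Rightarrow> bool" where
  "consistent_theory T \<longleftrightarrow> \<not> T \<turnstile> Bot"

definition complete_theory :: "fm set \<Rightarrow> bool" where
  "complete_theory T \<longleftrightarrow> (\<forall>p. sentence p \<longrightarrow> T \<turnstile> p \<or> T \<turnstile> Neg p)"

definition extends :: "fm set \<Rightarrow> fm set \<Rightarrow> bool" where
  "extends T S \<longleftrightarrow> (\<forall>p. sentence p \<longrightarrow> S \<turnstile> p \<longrightarrow> T \<turnstile> p)"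


section \<open>Interpretability in \<open>(\<nat>, +)\<close>\<close>

datatype ptm = PVar nat | PAdd ptm ptm

datatype pfm = PEq ptm ptm | PBot | PImp pfm pfm | PForall pfm

primrec pfv_tm :: "ptm \<Rightarrow> nat set" where
  "pfv_tm (PVar n) = {n}"
| "pfv_tm (PAdd s t) = pfv_tm s \<union> pfv_tm t"

primrec pfv :: "pfm \<Rightarrow> nat set" where
  "pfv (PEq s t) = pfv_tm s \<union> pfv_tm t"
| "pfv PBot = {}"
| "pfv (PImp p q) = pfv p \<union> pfv q"
| "pfv (PForall p) = {n. Suc n \<in> pfv p}"

primrec pval :: "(nat \<Rightarrow> nat) \<Rightarrow> ptm \<Rightarrow> nat" where
  "pval e (PVar n) = e n"
| "pval e (PAdd s t) = pval e s + pval e t"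

primrec psat :: "(nat \<Rightarrow> nat) \<Rightarrow> pfm \<Rightarrow> bool" where
  "psat e (PEq s t) \<longleftrightarrow> pval e s = pval e t"
| "psat e PBot \<longleftrightarrow> False"
| "psat e (PImp p q) \<longleftrightarrow> (psat e p \<longrightarrow> psat e q)"
| "psat e (PForall p) \<longleftrightarrow> (\<forall>a. psat (case_nat a e) p)"

text \<open>Parameter-free definability of an \<open>n\<close>-ary relation on the natural numbers. Because of the
  bound on the free variables, \<open>xs ! i\<close> matters only for \<open>i < n\<close>.\<close>

definition presburger_rel :: "nat \<Rightarrow> nat list set \<Rightarrow> bool" where
  "presburger_rel n R \<longleftrightarrow>
     (\<exists>p. pfv p \<subseteq> {..<n} \<and> R = {xs. length xs = n \<and> psat (\<lambda>i. xs ! i) p})"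

text \<open>A \<open>k\<close>-dimensional interpretation, given by its domain \<open>D\<close> and coordinate map \<open>h\<close>. Plain
  definability is the case where \<open>k = 1\<close> and \<open>h\<close> is injective on \<open>D\<close>.
  Finite structures and interpretable structures are countable, so up to isomorphism their elements
  may be taken to be natural numbers.\<close>

definition presburger_definable :: "'a struct \<Rightarrow> bool" where
  "presburger_definable M \<longleftrightarrow> (\<exists>k D h. 0 < k \<and> h ` D = universe M \<and>
     presburger_rel k D \<and>
     presburger_rel (2 * k) {xs @ ys |xs ys. xs \<in> D \<and> ys \<in> D \<and> h xs = h ys} \<and>
     presburger_rel k {xs \<in> D. h xs = emp M} \<and>
     presburger_rel (2 * k) {xs @ ys |xs ys. xs \<in> D \<and> ys \<in> D \<and> sing M (h xs) = h ys} \<and>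
     presburger_rel (3 * k) {xs @ ys @ zs |xs ys zs.
       xs \<in> D \<and> ys \<in> D \<and> zs \<in> D \<and> plus M (h xs) (h ys) = h zs} \<and>
     presburger_rel (2 * k) {xs @ ys |xs ys. xs \<in> D \<and> ys \<in> D \<and> contained M (h xs) (h ys)})"


section \<open>The axioms\<close>

text \<open>\<open>ax i\<close> is the universal closure of the axiom \<open>F\<^sub>i\<close>, for \<open>1 \<le> i \<le> 9\<close>. The variable quantified
  last has index 0. Axioms 1 to 7 quantify their variables in the order \<open>x y z\<close>; axiom 8 uses
  \<open>u v x w\<close> and then \<open>w'\<close>; axiom 9 uses \<open>x t\<close> and then \<open>w u\<close>.\<close>

abbreviation Forall2 :: "fm \<Rightarrow> fm" where "Forall2 p \<equiv> Forall (Forall p)"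
abbreviation Forall3 :: "fm \<Rightarrow> fm" where "Forall3 p \<equiv> Forall (Forall2 p)"
abbreviation Forall4 :: "fm \<Rightarrow> fm" where "Forall4 p \<equiv> Forall (Forall3 p)"

definition ax :: "nat \<Rightarrow> fm" where
  "ax i =
    (if i = 1 then Forall3 ((Var 2 \<uplus> Var 1) \<uplus> Var 0 \<doteq> Var 2 \<uplus> (Var 1 \<uplus> Var 0))
     else if i = 2 then Forall2 (Var 1 \<uplus> Var 0 \<doteq> Var 0 \<uplus> Var 1)
     else if i = 3 then Forall (Var 0 \<uplus> Emp \<doteq> Var 0)
     else if i = 4 then Forall3 (Var 2 \<uplus> Var 0 \<doteq> Var 1 \<uplus> Var 0 \<rightharpoonup> Var 2 \<doteq> Var 1)
     else if i = 5 then Forall (Neg (Sing (Var 0) \<doteq> Emp))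
     else if i = 6 then Forall2 (Var 1 \<uplus> Var 0 \<doteq> Emp \<rightharpoonup> Var 1 \<doteq> Emp)
     else if i = 7 then Forall2 (Sing (Var 1) \<doteq> Sing (Var 0) \<rightharpoonup> Var 1 \<doteq> Var 0)
     else if i = 8 then
       Forall4 (Var 3 \<uplus> Var 2 \<doteq> Sing (Var 1) \<uplus> Var 0 \<rightharpoonup>
         Exists (Or (Var 4 \<doteq> Sing (Var 2) \<uplus> Var 0) (Var 3 \<doteq> Sing (Var 2) \<uplus> Var 0)))
     else
       Forall2 (Iff (Var 1 \<sqsubseteq> Var 0) (Or (Var 1 \<doteq> Var 0)
         (Exists (Exists (And (Var 2 \<doteq> Var 1 \<uplus> Sing (Var 0)) (Var 3 \<sqsubseteq> Var 0)))))))"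

definition F_minus :: "fm set" where
  "F_minus = ax ` {1..9}"

end

theory Submission
  imports Defs
begin

text \<open>Conservativity is semantic: by Henkin's construction, an unprovable sentence without containment
  fails in some model of \<open>F\<^sub>1, \<dots>, F\<^sub>8\<close>, and reading \<open>\<sqsubseteq>\<close> as the least relation closed under the right-hand
  side of \<open>F\<^sub>9\<close> turns that model into a model of \<open>F\<^sub>9\<close> without affecting the sentence.

  For independence, the models are \<open>(\<nat>, max)\<close> with \<open>\<langle>x\<rangle> = x + 1\<close> (for \<open>F\<^sub>4\<close>), a single point (for \<open>F\<^sub>5\<close>),
  \<open>(\<int>, +)\<close> with \<open>\<langle>x\<rangle> = 2 x + 1\<close> (for \<open>F\<^sub>6\<close>), and \<open>(\<nat>, +)\<close> with \<open>\<langle>x\<rangle> = 1\<close> (for \<open>F\<^sub>7\<close>) or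
  \<open>\<langle>x\<rangle> = x + 1\<close> (for \<open>F\<^sub>8\<close>). Their theories are decided without an elimination algorithm: the truth
  of a formula only depends on the signs of integer linear forms with small coefficients and on residues
  modulo a fixed number, so a back-and-forth argument in the style of Cooper and of Ferrante and Rackoff
  bounds each quantifier by a recursive function of the code of the formula and the parameters. Truth under
  bounded quantification is then decided by searching for a finite table of truth values that is closed
  under the recursion equations of the evaluator.\<close>

section \<open>Substitution and soundness\<close>

text \<open>Decidability means that a set of codes has a characteristic function in the class
  generated by \<open>recursive\<close>, so every algorithm must be exhibited as a recursive
  function on numbers. A quantifier elimination would require recursive descriptions of formula
  transformations; a quantifier bound requires one explicit arithmetical function. The price is an
  evaluator whose assignment grows with every recursive call, hence the search for a table. The four
  infinite models share one argument: elements are read as integers and the operations as linear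
  maps, with coefficients that may depend on the sign of a difference, which covers
  \<open>max\<close>. Coefficient bounds are indexed by codes of terms and formulas, so that one
  index controls term size and quantifier depth alike. Each model breaks its axiom at a visible
  spot: max 0 1 = max 1 1; <x> = 0 at the point; 1 + (-1) = 0; <0> = <1>; 2 + 2 = <3> + 0 although 2
  is less than <3> = 4. In a group F_8 costs nothing, and <x> = 2x + 1 is injective and never
  0.\<close>

lemma subst_tm_cong: "(\<And>n. n \<in> fv_tm t \<Longrightarrow> \<sigma> n = \<tau> n) \<Longrightarrow> subst_tm \<sigma> t = subst_tm \<tau> t"
  by (induction t) auto

lemma subst_cong: "(\<And>n. n \<in> fv p \<Longrightarrow> \<sigma> n = \<tau> n) \<Longrightarrow> subst \<sigma> p = subst \<tau> p"
proof (induction p arbitrary: \<sigma> \<tau>)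
  case (Eq s t)
  then show ?case by (auto intro!: subst_tm_cong)
next
  case (Cont s t)
  then show ?case by (auto intro!: subst_tm_cong)
next
  case (Imp p q)
  show ?case by (simp; intro conjI Imp.IH; simp add: Imp.prems)
next
  case (Forall p)
  have "subst (case_nat (Var 0) (\<lambda>n. subst_tm (\<lambda>m. Var (Suc m)) (\<sigma> n))) p
      = subst (case_nat (Var 0) (\<lambda>n. subst_tm (\<lambda>m. Var (Suc m)) (\<tau> n))) p"
    by (rule Forall.IH) (use Forall.prems in \<open>auto split: nat.split\<close>)
  then show ?case by simp
qed auto

lemma subst_tm_Var [simp]: "subst_tm Var t = t"
  by (induction t) auto

lemma case_nat_Var [simp]: "case_nat (Var 0) (\<lambda>n. Var (Suc n)) = Var"
  by (auto split: nat.split)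

lemma subst_Var [simp]: "subst Var p = p"
  by (induction p) auto

lemma subst_tm_subst_tm: "subst_tm \<sigma> (subst_tm \<tau> t) = subst_tm (\<lambda>n. subst_tm \<sigma> (\<tau> n)) t"
  by (induction t) auto

lemma subst_subst: "subst \<sigma> (subst \<tau> p) = subst (\<lambda>n. subst_tm \<sigma> (\<tau> n)) p"
proof (induction p arbitrary: \<sigma> \<tau>)
  case (Forall p)
  show ?case
    by (auto simp: Forall.IH subst_tm_subst_tm intro!: subst_cong split: nat.split)
qed (auto simp: subst_tm_subst_tm)

lemma subst_lift: "subst (case_nat (Var 0) (\<lambda>n. subst_tm (\<lambda>m. Var (Suc m)) (\<sigma> n))) (lift p)
    = lift (subst \<sigma> p)"
  by (simp add: subst_subst)

lemma subst_inst: "subst \<sigma> (inst p t)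
    = inst (subst (case_nat (Var 0) (\<lambda>n. subst_tm (\<lambda>m. Var (Suc m)) (\<sigma> n))) p) (subst_tm \<sigma> t)"
  by (auto simp: subst_subst subst_tm_subst_tm intro!: subst_cong split: nat.split)

lemma inst_lift [simp]: "inst (lift p) t = p"
  by (simp add: subst_subst)

text \<open>Serves the quantifier case of the truth lemma: instantiating a substituted body is a
  single substitution, extended at index 0.\<close>

lemma inst_subst_up: "inst (subst (case_nat (Var 0) (\<lambda>n. subst_tm (\<lambda>m. Var (Suc m)) (\<sigma> n))) p) t
    = subst (case_nat t \<sigma>) p"
  by (auto simp: subst_subst subst_tm_subst_tm intro!: subst_cong split: nat.split)

lemma val_subst_tm: "val M e (subst_tm \<sigma> t) = val M (\<lambda>n. val M e (\<sigma> n)) t"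
  by (induction t) auto

lemma val_cong: "(\<And>n. n \<in> fv_tm t \<Longrightarrow> e n = e' n) \<Longrightarrow> val M e t = val M e' t"
  by (induction t) auto

lemma sat_cong: "(\<And>n. n \<in> fv p \<Longrightarrow> e n = e' n) \<Longrightarrow> sat M e p = sat M e' p"
proof (induction p arbitrary: e e')
  case (Eq s t)
  then show ?case by (simp add: val_cong[of s e e'] val_cong[of t e e'])
next
  case (Cont s t)
  then show ?case by (simp add: val_cong[of s e e'] val_cong[of t e e'])
next
  case (Imp p q)
  show ?case by (simp; intro conjI arg_cong2[where f = "(\<longrightarrow>)"] Imp.IH; simp add: Imp.prems)
next
  case (Forall p)
  have "sat M (case_nat a e) p = sat M (case_nat a e') p" for a
    by (rule Forall.IH) (use Forall.prems in \<open>auto split: nat.split\<close>)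
  then show ?case by simp
qed auto

lemma sat_subst: "sat M e (subst \<sigma> p) = sat M (\<lambda>n. val M e (\<sigma> n)) p"
proof (induction p arbitrary: e \<sigma>)
  case (Forall p)
  have "sat M (\<lambda>n. val M (case_nat a e) (case_nat (Var 0) (\<lambda>n. subst_tm (\<lambda>m. Var (Suc m)) (\<sigma> n)) n)) p
      = sat M (case_nat a (\<lambda>n. val M e (\<sigma> n))) p" for a
    by (rule sat_cong) (auto simp: val_subst_tm split: nat.split)
  then show ?case by (simp add: Forall.IH)
qed (auto simp: val_subst_tm)

lemma sat_lift: "sat M (case_nat a e) (lift p) = sat M e p"
  by (simp add: sat_subst)

lemma sat_inst: "sat M e (inst p t) = sat M (case_nat (val M e t) e) p"
  by (auto simp: sat_subst intro!: sat_cong split: nat.split)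

lemma val_in_universe: "wf_struct M \<Longrightarrow> range e \<subseteq> universe M \<Longrightarrow> val M e t \<in> universe M"
  by (induction t) (auto simp: wf_struct_def)

theorem soundness:
  "H \<turnstile> p \<Longrightarrow> wf_struct M \<Longrightarrow> range e \<subseteq> universe M \<Longrightarrow> \<forall>q\<in>H. sat M e q \<Longrightarrow> sat M e p"
proof (induction arbitrary: e rule: derives.induct)
  case (AllI H p)
  show ?case
  proof (simp, intro ballI)
    fix a assume a: "a \<in> universe M"
    have "\<forall>q\<in>lift ` H. sat M (case_nat a e) q"
      using AllI.prems(3) by (simp add: sat_lift)
    moreover have "range (case_nat a e) \<subseteq> universe M"
      using a AllI.prems(2) by (auto simp: image_subset_iff split: nat.split)
    ultimately show "sat M (case_nat a e) p"
      using AllI.IH AllI.prems(1) by blast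
  qed
next
  case (AllE H p t)
  then show ?case using val_in_universe[of M e t] by (simp add: sat_inst)
next
  case (EqSubst H s t p)
  then show ?case by (simp add: sat_inst)
qed auto

section \<open>Truth of sentences and the complete theory of a structure\<close>

lemma soundness_model: "T \<turnstile> p \<Longrightarrow> model_of M T \<Longrightarrow> M \<Turnstile> p"
  using soundness[of T p M] by (auto simp: model_of_def holds_def)

lemma sentence_holds_iff:
  assumes "sentence p" "range e \<subseteq> universe M"
  shows "M \<Turnstile> p \<longleftrightarrow> sat M e p"
proof -
  have "sat M e' p = sat M e p" for e'
    by (rule sat_cong) (use assms in \<open>simp add: sentence_def\<close>)
  then show ?thesis using assms(2) by (auto simp: holds_def)
qed

lemma model_of_Th: "wf_struct M \<Longrightarrow> model_of M (Th M)"
  by (auto simp: model_of_def Th_def)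

text \<open>By soundness nothing new follows from \<open>Th M\<close>, so deciding this theory is
  deciding truth in \<open>M\<close>.\<close>

lemma Th_derives_iff:
  assumes "wf_struct M" "sentence p"
  shows "Th M \<turnstile> p \<longleftrightarrow> M \<Turnstile> p"
proof
  show "Th M \<turnstile> p \<Longrightarrow> M \<Turnstile> p" by (rule soundness_model[OF _ model_of_Th[OF assms(1)]])
  show "M \<Turnstile> p \<Longrightarrow> Th M \<turnstile> p" by (rule Assm) (simp add: Th_def assms(2))
qed

lemma const_env: "wf_struct M \<Longrightarrow> range (\<lambda>_. emp M) \<subseteq> universe M"
  by (auto simp: wf_struct_def)

lemma Th_extends:
  assumes "model_of M S"
  shows "extends (Th M) S"
proof -
  have "wf_struct M" using assms by (simp add: model_of_def)
  then show ?thesis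
    using soundness_model[OF _ assms] by (simp add: extends_def Th_derives_iff)
qed

lemma Th_consistent: "wf_struct M \<Longrightarrow> consistent_theory (Th M)"
  using sentence_holds_iff[OF _ const_env, of Bot M]
  by (simp add: consistent_theory_def Th_derives_iff sentence_def)

lemma Th_complete:
  assumes "wf_struct M"
  shows "complete_theory (Th M)"
  unfolding complete_theory_def
proof (intro allI impI)
  fix p assume p: "sentence p"
  then have np: "sentence (Neg p)" by (simp add: sentence_def)
  show "Th M \<turnstile> p \<or> Th M \<turnstile> Neg p"
    unfolding Th_derives_iff[OF assms p] Th_derives_iff[OF assms np]
      sentence_holds_iff[OF p const_env[OF assms]] sentence_holds_iff[OF np const_env[OF assms]]
    by simp
qed

lemma sentence_ax: "sentence (ax i)"
  by (simp add: ax_def sentence_def numeral_2_eq_2 numeral_3_eq_3 eval_nat_numeral)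

text \<open>Turns the de Bruijn sentences into statements about the operations. A single assignment
  settles a sentence, and the constant one at \<open>emp M\<close> always exists.\<close>

lemma
  assumes "wf_struct M"
  shows holds_ax1: "M \<Turnstile> ax 1 \<longleftrightarrow> (\<forall>x\<in>universe M. \<forall>y\<in>universe M. \<forall>z\<in>universe M.
      plus M (plus M x y) z = plus M x (plus M y z))"
    and holds_ax2: "M \<Turnstile> ax 2 \<longleftrightarrow> (\<forall>x\<in>universe M. \<forall>y\<in>universe M. plus M x y = plus M y x)"
    and holds_ax3: "M \<Turnstile> ax 3 \<longleftrightarrow> (\<forall>x\<in>universe M. plus M x (emp M) = x)"
    and holds_ax4: "M \<Turnstile> ax 4 \<longleftrightarrow> (\<forall>x\<in>universe M. \<forall>y\<in>universe M. \<forall>z\<in>universe M.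
      plus M x z = plus M y z \<longrightarrow> x = y)"
    and holds_ax5: "M \<Turnstile> ax 5 \<longleftrightarrow> (\<forall>x\<in>universe M. sing M x \<noteq> emp M)"
    and holds_ax6: "M \<Turnstile> ax 6 \<longleftrightarrow> (\<forall>x\<in>universe M. \<forall>y\<in>universe M.
      plus M x y = emp M \<longrightarrow> x = emp M)"
    and holds_ax7: "M \<Turnstile> ax 7 \<longleftrightarrow> (\<forall>x\<in>universe M. \<forall>y\<in>universe M. sing M x = sing M y \<longrightarrow> x = y)"
    and holds_ax8: "M \<Turnstile> ax 8 \<longleftrightarrow> (\<forall>u\<in>universe M. \<forall>v\<in>universe M. \<forall>x\<in>universe M. \<forall>w\<in>universe M.
      plus M u v = plus M (sing M x) w \<longrightarrow>
      (\<exists>w'\<in>universe M. u = plus M (sing M x) w' \<or> v = plus M (sing M x) w'))"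
    and holds_ax9: "M \<Turnstile> ax 9 \<longleftrightarrow> (\<forall>x\<in>universe M. \<forall>t\<in>universe M. contained M x t \<longleftrightarrow>
      x = t \<or> (\<exists>w\<in>universe M. \<exists>u\<in>universe M. t = plus M w (sing M u) \<and> contained M x u))"
  unfolding sentence_holds_iff[OF sentence_ax const_env[OF assms]]
  by (simp_all add: ax_def eval_nat_numeral) blast+

section \<open>Completeness and conservativity of containment\<close>

lemma derives_mono: "H \<turnstile> p \<Longrightarrow> H \<subseteq> H' \<Longrightarrow> H' \<turnstile> p"
proof (induction arbitrary: H' rule: derives.induct)
  case (Assm p H)
  then show ?case by (auto intro: derives.Assm)
next
  case (ImpI p H q)
  then show ?case by (meson derives.ImpI insert_mono)
next
  case (ImpE H p q)
  then show ?case by (meson derives.ImpE)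
next
  case (Raa p H)
  then show ?case by (meson derives.Raa insert_mono)
next
  case (AllI H p)
  show ?case by (rule derives.AllI, rule AllI.IH, rule image_mono, rule AllI.prems)
next
  case (AllE H p t)
  show ?case by (rule derives.AllE[OF AllE.IH[OF AllE.prems]])
next
  case (EqRefl H t)
  show ?case by (rule derives.EqRefl)
next
  case (EqSubst H s t p)
  show ?case by (rule derives.EqSubst[OF EqSubst.IH(1)[OF EqSubst.prems] EqSubst.IH(2)[OF EqSubst.prems]])
qed

text \<open>Substitution commutes with lifting (\<open>AllI\<close>) and with instantiation
  (\<open>AllE\<close>, \<open>EqSubst\<close>). This is what allows a named eigenvariable to be
  exchanged for index 0.\<close>

lemma derives_subst: "H \<turnstile> p \<Longrightarrow> subst \<sigma> ` H \<turnstile> subst \<sigma> p"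
proof (induction arbitrary: \<sigma> rule: derives.induct)
  case (Assm p H)
  then show ?case by (auto intro: derives.Assm)
next
  case (ImpI p H q)
  then show ?case by (simp add: derives.ImpI)
next
  case (ImpE H p q)
  show ?case using ImpE.IH(1)[of \<sigma>] ImpE.IH(2)[of \<sigma>] by (auto intro: derives.ImpE)
next
  case (Raa p H)
  show ?case using Raa.IH[of \<sigma>] by (auto intro: derives.Raa)
next
  case (AllI H p)
  let ?up = "case_nat (Var 0) (\<lambda>n. subst_tm (\<lambda>m. Var (Suc m)) (\<sigma> n))"
  have "subst ?up ` lift ` H = lift ` subst \<sigma> ` H"
    unfolding image_image subst_lift ..
  with AllI.IH[of ?up] show ?case by (simp add: derives.AllI)
next
  case (AllE H p t)
  show ?case using derives.AllE[OF AllE.IH[of \<sigma>, unfolded subst.simps]]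
    unfolding subst_inst .
next
  case (EqRefl H t)
  show ?case by (simp add: derives.EqRefl)
next
  case (EqSubst H s t p)
  show ?case
    using derives.EqSubst[OF EqSubst.IH(1)[of \<sigma>, unfolded subst.simps] EqSubst.IH(2)[of \<sigma>, unfolded subst_inst]]
    unfolding subst_inst .
qed

lemma derives_finite: "H \<turnstile> p \<Longrightarrow> \<exists>G\<subseteq>H. finite G \<and> G \<turnstile> p"
proof (induction rule: derives.induct)
  case (Assm p H)
  then show ?case by (intro exI[of _ "{p}"]) (auto intro: derives.Assm)
next
  case (ImpI p H q)
  then obtain G where G: "G \<subseteq> insert p H" "finite G" "G \<turnstile> q" by blast
  have "G - {p} \<turnstile> p \<rightharpoonup> q"
    by (rule derives.ImpI, rule derives_mono[OF G(3)]) auto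
  then show ?case using G(1,2) by (intro exI[of _ "G - {p}"] conjI) auto
next
  case (ImpE H p q)
  then obtain G G' where G: "G \<subseteq> H" "finite G" "G \<turnstile> p \<rightharpoonup> q"
    and G': "G' \<subseteq> H" "finite G'" "G' \<turnstile> p" by blast
  have "G \<union> G' \<turnstile> q"
    by (rule derives.ImpE[of _ p]; rule derives_mono[OF G(3)] derives_mono[OF G'(3)]; simp)
  then show ?case using G(1,2) G'(1,2) by (intro exI[of _ "G \<union> G'"] conjI) auto
next
  case (Raa p H)
  then obtain G where G: "G \<subseteq> insert (Neg p) H" "finite G" "G \<turnstile> Bot" by blast
  have "G - {Neg p} \<turnstile> p"
    by (rule derives.Raa, rule derives_mono[OF G(3)]) auto
  then show ?case using G(1,2) by (intro exI[of _ "G - {Neg p}"] conjI) auto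
next
  case (AllI H p)
  then obtain G where "G \<subseteq> lift ` H" "finite G" "G \<turnstile> p" by blast
  then obtain G' where "G' \<subseteq> H" "finite G'" "lift ` G' \<turnstile> p"
    using finite_subset_image[of G lift H] by auto
  then show ?case using derives.AllI by blast
next
  case (AllE H p t)
  then obtain G where "G \<subseteq> H" "finite G" "G \<turnstile> Forall p" by blast
  then show ?case using derives.AllE[of G p t] by blast
next
  case (EqRefl H t)
  show ?case by (intro exI[of _ "{}"]) (auto intro: derives.EqRefl)
next
  case (EqSubst H s t p)
  then obtain G G' where G: "G \<subseteq> H" "finite G" "G \<turnstile> s \<doteq> t"
    and G': "G' \<subseteq> H" "finite G'" "G' \<turnstile> inst p s" by blast
  have "G \<union> G' \<turnstile> inst p t"
    by (rule derives.EqSubst[of _ s]; rule derives_mono[OF G(3)] derives_mono[OF G'(3)]; simp)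
  then show ?case using G(1,2) G'(1,2) by (intro exI[of _ "G \<union> G'"] conjI) auto
qed

lemma AllI_fresh:
  assumes "H \<turnstile> inst p (Var v)" "\<And>q. q \<in> H \<Longrightarrow> v \<notin> fv q" "v \<notin> fv (Forall p)"
  shows "H \<turnstile> Forall p"
proof (rule AllI)
  \<comment> \<open>The variable \<open>v\<close> becomes the bound index 0 and all others move up.
    On hypotheses without \<open>v\<close> this is \<open>lift\<close>; on the instance of
    \<open>p\<close> at \<open>v\<close> it undoes the instantiation.\<close>
  let ?\<sigma> = "\<lambda>n. if n = v then Var 0 else Var (Suc n)"
  have "subst ?\<sigma> q = lift q" if "q \<in> H" for q
    by (rule subst_cong) (use assms(2)[OF that] in auto)
  then have "subst ?\<sigma> ` H = lift ` H" by simp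
  moreover have "subst ?\<sigma> (inst p (Var v)) = subst Var p"
    unfolding subst_subst by (rule subst_cong) (use assms(3) in \<open>auto split: nat.split\<close>)
  ultimately show "lift ` H \<turnstile> p" using derives_subst[OF assms(1), of ?\<sigma>] by simp
qed

lemma ex_falso: "H \<turnstile> Bot \<Longrightarrow> H \<turnstile> p"
  by (rule Raa) (rule derives_mono, auto)

section \<open>Henkin's construction along the codes of formulas\<close>

lemma finite_fv_tm: "finite (fv_tm t)"
  by (induction t) auto

lemma finite_fv: "finite (fv p)"
proof (induction p)
  case (Forall p)
  then have "finite (Suc -` fv p)" by (simp add: finite_vimageI)
  then show ?case by (simp add: vimage_def)
qed (auto simp: finite_fv_tm)

lemma code_tm_inject [simp]: "code_tm s = code_tm t \<longleftrightarrow> s = t"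
proof (induction s arbitrary: t)
  case (Var n) then show ?case by (cases t) auto
next
  case Emp then show ?case by (cases t) auto
next
  case (Sing s) then show ?case by (cases t) auto
next
  case (Plus s1 s2) then show ?case by (cases t) auto
qed

lemma code_fm_inject: "code_fm p = code_fm q \<longleftrightarrow> p = q"
proof (induction p arbitrary: q)
  case (Eq s t) then show ?case by (cases q) auto
next
  case (Cont s t) then show ?case by (cases q) auto
next
  case Bot then show ?case by (cases q) auto
next
  case (Imp p1 p2) then show ?case by (cases q) auto
next
  case (Forall p) then show ?case by (cases q) auto
qed

text \<open>Witnesses are variables instead of new constants, so the language stays fixed; a fresh
  one exists as long as only finitely many variables occur free. Only negated universal formulas
  receive one; any other formula is returned unchanged.\<close>

fun witness :: "fm \<Rightarrow> nat \<Rightarrow> fm" where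
  "witness (Forall p \<rightharpoonup> Bot) v = Neg (inst p (Var v))"
| "witness q v = q"

definition fresh :: "fm set \<Rightarrow> nat" where
  "fresh H = (SOME v. v \<notin> \<Union> (fv ` H))"

definition extend :: "fm \<Rightarrow> fm set \<Rightarrow> fm set" where
  "extend q H = (if insert q H \<turnstile> Bot then H
     else insert (witness q (fresh (insert q H))) (insert q H))"

text \<open>Every formula is treated at its own code. At a number that codes nothing,
  \<open>inv code_fm\<close> yields some formula, and treating it is harmless.\<close>

primrec henkin_stage :: "fm set \<Rightarrow> nat \<Rightarrow> fm set" where
  "henkin_stage S 0 = S"
| "henkin_stage S (Suc n) = extend (inv code_fm n) (henkin_stage S n)"

definition henkin :: "fm set \<Rightarrow> fm set" where
  "henkin S = (\<Union>n. henkin_stage S n)"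

lemma fresh_notin: "finite (\<Union> (fv ` H)) \<Longrightarrow> q \<in> H \<Longrightarrow> fresh H \<notin> fv q"
  unfolding fresh_def by (rule someI2_ex[OF ex_new_if_finite[OF infinite_UNIV_nat]]) auto

text \<open>If the witness destroyed consistency, \<open>Raa\<close> would derive the instance of
  \<open>p\<close> at a fresh variable, hence \<open>Forall p\<close>, against its negation in the
  set.\<close>

lemma extend_consistent:
  assumes "\<not> H \<turnstile> Bot" "finite (\<Union> (fv ` H))"
  shows "\<not> extend q H \<turnstile> Bot"
proof (cases "insert q H \<turnstile> Bot")
  case True
  then show ?thesis using assms by (simp add: extend_def)
next
  case False
  let ?G = "insert q H" let ?v = "fresh ?G"
  have fin: "finite (\<Union> (fv ` ?G))" using assms(2) by (simp add: finite_fv)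
  have "\<not> insert (witness q ?v) ?G \<turnstile> Bot"
  proof (cases "\<exists>p. q = Neg (Forall p)")
    case True
    then obtain p where q: "q = Neg (Forall p)" by blast
    show ?thesis
    proof
      assume "insert (witness q ?v) ?G \<turnstile> Bot"
      then have "?G \<turnstile> inst p (Var ?v)" unfolding q by (simp add: Raa)
      moreover have "?v \<notin> fv (Forall p)" using fresh_notin[OF fin, of q] unfolding q by simp
      ultimately have "?G \<turnstile> Forall p" using AllI_fresh[where H = ?G and p = p and v = ?v] fresh_notin[OF fin] by blast
      moreover have "?G \<turnstile> Neg (Forall p)" unfolding q by (rule Assm) simp
      ultimately have "?G \<turnstile> Bot" using ImpE by blast
      with False show False by simp
    qed
  next
    case no: False
    then have "witness q ?v = q" by (cases "(q, ?v)" rule: witness.cases) auto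
    then show ?thesis using False by simp
  qed
  then show ?thesis using False by (simp add: extend_def)
qed

lemma finite_fv_extend: "finite (\<Union> (fv ` H)) \<Longrightarrow> finite (\<Union> (fv ` extend q H))"
  by (simp add: extend_def finite_fv)

lemma henkin_stage_consistent:
  assumes "\<not> S \<turnstile> Bot" "finite (\<Union> (fv ` S))"
  shows "\<not> henkin_stage S n \<turnstile> Bot \<and> finite (\<Union> (fv ` henkin_stage S n))"
  using assms by (induction n) (simp_all add: extend_consistent finite_fv_extend)

lemma henkin_stage_mono: "m \<le> n \<Longrightarrow> henkin_stage S m \<subseteq> henkin_stage S n"
  by (rule lift_Suc_mono_le[of "henkin_stage S"]) (auto simp: extend_def)

locale henkin_theory =
  fixes S :: "fm set"
  assumes S_consistent: "\<not> S \<turnstile> Bot" and S_finite_fv: "finite (\<Union> (fv ` S))"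
begin

definition W :: "fm set" where "W = henkin S"

lemma S_subset_W: "S \<subseteq> W"
  unfolding W_def henkin_def using UN_upper[of 0 UNIV "henkin_stage S"] by simp

lemma W_consistent: "\<not> W \<turnstile> Bot"
proof
  assume "W \<turnstile> Bot"
  then obtain G where G: "G \<subseteq> W" "finite G" "G \<turnstile> Bot" using derives_finite by blast
  from G(2,1) have "\<exists>n. G \<subseteq> henkin_stage S n"
  proof (induction G rule: finite_induct)
    case (insert x F)
    then obtain m n where "F \<subseteq> henkin_stage S m" "x \<in> henkin_stage S n"
      unfolding W_def henkin_def by auto
    then have "insert x F \<subseteq> henkin_stage S (max m n)"
      using henkin_stage_mono[of m "max m n" S] henkin_stage_mono[of n "max m n" S] by auto
    then show ?case by blast
  qed auto
  then show False
    using G(3) derives_mono henkin_stage_consistent[OF S_consistent S_finite_fv] by blast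
qed

lemma stage_of: "\<exists>n. inv code_fm n = q"
  by (rule exI[of _ "code_fm q"]) (simp add: inv_f_f inj_def code_fm_inject)

text \<open>What is consistent with all of \<open>W\<close> is consistent with the stage that treats
  \<open>p\<close>, and there \<open>p\<close> was added together with its witness.\<close>

lemma W_maximal:
  assumes "\<not> insert p W \<turnstile> Bot"
  shows "p \<in> W" "\<exists>v. witness p v \<in> W"
proof -
  obtain n where n: "inv code_fm n = p" using stage_of by blast
  have sub: "henkin_stage S m \<subseteq> W" for m unfolding W_def henkin_def by blast
  have "\<not> insert p (henkin_stage S n) \<turnstile> Bot"
    using assms derives_mono insert_mono[OF sub] by blast
  then have "henkin_stage S (Suc n)
      = insert (witness p (fresh (insert p (henkin_stage S n)))) (insert p (henkin_stage S n))"
    by (simp add: extend_def n)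
  with sub[of "Suc n"] show "p \<in> W" "\<exists>v. witness p v \<in> W" by auto
qed

lemma W_closed: "W \<turnstile> p \<longleftrightarrow> p \<in> W"
proof
  assume p: "W \<turnstile> p"
  show "p \<in> W"
  proof (rule W_maximal, rule notI)
    assume "insert p W \<turnstile> Bot"
    then show False using ImpE[OF ImpI p] W_consistent by blast
  qed
qed (rule Assm)

lemma Bot_W: "Bot \<notin> W"
  using W_consistent W_closed by blast

lemma Imp_W: "(p \<rightharpoonup> q) \<in> W \<longleftrightarrow> (p \<in> W \<longrightarrow> q \<in> W)"
proof (intro iffI impI)
  show "(p \<rightharpoonup> q) \<in> W \<Longrightarrow> p \<in> W \<Longrightarrow> q \<in> W"
    using ImpE W_closed by blast
  assume pq: "p \<in> W \<longrightarrow> q \<in> W"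
  have "insert p W \<turnstile> q"
  proof (cases "p \<in> W")
    case True
    with pq show ?thesis by (auto intro: Assm)
  next
    case False
    then show ?thesis using W_maximal(1) ex_falso by blast
  qed
  then show "(p \<rightharpoonup> q) \<in> W" using ImpI W_closed by blast
qed

lemma Forall_W: "Forall p \<in> W \<longleftrightarrow> (\<forall>t. inst p t \<in> W)"
proof (intro iffI allI)
  show "Forall p \<in> W \<Longrightarrow> inst p t \<in> W" for t
    using AllE W_closed by blast
  assume all: "\<forall>t. inst p t \<in> W"
  show "Forall p \<in> W"
  proof (rule ccontr)
    assume "Forall p \<notin> W"
    then have "Neg (Forall p) \<in> W" by (simp add: Imp_W)
    then have "\<not> insert (Neg (Forall p)) W \<turnstile> Bot"
      using W_consistent by (simp add: insert_absorb)
    \<comment> \<open>The witness of the negated universal formula is a refuted instance.\<close>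
    from W_maximal(2)[OF this] obtain v where "Neg (inst p (Var v)) \<in> W" by auto
    with all show False using Bot_W Imp_W by blast
  qed
qed

lemma Eq_refl_W: "(t \<doteq> t) \<in> W"
  using EqRefl W_closed by blast

lemma Eq_subst_W: "(s \<doteq> t) \<in> W \<Longrightarrow> inst p s \<in> W \<Longrightarrow> inst p t \<in> W"
  using EqSubst W_closed by blast

text \<open>Index 0 marks the place of replacement, and the other terms are lifted so that
  \<open>inst\<close> restores them. Transitivity and the congruences below follow the same
  pattern.\<close>

lemma Eq_sym_W: "(s \<doteq> t) \<in> W \<Longrightarrow> (t \<doteq> s) \<in> W"
  using Eq_subst_W[of s t "Var 0 \<doteq> subst_tm (\<lambda>n. Var (Suc n)) s"] Eq_refl_W[of s]
  by (simp add: subst_tm_subst_tm)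

lemma Eq_trans_W: "(s \<doteq> t) \<in> W \<Longrightarrow> (t \<doteq> u) \<in> W \<Longrightarrow> (s \<doteq> u) \<in> W"
  using Eq_subst_W[of t u "subst_tm (\<lambda>n. Var (Suc n)) s \<doteq> Var 0"]
  by (simp add: subst_tm_subst_tm)

lemma Eq_Sing_W: "(s \<doteq> t) \<in> W \<Longrightarrow> (Sing s \<doteq> Sing t) \<in> W"
  using Eq_subst_W[of s t "Sing (subst_tm (\<lambda>n. Var (Suc n)) s) \<doteq> Sing (Var 0)"] Eq_refl_W[of "Sing s"]
  by (simp add: subst_tm_subst_tm)

lemma Eq_Plus_W:
  assumes "(s \<doteq> t) \<in> W" "(s' \<doteq> t') \<in> W"
  shows "(s \<uplus> s' \<doteq> t \<uplus> t') \<in> W"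
proof -
  let ?l = "subst_tm (\<lambda>n. Var (Suc n))"
  have "(s \<uplus> s' \<doteq> t \<uplus> s') \<in> W"
    using Eq_subst_W[OF assms(1), of "?l s \<uplus> ?l s' \<doteq> Var 0 \<uplus> ?l s'"] Eq_refl_W[of "s \<uplus> s'"]
    by (simp add: subst_tm_subst_tm)
  moreover have "(t \<uplus> s' \<doteq> t \<uplus> t') \<in> W"
    using Eq_subst_W[OF assms(2), of "?l t \<uplus> ?l s' \<doteq> ?l t \<uplus> Var 0"] Eq_refl_W[of "t \<uplus> s'"]
    by (simp add: subst_tm_subst_tm)
  ultimately show ?thesis by (rule Eq_trans_W)
qed

section \<open>The quotient of the terms by provable equality\<close>

definition cls :: "tm \<Rightarrow> tm set" where "cls t = {s. (t \<doteq> s) \<in> W}"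
text \<open>Representatives make the operations on classes plain functions; since provable equality
  is a congruence, the choice is immaterial.\<close>

definition rep :: "tm set \<Rightarrow> tm" where "rep A = (SOME t. cls t = A)"

lemma cls_eq_iff: "cls s = cls t \<longleftrightarrow> (s \<doteq> t) \<in> W"
  unfolding cls_def using Eq_refl_W Eq_sym_W Eq_trans_W by blast

lemma rep_cls: "(rep (cls t) \<doteq> t) \<in> W"
  unfolding rep_def cls_eq_iff[symmetric] by (rule someI[of _ t]) simp

text \<open>Containment is a parameter because the truth lemma for formulas without it holds for
  every \<open>C\<close>; the relation can then be chosen to suit F_9.\<close>

definition term_model :: "(tm set \<Rightarrow> tm set \<Rightarrow> bool) \<Rightarrow> tm set struct" where
  "term_model C = \<lparr>universe = range cls, emp = cls Emp, sing = \<lambda>A. cls (Sing (rep A)),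
     plus = \<lambda>A B. cls (rep A \<uplus> rep B), contained = C\<rparr>"

lemma wf_term_model: "wf_struct (term_model C)"
  by (auto simp: wf_struct_def term_model_def)

lemma val_term_model: "val (term_model C) (\<lambda>n. cls (\<sigma> n)) t = cls (subst_tm \<sigma> t)"
  by (induction t) (simp_all add: term_model_def cls_eq_iff Eq_Sing_W Eq_Plus_W rep_cls)

text \<open>An assignment into classes is a substitution followed by \<open>cls\<close>. As the
  universe is the range of \<open>cls\<close>, quantifying over it is quantifying over instances by
  terms.\<close>

lemma sat_term_model:
  "cont_free p \<Longrightarrow> sat (term_model C) (\<lambda>n. cls (\<sigma> n)) p \<longleftrightarrow> subst \<sigma> p \<in> W"
proof (induction p arbitrary: \<sigma>)
  case (Eq s t)
  then show ?case by (simp add: val_term_model cls_eq_iff)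
next
  case (Imp p q)
  then show ?case by (simp add: Imp_W)
next
  case (Forall p)
  have "(\<lambda>n. cls (case_nat t \<sigma> n)) = case_nat (cls t) (\<lambda>n. cls (\<sigma> n))" for t
    by (rule ext) (simp split: nat.split)
  then have "sat (term_model C) (case_nat (cls t) (\<lambda>n. cls (\<sigma> n))) p \<longleftrightarrow> subst (case_nat t \<sigma>) p \<in> W" for t
    using Forall.IH[of "case_nat t \<sigma>"] Forall.prems by simp
  then show ?case by (simp add: Forall_W inst_subst_up) (simp add: term_model_def)
qed (simp_all add: Bot_W)

lemma holds_term_model:
  assumes "cont_free p" "sentence p"
  shows "term_model C \<Turnstile> p \<longleftrightarrow> p \<in> W"
proof -
  have "range (\<lambda>n. cls (Var n)) \<subseteq> universe (term_model C)" by (auto simp: term_model_def)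
  from sentence_holds_iff[OF assms(2) this] show ?thesis
    using sat_term_model[OF assms(1), of C Var] by simp
qed

end

section \<open>The least containment relation\<close>

inductive containment :: "'a struct \<Rightarrow> 'a \<Rightarrow> 'a \<Rightarrow> bool" for M where
  refl: "containment M x x"
| step: "w \<in> universe M \<Longrightarrow> u \<in> universe M \<Longrightarrow> containment M x u \<Longrightarrow> containment M x (plus M w (sing M u))"

lemma containment_iff: "containment M x t \<longleftrightarrow>
    x = t \<or> (\<exists>w\<in>universe M. \<exists>u\<in>universe M. t = plus M w (sing M u) \<and> containment M x u)"
  by (subst containment.simps) blast

text \<open>\<open>containment M\<close> reads only the universe and the operations, so overwriting
  the field \<open>contained\<close> leaves it unchanged, and F_9 is its unfolding.\<close>

lemma holds_ax9_containment:
  assumes "wf_struct M"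
  shows "M\<lparr>contained := containment M\<rparr> \<Turnstile> ax 9"
proof -
  have "wf_struct (M\<lparr>contained := containment M\<rparr>)"
    using assms by (simp add: wf_struct_def)
  then show ?thesis by (simp add: holds_ax9 containment_iff[symmetric])
qed

lemma cont_free_ax: "i \<in> {1..8} \<Longrightarrow> cont_free (ax i)"
  by (auto simp: ax_def)

theorem containment_conservative:
  assumes p: "sentence p" "cont_free p" "F_minus \<turnstile> p"
  shows "ax ` {1..8} \<turnstile> p"
proof (rule Raa, rule ccontr)
  define S where "S = insert (Neg p) (ax ` {1..8})"
  assume "\<not> insert (Neg p) (ax ` {1..8}) \<turnstile> Bot"
  then interpret henkin_theory S
    by unfold_locales (auto simp: finite_fv S_def)
  \<comment> \<open>The constantly false relation is a placeholder inside
    \<open>containment\<close>, which does not read that field.\<close>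
  define M where "M = term_model (containment (term_model (\<lambda>_ _. False)))"
  have M_eq: "M = (term_model (\<lambda>_ _. False)) \<lparr>contained := containment (term_model (\<lambda>_ _. False))\<rparr>"
    by (simp add: M_def term_model_def)
  have wf: "wf_struct M" unfolding M_def by (rule wf_term_model)
  have "M \<Turnstile> ax i" if "i \<in> {1..9}" for i
  proof (cases "i = 9")
    case True
    have "M \<Turnstile> ax 9"
      unfolding M_eq by (rule holds_ax9_containment[OF wf_term_model])
    with True show ?thesis by simp
  next
    case False
    then have "i \<in> {1..8}" using that by auto
    then show ?thesis unfolding M_def
      using holds_term_model[OF cont_free_ax sentence_ax] S_subset_W \<open>i \<in> {1..8}\<close> S_def by blast
  qed
  then have "model_of M F_minus" using wf by (simp add: model_of_def F_minus_def)
  then have "M \<Turnstile> p" by (rule soundness_model[OF p(3)])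
  then have "p \<in> W" unfolding M_def using holds_term_model p by blast
  moreover have "Neg p \<in> W" using S_subset_W S_def by blast
  ultimately show False using Imp_W Bot_W by blast
qed

section \<open>Recursive functions\<close>

text \<open>\<open>recursive\<close> speaks about functions on all lists, also those of the wrong
  length. Agreement on lists of length \<open>n\<close> is the notion that survives rewriting the
  body of a function.\<close>

definition rec_on :: "nat \<Rightarrow> (nat list \<Rightarrow> nat) \<Rightarrow> bool" where
  "rec_on n f \<longleftrightarrow> (\<exists>g. recursive n g \<and> (\<forall>xs. length xs = n \<longrightarrow> g xs = f xs))"

lemma rec_onI: "recursive n g \<Longrightarrow> (\<And>xs. length xs = n \<Longrightarrow> g xs = f xs) \<Longrightarrow> rec_on n f"
  by (auto simp: rec_on_def)

lemma recursive_rec_on: "recursive n f \<Longrightarrow> rec_on n f"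
  by (auto simp: rec_on_def)

definition rec1 :: "(nat \<Rightarrow> nat) \<Rightarrow> bool" where
  "rec1 f \<longleftrightarrow> rec_on 1 (\<lambda>xs. f (xs ! 0))"

definition rec2 :: "(nat \<Rightarrow> nat \<Rightarrow> nat) \<Rightarrow> bool" where
  "rec2 f \<longleftrightarrow> rec_on 2 (\<lambda>xs. f (xs ! 0) (xs ! 1))"

definition rec3 :: "(nat \<Rightarrow> nat \<Rightarrow> nat \<Rightarrow> nat) \<Rightarrow> bool" where
  "rec3 f \<longleftrightarrow> rec_on 3 (\<lambda>xs. f (xs ! 0) (xs ! 1) (xs ! 2))"

lemma rec_on_proj: "i < n \<Longrightarrow> rec_on n (\<lambda>xs. xs ! i)"
  by (intro recursive_rec_on recursive.Proj)

lemma rec_on_zero: "rec_on n (\<lambda>_. 0)"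
  by (intro recursive_rec_on recursive.Zero)

lemma rec_on_rec1:
  assumes "rec1 f" "rec_on n g"
  shows "rec_on n (\<lambda>xs. f (g xs))"
proof -
  obtain F where F: "recursive 1 F" "\<And>xs. length xs = 1 \<Longrightarrow> F xs = f (xs ! 0)"
    using assms(1) by (auto simp: rec1_def rec_on_def)
  obtain G where G: "recursive n G" "\<And>xs. length xs = n \<Longrightarrow> G xs = g xs"
    using assms(2) by (auto simp: rec_on_def)
  have "recursive n (\<lambda>xs. F (map (\<lambda>g. g xs) [G]))"
    by (rule recursive.Comp) (use F(1) G(1) in simp_all)
  then show ?thesis by (rule rec_onI) (simp add: F G)
qed

lemma rec_on_rec2:
  assumes "rec2 f" "rec_on n g" "rec_on n h"
  shows "rec_on n (\<lambda>xs. f (g xs) (h xs))"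
proof -
  obtain F where F: "recursive 2 F" "\<And>xs. length xs = 2 \<Longrightarrow> F xs = f (xs ! 0) (xs ! 1)"
    using assms(1) by (auto simp: rec2_def rec_on_def)
  obtain G where G: "recursive n G" "\<And>xs. length xs = n \<Longrightarrow> G xs = g xs"
    using assms(2) by (auto simp: rec_on_def)
  obtain H where H: "recursive n H" "\<And>xs. length xs = n \<Longrightarrow> H xs = h xs"
    using assms(3) by (auto simp: rec_on_def)
  have "recursive n (\<lambda>xs. F (map (\<lambda>g. g xs) [G, H]))"
    by (rule recursive.Comp) (use F(1) G(1) H(1) in \<open>simp_all add: numeral_2_eq_2\<close>)
  then show ?thesis by (rule rec_onI) (simp add: F G H)
qed

lemma rec1_cong: "rec1 f \<Longrightarrow> (\<And>x. f x = g x) \<Longrightarrow> rec1 g"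
  by (simp add: ext[of f g])

lemma rec1_Suc: "rec1 Suc"
  unfolding rec1_def by (intro recursive_rec_on recursive.Succ)

lemma rec1_zero: "rec1 (\<lambda>_. 0)"
  unfolding rec1_def by (intro recursive_rec_on recursive.Zero)

text \<open>The recursion variable comes first because \<open>PrimRec\<close> recurses on the head
  of the list; \<open>s\<close> receives the counter, the previous value and the parameter.\<close>

lemma rec2_rec_nat:
  assumes "rec1 b" "rec3 s"
  shows "rec2 (\<lambda>n x. rec_nat (b x) (\<lambda>m r. s m r x) n)"
proof -
  obtain B where B: "recursive 1 B" "\<And>xs. length xs = 1 \<Longrightarrow> B xs = b (xs ! 0)"
    using assms(1) by (auto simp: rec1_def rec_on_def)
  obtain S where S: "recursive 3 S" "\<And>xs. length xs = 3 \<Longrightarrow> S xs = s (xs ! 0) (xs ! 1) (xs ! 2)"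
    using assms(2) by (auto simp: rec3_def rec_on_def)
  have "recursive (Suc 1) (\<lambda>xs. rec_nat (B (tl xs)) (\<lambda>m r. S (m # r # tl xs)) (hd xs))"
    by (rule recursive.PrimRec) (use B S in \<open>simp_all add: numeral_3_eq_3\<close>)
  then have "recursive 2 (\<lambda>xs. rec_nat (B (tl xs)) (\<lambda>m r. S (m # r # tl xs)) (hd xs))"
    by (simp add: numeral_2_eq_2)
  then show ?thesis unfolding rec2_def
    by (rule rec_onI) (auto simp: B S numeral_2_eq_2 length_Suc_conv)
qed

lemma rec1_Least:
  assumes "rec2 f" "\<And>x. \<exists>m. f m x = 0"
  shows "rec1 (\<lambda>x. LEAST m. f m x = 0)"
proof -
  obtain F where F: "recursive 2 F" "\<And>xs. length xs = 2 \<Longrightarrow> F xs = f (xs ! 0) (xs ! 1)"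
    using assms(1) by (auto simp: rec2_def rec_on_def)
  have "recursive 1 (\<lambda>xs. LEAST m. F (m # xs) = 0)"
  proof (rule recursive.Mu)
    show "recursive (Suc 1) F" using F(1) by (simp add: numeral_2_eq_2)
    show "\<forall>xs. length xs = 1 \<longrightarrow> (\<exists>m. F (m # xs) = 0)" using assms(2) by (simp add: F)
  qed
  then show ?thesis unfolding rec1_def
    by (rule rec_onI) (simp add: F)
qed

lemma rec2_swap: "rec2 f \<Longrightarrow> rec2 (\<lambda>x y. f y x)"
  unfolding rec2_def[of "\<lambda>x y. f y x"] by (intro rec_on_rec2[of f] rec_on_proj) simp_all

lemma rec1_rec2: "rec2 f \<Longrightarrow> rec1 g \<Longrightarrow> rec1 h \<Longrightarrow> rec1 (\<lambda>x. f (g x) (h x))"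
  unfolding rec1_def by (rule rec_on_rec2)

lemma rec1_rec1: "rec1 f \<Longrightarrow> rec1 g \<Longrightarrow> rec1 (\<lambda>x. f (g x))"
  unfolding rec1_def[of g] rec1_def[of "\<lambda>x. f (g x)"] by (rule rec_on_rec1)

lemma rec1_id: "rec1 (\<lambda>x. x)"
  unfolding rec1_def by (intro rec_on_proj) simp

lemma rec2_add: "rec2 (+)"
proof -
  have "rec2 (\<lambda>n x. rec_nat x (\<lambda>m r. Suc r) n)"
    by (rule rec2_rec_nat[of "\<lambda>x. x" "\<lambda>m r x. Suc r"])
      (unfold rec1_def rec3_def; intro rec_on_proj rec_on_rec1[OF rec1_Suc]; simp)+
  moreover have "rec_nat x (\<lambda>m r. Suc r) n = n + x" for n x by (induction n) auto
  ultimately show ?thesis by simp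
qed

lemma rec1_pred: "rec1 (\<lambda>n. n - 1)"
proof -
  have "rec2 (\<lambda>n x. rec_nat 0 (\<lambda>m r. m) n)"
    by (rule rec2_rec_nat[of "\<lambda>x. 0" "\<lambda>m r x. m"])
      (unfold rec1_def rec3_def; intro rec_on_proj rec_on_zero; simp)+
  moreover have "rec_nat 0 (\<lambda>m r. m) n = n - 1" for n by (cases n) auto
  ultimately have "rec2 (\<lambda>n _. n - 1)" by simp
  from rec1_rec2[OF this rec1_id rec1_id] show ?thesis .
qed

lemma rec2_diff: "rec2 (-)"
proof -
  have "rec2 (\<lambda>n x. rec_nat x (\<lambda>m r. r - 1) n)"
    by (rule rec2_rec_nat[of "\<lambda>x. x" "\<lambda>m r x. r - 1"])
      (unfold rec1_def rec3_def; intro rec_on_proj rec_on_rec1[OF rec1_pred]; simp)+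
  moreover have "rec_nat x (\<lambda>m r. r - 1) n = x - n" for n x by (induction n) auto
  ultimately have "rec2 (\<lambda>n x. x - n)" by simp
  then show ?thesis by (rule rec2_swap)
qed

lemma rec2_mult: "rec2 (*)"
proof -
  have "rec2 (\<lambda>n x. rec_nat 0 (\<lambda>m r. r + x) n)"
    by (rule rec2_rec_nat[of "\<lambda>x. 0" "\<lambda>m r x. r + x"])
      (unfold rec1_def rec3_def; intro rec_on_proj rec_on_zero rec_on_rec2[OF rec2_add]; simp)+
  moreover have "rec_nat 0 (\<lambda>m r. r + x) n = n * x" for n x by (induction n) auto
  ultimately show ?thesis by simp
qed

lemma rec1_triangle: "rec1 triangle"
proof -
  have "rec2 (\<lambda>n x. rec_nat 0 (\<lambda>m r. r + Suc m) n)"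
    by (rule rec2_rec_nat[of "\<lambda>x. 0" "\<lambda>m r x. r + Suc m"])
      (unfold rec1_def rec3_def;
        intro rec_on_proj rec_on_zero rec_on_rec2[OF rec2_add] rec_on_rec1[OF rec1_Suc]; simp)+
  moreover have "rec_nat 0 (\<lambda>m r. r + Suc m) n = triangle n" for n by (induction n) auto
  ultimately have "rec2 (\<lambda>n x. triangle n)" by simp
  from rec1_rec2[OF this rec1_id rec1_id] show ?thesis by simp
qed

section \<open>Cantor pairing and its inverses\<close>

definition pair :: "nat \<Rightarrow> nat \<Rightarrow> nat" where "pair a b = prod_encode (a, b)"
definition pfst :: "nat \<Rightarrow> nat" where "pfst n = fst (prod_decode n)"
definition psnd :: "nat \<Rightarrow> nat" where "psnd n = snd (prod_decode n)"

lemma pfst_pair [simp]: "pfst (pair a b) = a" and psnd_pair [simp]: "psnd (pair a b) = b"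
  by (simp_all add: pair_def pfst_def psnd_def)

lemma pair_pfst_psnd [simp]: "pair (pfst n) (psnd n) = n"
  by (simp add: pair_def pfst_def psnd_def)

lemma pair_triangle: "pair a b = triangle (a + b) + a"
  by (simp add: pair_def prod_encode_def)

lemma pfst_le: "pfst n \<le> n" and psnd_le: "psnd n \<le> n"
  using le_prod_encode_1[of "pfst n" "psnd n"] le_prod_encode_2[of "psnd n" "pfst n"]
  by (simp_all flip: pair_def)

lemma triangle_mono: "m \<le> n \<Longrightarrow> triangle m \<le> triangle n"
  by (rule lift_Suc_mono_le[of triangle]) auto

lemma rec2_pair: "rec2 pair"
proof -
  have "rec2 (\<lambda>a b. triangle (a + b) + a)"
    unfolding rec2_def
    by (intro rec_on_rec2[OF rec2_add] rec_on_rec1[OF rec1_triangle] rec_on_proj) simp_all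
  then show ?thesis by (simp add: pair_triangle[abs_def])
qed

text \<open>The sum of the components is the number of the diagonal on which \<open>n\<close> lies,
  hence the least \<open>m\<close> with \<open>n < triangle (Suc m)\<close>. Truncated subtraction
  expresses this inequality as an equation with 0, the form required by \<open>Mu\<close>.\<close>

lemma triangle_root: "(LEAST m. Suc n - triangle (Suc m) = 0) = pfst n + psnd n"
proof -
  have n: "n = triangle (pfst n + psnd n) + pfst n" using pair_triangle[of "pfst n" "psnd n"] by simp
  show ?thesis
  proof (rule Least_equality)
    show "Suc n - triangle (Suc (pfst n + psnd n)) = 0" by (subst n) simp
  next
    fix m assume m: "Suc n - triangle (Suc m) = 0"
    show "pfst n + psnd n \<le> m"
    proof (rule ccontr)
      assume "\<not> pfst n + psnd n \<le> m"
      then have "triangle (Suc m) \<le> triangle (pfst n + psnd n)" by (intro triangle_mono) simp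
      then show False using m n by linarith
    qed
  qed
qed

lemma rec1_sum_pfst_psnd: "rec1 (\<lambda>n. pfst n + psnd n)"
proof -
  have "rec2 (\<lambda>m n. Suc n - triangle (Suc m))"
    unfolding rec2_def
    by (intro rec_on_rec2[OF rec2_diff] rec_on_rec1[OF rec1_triangle] rec_on_rec1[OF rec1_Suc] rec_on_proj)
      simp_all
  moreover have "\<exists>m. Suc n - triangle (Suc m) = 0" for n
    by (rule exI[of _ n]) simp
  ultimately show ?thesis
    using rec1_Least[of "\<lambda>m n. Suc n - triangle (Suc m)"] unfolding triangle_root by blast
qed

lemma rec1_pfst: "rec1 pfst"
proof -
  have "rec1 (\<lambda>n. n - triangle (pfst n + psnd n))"
    by (intro rec1_rec2[OF rec2_diff] rec1_id rec1_rec1[OF rec1_triangle] rec1_sum_pfst_psnd)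
  moreover have "n - triangle (pfst n + psnd n) = pfst n" for n
    using pair_triangle[of "pfst n" "psnd n"] by simp
  ultimately show ?thesis by simp
qed

lemma rec1_psnd: "rec1 psnd"
  using rec1_rec2[OF rec2_diff rec1_sum_pfst_psnd rec1_pfst] by simp

lemma rec1_const: "rec1 (\<lambda>_. n)"
proof (induction n)
  case (Suc n)
  then show ?case using rec1_rec1[OF rec1_Suc] by blast
qed (rule rec1_zero)

text \<open>Reduces recursion to unary functions: the number \<open>z\<close> packs the counter, the
  previous value and the parameter.\<close>

lemma rec1_rec_nat:
  assumes "rec1 b" "rec1 (\<lambda>z. s (pfst z) (pfst (psnd z)) (psnd (psnd z)))" "rec1 a"
  shows "rec1 (\<lambda>x. rec_nat (b x) (\<lambda>m r. s m r x) (a x))"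
proof -
  have "rec3 (\<lambda>m r x. (\<lambda>z. s (pfst z) (pfst (psnd z)) (psnd (psnd z))) (pair m (pair r x)))"
    unfolding rec3_def by (intro rec_on_rec1[OF assms(2)] rec_on_rec2[OF rec2_pair] rec_on_proj) simp_all
  then have "rec3 s" by simp
  from rec1_rec2[OF rec2_rec_nat[OF assms(1) this] assms(3) rec1_id] show ?thesis .
qed

section \<open>Recursive predicates\<close>

definition rpred :: "(nat \<Rightarrow> bool) \<Rightarrow> bool" where
  "rpred P \<longleftrightarrow> rec1 (\<lambda>x. if P x then 1 else 0)"

lemma rpred_Not: "rpred P \<Longrightarrow> rpred (\<lambda>x. \<not> P x)"
proof -
  assume "rpred P"
  then have "rec1 (\<lambda>x. 1 - (if P x then 1 else 0))"
    unfolding rpred_def by (intro rec1_rec2[OF rec2_diff] rec1_const)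
  moreover have "1 - (if P x then 1 else 0) = (if \<not> P x then 1 else 0 :: nat)" for x by simp
  ultimately show ?thesis unfolding rpred_def by (rule rec1_cong)
qed

lemma rpred_conj: "rpred P \<Longrightarrow> rpred Q \<Longrightarrow> rpred (\<lambda>x. P x \<and> Q x)"
proof -
  assume "rpred P" "rpred Q"
  then have "rec1 (\<lambda>x. (if P x then 1 else 0) * (if Q x then 1 else 0))"
    unfolding rpred_def by (intro rec1_rec2[OF rec2_mult])
  moreover have "(if P x then 1 else 0) * (if Q x then 1 else 0) = (if P x \<and> Q x then 1 else 0 :: nat)" for x by simp
  ultimately show ?thesis unfolding rpred_def by (rule rec1_cong)
qed

lemma rpred_disj: "rpred P \<Longrightarrow> rpred Q \<Longrightarrow> rpred (\<lambda>x. P x \<or> Q x)"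
  using rpred_Not[OF rpred_conj[OF rpred_Not rpred_Not], of P Q] by simp

lemma rpred_imp: "rpred P \<Longrightarrow> rpred Q \<Longrightarrow> rpred (\<lambda>x. P x \<longrightarrow> Q x)"
  using rpred_disj[OF rpred_Not, of P Q] by simp

lemma rpred_le: 
  assumes "rec1 f" "rec1 g"
  shows "rpred (\<lambda>x. f x \<le> g x)"
proof -
  have "rec1 (\<lambda>x. 1 - (f x - g x))"
    by (intro rec1_rec2[OF rec2_diff] rec1_const assms)
  moreover have "1 - (f x - g x) = (if f x \<le> g x then 1 else 0)" for x by simp
  ultimately show ?thesis unfolding rpred_def by (rule rec1_cong)
qed

lemma rpred_less: "rec1 f \<Longrightarrow> rec1 g \<Longrightarrow> rpred (\<lambda>x. f x < g x)"
  using rpred_Not[OF rpred_le, of g f] by (simp add: not_le)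

lemma rpred_eq: "rec1 f \<Longrightarrow> rec1 g \<Longrightarrow> rpred (\<lambda>x. f x = g x)"
  using rpred_conj[OF rpred_le rpred_le, of f g g f] by (simp add: eq_iff)

lemma rpred_const: "rpred (\<lambda>_. b)"
  unfolding rpred_def by (cases b) (simp_all add: rec1_const)

lemma rec1_if:
  assumes "rpred P" "rec1 f" "rec1 g"
  shows "rec1 (\<lambda>x. if P x then f x else g x)"
proof -
  have "rec1 (\<lambda>x. (if P x then 1 else 0) * f x + (if \<not> P x then 1 else 0) * g x)"
    by (intro rec1_rec2[OF rec2_add] rec1_rec2[OF rec2_mult] assms(2,3)
        rpred_Not[OF assms(1), unfolded rpred_def] assms(1)[unfolded rpred_def])
  moreover have "(if P x then 1 else 0) * f x + (if \<not> P x then 1 else 0) * g x = (if P x then f x else g x)" for x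
    by simp
  ultimately show ?thesis by (rule rec1_cong)
qed

lemma rpred_all_less:
  assumes "rpred (\<lambda>z. P (pfst z) (psnd z))" "rec1 b"
  shows "rpred (\<lambda>x. \<forall>m<b x. P m x)"
proof -
  \<comment> \<open>The middle component of the recursion triple is the truth value accumulated so
    far; \<open>P\<close> sees only the counter and the parameter.\<close>
  have "rpred (\<lambda>z. P (pfst z) (psnd (psnd z)))"
  proof -
    have "rec1 (\<lambda>z. pair (pfst z) (psnd (psnd z)))"
      by (intro rec1_rec2[OF rec2_pair] rec1_rec1[OF rec1_psnd] rec1_pfst rec1_psnd)
    from rec1_rec1[OF assms(1)[unfolded rpred_def] this] show ?thesis
      by (simp add: rpred_def)
  qed
  then have "rec1 (\<lambda>x. rec_nat 1 (\<lambda>m r. (\<lambda>m r x. if P m x then r else 0) m r x) (b x))"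
    by (intro rec1_rec_nat rec1_if rec1_const assms(2) rec1_rec1[OF rec1_pfst] rec1_psnd)
  moreover have "rec_nat 1 (\<lambda>m r. if P m x then r else 0) n = (if \<forall>m<n. P m x then 1 else 0 :: nat)" for x n
    by (induction n) (auto simp: less_Suc_eq)
  ultimately show ?thesis by (simp add: rpred_def)
qed

lemma rpred_ex_less:
  assumes "rpred (\<lambda>z. P (pfst z) (psnd z))" "rec1 b"
  shows "rpred (\<lambda>x. \<exists>m<b x. P m x)"
  using rpred_Not[OF rpred_all_less[OF rpred_Not[OF assms(1)] assms(2)]] by simp

lemma rec1_Least_pred:
  assumes "rpred (\<lambda>z. P (pfst z) (psnd z))" "\<And>x. \<exists>m. P m x"
  shows "rec1 (\<lambda>x. LEAST m. P m x)"
proof -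
  have "rec1 (\<lambda>z. if P (pfst z) (psnd z) then 0 else 1)"
    by (intro rec1_if assms(1) rec1_const)
  then have "rec2 (\<lambda>m x. (\<lambda>z. if P (pfst z) (psnd z) then 0 else 1) (pair m x))"
    unfolding rec2_def by (rule rec_on_rec1) (intro rec_on_rec2[OF rec2_pair] rec_on_proj; simp)
  then have "rec2 (\<lambda>m x. if P m x then 0 else 1)" by simp
  then have "rec1 (\<lambda>x. LEAST m. (if P m x then 0 else 1) = (0::nat))"
    by (rule rec1_Least) (simp add: assms(2))
  moreover have "((if b then 0 else 1) = (0::nat)) = b" for b by simp
  ultimately show ?thesis by simp
qed

section \<open>Numbers as finite tables\<close>

definition lk :: "nat \<Rightarrow> nat \<Rightarrow> nat" where
  "lk T n = pfst ((psnd ^^ n) T)"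

lemma lk_pair_0 [simp]: "lk (pair a T) 0 = a"
  by (simp add: lk_def)

lemma lk_pair_Suc [simp]: "lk (pair a T) (Suc n) = lk T n"
  by (simp add: lk_def funpow_swap1)

lemmas rec1_fst = rec1_rec1[OF rec1_pfst] and rec1_snd = rec1_rec1[OF rec1_psnd]

lemma rec1_lk:
  assumes "rec1 f" "rec1 g"
  shows "rec1 (\<lambda>x. lk (f x) (g x))"
proof -
  have "(psnd ^^ n) T = rec_nat T (\<lambda>m r. psnd r) n" for n T by (induction n) auto
  then show ?thesis
    unfolding lk_def using assms by (auto intro!: rec1_fst rec1_snd rec1_rec_nat rec1_id)
qed

lemmas rec1_intros = rec1_id rec1_const rec1_pfst rec1_psnd rec1_fst rec1_snd rec1_lk rec1_if
  rec1_rec1[OF rec1_Suc] rec1_rec2[OF rec2_add] rec1_rec2[OF rec2_diff] rec1_rec2[OF rec2_mult]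
  rec1_rec2[OF rec2_pair]
  rpred_Not rpred_conj rpred_disj rpred_imp rpred_le rpred_less rpred_eq rpred_const
  rpred_all_less rpred_ex_less

text \<open>0 and 1 are fixed by \<open>psnd\<close> and have first component 0. These are the two
  ends at which iterated unpairing can stop, so every number is a list of entries followed by
  zeros.\<close>

lemma pfst_0 [simp]: "pfst 0 = 0" and psnd_0 [simp]: "psnd 0 = 0"
  and pfst_1 [simp]: "pfst (Suc 0) = 0" and psnd_1 [simp]: "psnd (Suc 0) = 1"
proof -
  have "pair 0 0 = 0" "pair 0 1 = Suc 0" by (simp_all add: pair_triangle)
  from arg_cong[OF this(1), of pfst] arg_cong[OF this(1), of psnd]
    arg_cong[OF this(2), of pfst] arg_cong[OF this(2), of psnd]
  show "pfst 0 = 0" "psnd 0 = 0" "pfst (Suc 0) = 0" "psnd (Suc 0) = 1" by simp_all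
qed

lemma lk_0 [simp]: "lk 0 n = 0"
proof -
  have "(psnd ^^ n) 0 = 0" by (induction n) auto
  then show ?thesis by (simp add: lk_def)
qed

lemma psnd_less: "2 \<le> n \<Longrightarrow> psnd n < n"
proof (rule ccontr)
  assume n: "2 \<le> n" "\<not> psnd n < n"
  then have eq: "psnd n = n" using psnd_le[of n] by simp
  have "n = triangle (pfst n + n) + pfst n" using pair_triangle[of "pfst n" "psnd n"] pair_pfst_psnd[of n]
    unfolding eq by simp
  moreover have "triangle (pfst n + n) \<ge> triangle n" by (rule triangle_mono) simp
  moreover have "triangle n > n" using n(1)
  proof (induction n rule: dec_induct)
    case base then show ?case by (simp add: numeral_2_eq_2)
  qed simp
  ultimately show False by linarith
qed

text \<open>Tails decrease strictly until 0 or 1 is reached, so no entry at or beyond position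
  \<open>T\<close> survives. This bounds the test of a table and, later, the variables that an
  assignment can cover.\<close>

lemma lk_nonzero_less: 
  assumes "lk T n \<noteq> 0" shows "n < T"
proof (rule ccontr)
  assume "\<not> n < T"
  have "(psnd ^^ m) T \<le> max 1 (T - m)" for m
  proof (induction m)
    case (Suc m)
    let ?t = "(psnd ^^ m) T"
    show ?case
    proof (cases "2 \<le> ?t")
      case True
      with psnd_less[of ?t] Suc show ?thesis by simp
    next
      case False
      with psnd_le[of ?t] show ?thesis by simp
    qed
  qed simp
  from this[of n] have "(psnd ^^ n) T = 0 \<or> (psnd ^^ n) T = Suc 0" using \<open>\<not> n < T\<close> by auto
  then have "lk T n = 0" by (auto simp: lk_def)
  with assms show False by simp
qed

lemma ex_lk_bounded:
  "(\<And>n. N \<le> n \<Longrightarrow> g n = 0) \<Longrightarrow> \<exists>T. lk T = g"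
proof (induction N arbitrary: g)
  case 0
  then show ?case by (intro exI[of _ 0] ext) simp
next
  case (Suc N)
  from Suc.IH[of "\<lambda>n. g (Suc n)"] Suc.prems obtain T where T: "lk T = (\<lambda>n. g (Suc n))" by auto
  have "lk (pair (g 0) T) n = g n" for n by (cases n) (simp_all add: T)
  then show ?case by blast
qed

lemma ex_lk:
  assumes "finite C"
  shows "\<exists>T. lk T = (\<lambda>n. if n \<in> C then g n else 0)"
proof -
  obtain N where "\<forall>n\<in>C. n < N" using assms finite_nat_set_iff_bounded by blast
  then show ?thesis by (intro ex_lk_bounded[of N]) auto
qed

text \<open>\<open>step g x\<close> computes \<open>f x\<close> from the partial table \<open>g\<close>, where the value 0 stands for undefined;
  \<open>f\<close> is then found by searching for a finite table that is closed under \<open>step\<close>. No bound on the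
  parameters of the recursive calls is needed.\<close>

lemma rec1_table:
  fixes step :: "(nat \<Rightarrow> nat) \<Rightarrow> nat \<Rightarrow> nat"
  assumes step: "rec1 (\<lambda>z. step (lk (pfst z)) (psnd z))"
    and wf: "wf R"
    and nonzero: "\<And>x. f x \<noteq> 0"
    and finite: "\<And>x. finite (D x)"
    and smaller: "\<And>x y. y \<in> D x \<Longrightarrow> (y, x) \<in> R"
    and strict: "\<And>g x y. y \<in> D x \<Longrightarrow> g y = 0 \<Longrightarrow> step g x = 0"
    and correct: "\<And>g x. (\<And>y. y \<in> D x \<Longrightarrow> g y = f y) \<Longrightarrow> step g x = f x"
  shows "rec1 f"
proof -
  \<comment> \<open>Entries from \<open>T\<close> on are 0, so a bounded quantifier checks the whole
    table and the test is recursive.\<close>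
  define good where "good T \<longleftrightarrow> (\<forall>y<T. lk T y = 0 \<or> lk T y = step (lk T) y)" for T
  have table_sound: "lk T x = f x" if "good T" "lk T x \<noteq> 0" for T x
    using wf that(2)
  proof (induction x rule: wf_induct_rule)
    case (less x)
    have "lk T x = step (lk T) x"
      using that(1) less.prems lk_nonzero_less[OF less.prems] by (auto simp: good_def)
    with strict[of _ x "lk T"] less.prems have "lk T y \<noteq> 0" if "y \<in> D x" for y
      using that by fastforce
    with less.IH smaller have "step (lk T) x = f x" by (intro correct) blast
    with \<open>lk T x = step (lk T) x\<close> show ?case by simp
  qed
  \<comment> \<open>Each call has finitely many dependencies and these descend along a well-founded
    relation, so only finitely many calls are reachable from \<open>x\<close>.\<close>
  have closed: "\<exists>C. finite C \<and> x \<in> C \<and> (\<forall>y\<in>C. D y \<subseteq> C)" for x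
    using wf
  proof (induction x rule: wf_induct_rule)
    case (less x)
    then obtain C where C: "\<And>y. y \<in> D x \<Longrightarrow> finite (C y) \<and> y \<in> C y \<and> (\<forall>z\<in>C y. D z \<subseteq> C y)"
      using smaller by metis
    show ?case
      by (rule exI[of _ "insert x (\<Union>y\<in>D x. C y)"]) (use C finite in blast)
  qed
  have ex: "\<exists>T. good T \<and> lk T x \<noteq> 0" for x
  proof -
    obtain C where C: "finite C" "x \<in> C" "\<And>y. y \<in> C \<Longrightarrow> D y \<subseteq> C" using closed[of x] by blast
    obtain T where T: "lk T = (\<lambda>n. if n \<in> C then f n else 0)" using ex_lk[OF C(1)] by blast
    have "step (lk T) y = f y" if "y \<in> C" for y
      by (rule correct) (use C(3)[OF that] T in auto)
    then have "good T" using T by (auto simp: good_def)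
    moreover have "lk T x \<noteq> 0" using T C(2) nonzero by simp
    ultimately show ?thesis by blast
  qed
  have f_eq: "f x = lk (LEAST T. good T \<and> lk T x \<noteq> 0) x" for x
    using table_sound LeastI_ex[OF ex[of x]] by metis
  have "rec1 (\<lambda>x. lk (LEAST T. good T \<and> lk T x \<noteq> 0) x)"
  proof (rule rec1_lk[OF rec1_Least_pred rec1_id])
    \<comment> \<open>The components are exchanged because the closure rule for bounded quantifiers
      expects the bound variable first.\<close>
    have "rec1 (\<lambda>z. (\<lambda>z. step (lk (pfst z)) (psnd z)) (pair (psnd z) (pfst z)))"
      by (rule rec1_rec1[OF step]) (intro rec1_intros)
    then have "rec1 (\<lambda>z. step (lk (psnd z)) (pfst z))" by simp
    then have "rpred good"
      unfolding good_def by (intro rec1_intros)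
    then have "rec1 (\<lambda>z. (\<lambda>z. if good z then 1 else 0) (pfst z))"
      unfolding rpred_def by (rule rec1_rec1) (intro rec1_intros)
    then have "rpred (\<lambda>z. good (pfst z))" by (simp add: rpred_def)
    then show "rpred (\<lambda>z. good (pfst z) \<and> lk (pfst z) (psnd z) \<noteq> 0)"
      by (intro rec1_intros)
  qed (rule ex)
  then show ?thesis by (rule rec1_cong) (rule f_eq[symmetric])
qed

lemma recursive_setI:
  assumes "rpred (\<lambda>n. n \<in> A)" shows "recursive_set A"
  using assms unfolding rpred_def rec1_def rec_on_def recursive_set_def by force

section \<open>Deciding truth under bounded quantification\<close>

text \<open>With tag \<open>a\<close> and contents \<open>b\<close>, the code
  \<open>triangle (a + b) + a\<close> is at least \<open>2 * a + b\<close>. Tag 0, which belongs to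
  \<open>Var\<close> and \<open>Eq\<close>, gives no strict decrease.\<close>

lemma psnd_less_tag: "pfst c \<noteq> 0 \<Longrightarrow> psnd c < c"
proof -
  assume "pfst c \<noteq> 0"
  moreover have "n \<le> triangle n" for n by (induction n) auto
  from this[of "pfst c + psnd c"] have "pfst c + psnd c + pfst c \<le> c"
    using pair_triangle[of "pfst c" "psnd c"] by simp
  ultimately show ?thesis by simp
qed

lemma subcode_less: "pfst c \<noteq> 0 \<Longrightarrow> pfst (psnd c) < c" "pfst c \<noteq> 0 \<Longrightarrow> psnd (psnd c) < c"
  using psnd_less_tag[of c] pfst_le[of "psnd c"] psnd_le[of "psnd c"] by linarith+

lemma code_tm_pair:
  "code_tm (Var n) = pair 0 n" "code_tm Emp = pair 1 0" "code_tm (Sing t) = pair 2 (code_tm t)"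
  "code_tm (s \<uplus> t) = pair 3 (pair (code_tm s) (code_tm t))"
  by (simp_all add: pair_def)

lemma code_fm_pair:
  "code_fm (s \<doteq> t) = pair 0 (pair (code_tm s) (code_tm t))"
  "code_fm (s \<sqsubseteq> t) = pair 1 (pair (code_tm s) (code_tm t))"
  "code_fm Bot = pair 2 0"
  "code_fm (p \<rightharpoonup> q) = pair 3 (pair (code_fm p) (code_fm q))"
  "code_fm (Forall p) = pair 4 (code_fm p)"
  by (simp_all add: pair_def)

declare code_tm.simps [simp del] code_fm.simps [simp del]

lemma pair_inject [simp]: "pair a b = pair c d \<longleftrightarrow> a = c \<and> b = d"
  by (simp add: pair_def)

text \<open>Assignments store each value plus one; the entry 0 marks a variable without
  value.\<close>

definition env :: "nat \<Rightarrow> nat \<Rightarrow> nat" where "env E n = lk E n - 1"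

lemma env_pair: "env (pair (Suc a) E) = case_nat a (env E)"
  by (rule ext) (simp add: env_def split: nat.split)

lemma rec1_pair_arg:
  assumes "rec1 (\<lambda>z. F (pfst z) (psnd z))" "rec1 f" "rec1 g"
  shows "rec1 (\<lambda>x. F (f x) (g x))"
  using rec1_rec1[OF assms(1) rec1_rec2[OF rec2_pair assms(2,3)]] by simp

lemma rpred_pair_arg:
  assumes "rpred (\<lambda>z. F (pfst z) (psnd z))" "rec1 f" "rec1 g"
  shows "rpred (\<lambda>x. F (f x) (g x))"
  using rec1_rec1[OF assms(1)[unfolded rpred_def] rec1_rec2[OF rec2_pair assms(2,3)]]
  by (simp add: rpred_def)

text \<open>The assumption \<open>bounded\<close> is the mathematical core of a decision procedure.
  It is asked only for assignments that cover the free variables: these are then less than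
  \<open>E\<close>, so a bound computed from \<open>E\<close> can account for their number. By
  \<open>bd_pos\<close> at least one recursive call is made, through which an ill-formed body is
  noticed.\<close>

locale bounded_struct =
  fixes M :: "nat struct" and bd :: "nat \<Rightarrow> nat \<Rightarrow> nat"
  assumes wf: "wf_struct M"
    and rec_sing: "rec1 (sing M)"
    and rec_plus: "rec1 (\<lambda>z. plus M (pfst z) (psnd z))"
    and rec_contained: "rpred (\<lambda>z. contained M (pfst z) (psnd z))"
    and rec_bd: "rec1 (\<lambda>z. bd (pfst z) (psnd z))"
    and bd_pos: "0 < bd c E"
    and bounded: "\<forall>n\<in>fv (Forall p). lk E n \<noteq> 0 \<Longrightarrow>
      (\<forall>a\<in>universe M. sat M (case_nat a (env E)) p) \<longleftrightarrow>
      (\<forall>a<bd (code_fm p) E. sat M (case_nat a (env E)) p)"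
begin

definition scoped :: "nat \<Rightarrow> nat set \<Rightarrow> bool" where "scoped E A \<longleftrightarrow> (\<forall>n\<in>A. lk E n \<noteq> 0)"

lemma scoped_simps [simp]:
  "scoped E {}" "scoped E {n} \<longleftrightarrow> lk E n \<noteq> 0" "scoped E (A \<union> B) \<longleftrightarrow> scoped E A \<and> scoped E B"
  by (auto simp: scoped_def)

text \<open>The values of the evaluators on codes are 1 for ill-formed or badly scoped input and
  otherwise are shifted by 2, since 0 stands for undefined.\<close>

definition tval :: "nat \<Rightarrow> nat \<Rightarrow> nat" where
  "tval c E = (if \<exists>t. c = code_tm t \<and> scoped E (fv_tm t)
     then Suc (Suc (val M (env E) (inv code_tm c))) else 1)"

definition fval :: "nat \<Rightarrow> nat \<Rightarrow> nat" where
  "fval c E = (if \<exists>p. c = code_fm p \<and> scoped E (fv p)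
     then if sat M (env E) (inv code_fm c) then 3 else 2 else 1)"

lemma inv_code [simp]: "inv code_tm (code_tm t) = t" "inv code_fm (code_fm p) = p"
  by (simp_all add: inv_f_f inj_def code_fm_inject)

lemma tval_code: "tval (code_tm t) E = (if scoped E (fv_tm t) then Suc (Suc (val M (env E) t)) else 1)"
  by (auto simp: tval_def)

lemma fval_code: "fval (code_fm p) E = (if scoped E (fv p) then if sat M (env E) p then 3 else 2 else 1)"
  by (auto simp: fval_def code_fm_inject)

lemma tval_no_code: "c \<notin> range code_tm \<Longrightarrow> tval c E = 1"
  by (auto simp: tval_def)

lemma fval_no_code: "c \<notin> range code_fm \<Longrightarrow> fval c E = 1"
  by (auto simp: fval_def)

lemma tval_nonzero [simp]: "tval c E \<noteq> 0" and fval_nonzero [simp]: "fval c E \<noteq> 0"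
  by (simp_all add: tval_def fval_def)

text \<open>In the variable case \<open>Suc (lk E d)\<close> is 1 for an unassigned variable and the
  shifted value otherwise. \<open>Emp\<close> is compared by its whole code, since tag 1 with other
  contents codes nothing.\<close>

definition tstep :: "(nat \<Rightarrow> nat) \<Rightarrow> nat \<Rightarrow> nat \<Rightarrow> nat \<Rightarrow> nat \<Rightarrow> nat" where
  "tstep g t d c E =
    (if t = 0 then Suc (lk E d)
     else if c = pair 1 0 then Suc (Suc (emp M))
     else if t = 2 then
       (if g (pair d E) = 0 then 0 else if g (pair d E) = 1 then 1
        else Suc (Suc (sing M (g (pair d E) - 2))))
     else if t = 3 then
       (if g (pair (pfst d) E) = 0 \<or> g (pair (psnd d) E) = 0 then 0
        else if g (pair (pfst d) E) = 1 \<or> g (pair (psnd d) E) = 1 then 1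
        else Suc (Suc (plus M (g (pair (pfst d) E) - 2) (g (pair (psnd d) E) - 2))))
     else 1)"

definition tdeps :: "nat \<Rightarrow> nat set" where
  "tdeps x = (let t = pfst (pfst x); d = psnd (pfst x); E = psnd x in
     if t = 2 then {pair d E} else if t = 3 then {pair (pfst d) E, pair (psnd d) E} else {})"

text \<open>If the input codes no term, either tag and contents fit no constructor, or some
  component codes no term and has value 1 itself.\<close>

lemma tstep_correct:
  assumes "\<And>y. y \<in> tdeps x \<Longrightarrow> g y = tval (pfst y) (psnd y)"
  shows "tstep g (pfst (pfst x)) (psnd (pfst x)) (pfst x) (psnd x) = tval (pfst x) (psnd x)"
proof (cases "pfst x \<in> range code_tm")
  case True
  then obtain t where t: "pfst x = code_tm t" by blast
  show ?thesis
  proof (cases t)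
    case (Var n)
    then show ?thesis using tval_code[of t] by (simp add: t tstep_def code_tm_pair env_def)
  next
    case Emp
    then show ?thesis using tval_code[of t] by (simp add: t tstep_def code_tm_pair)
  next
    case (Sing s)
    then have "g (pair (code_tm s) (psnd x)) = tval (code_tm s) (psnd x)"
      using assms by (simp add: tdeps_def t code_tm_pair)
    then show ?thesis using tval_code[of t] by (simp add: t Sing tstep_def code_tm_pair tval_code)
  next
    case (Plus s s')
    then have "g (pair (code_tm s) (psnd x)) = tval (code_tm s) (psnd x)"
      "g (pair (code_tm s') (psnd x)) = tval (code_tm s') (psnd x)"
      using assms by (simp_all add: tdeps_def Let_def t code_tm_pair)
    then show ?thesis using tval_code[of t] by (simp add: t Plus tstep_def code_tm_pair tval_code)
  qed
next
  case False
  let ?t = "pfst (pfst x)" and ?d = "psnd (pfst x)" and ?E = "psnd x"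
  have x: "pfst x = pair ?t ?d" by simp
  have no: "\<lbrakk>?t = a; ?d = b\<rbrakk> \<Longrightarrow> pair a b \<noteq> code_tm t" for a b t using False x by auto
  have 0: "?t \<noteq> 0" "pfst x \<noteq> pair 1 0"
    using no[of 0 ?d "Var ?d"] no[of 1 0 Emp] by (auto simp: code_tm_pair)
  have 1: "?t = 2 \<Longrightarrow> ?d \<notin> range code_tm"
    using no[of 2 _ "Sing s" for s] by (auto simp: code_tm_pair)
  have 2: "?t = 3 \<Longrightarrow> pfst ?d \<notin> range code_tm \<or> psnd ?d \<notin> range code_tm"
  proof (rule ccontr)
    assume "?t = 3" "\<not> (pfst ?d \<notin> range code_tm \<or> psnd ?d \<notin> range code_tm)"
    then obtain s s' where "pfst ?d = code_tm s" "psnd ?d = code_tm s'" by auto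
    then have "?d = pair (code_tm s) (code_tm s')" by (metis pair_pfst_psnd)
    with \<open>?t = 3\<close> no[of 3 _ "s \<uplus> s'"] show False by (simp add: code_tm_pair)
  qed
  from 0 1 2 assms show ?thesis
    by (auto simp: tstep_def tdeps_def Let_def tval_no_code False)
qed

lemma rec1_tval: "rec1 f \<Longrightarrow> rec1 g \<Longrightarrow> rec1 (\<lambda>x. tval (f x) (g x))"
proof (rule rec1_pair_arg[of tval])
  show "rec1 (\<lambda>z. tval (pfst z) (psnd z))"
  proof (rule rec1_table[where R = "measure pfst" and D = tdeps
      and step = "\<lambda>g x. tstep g (pfst (pfst x)) (psnd (pfst x)) (pfst x) (psnd x)"])
    show "rec1 (\<lambda>z. tstep (lk (pfst z)) (pfst (pfst (psnd z))) (psnd (pfst (psnd z))) (pfst (psnd z)) (psnd (psnd z)))"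
      unfolding tstep_def
      by (intro rec1_intros rec1_pair_arg[OF rec_plus] rec1_rec1[OF rec_sing])
    show "wf (measure pfst)" by simp
    show "tval (pfst x) (psnd x) \<noteq> 0" for x by simp
    show "finite (tdeps x)" for x by (simp add: tdeps_def Let_def)
    show "(y, x) \<in> measure pfst" if "y \<in> tdeps x" for x y
      using that by (auto simp: tdeps_def Let_def psnd_less_tag subcode_less split: if_splits)
    show "tstep g (pfst (pfst x)) (psnd (pfst x)) (pfst x) (psnd x) = 0" if "y \<in> tdeps x" "g y = 0" for g x y
      using that by (auto simp: tdeps_def tstep_def Let_def split: if_splits)
  qed (rule tstep_correct)
qed

text \<open>The value 2 is false and 3 is true. The tests for 0 and 1 precede the truth value even
  where one component would settle it: this makes the step strict and gives 1 to formulas with an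
  ill-formed part.\<close>

definition fstep :: "(nat \<Rightarrow> nat) \<Rightarrow> nat \<Rightarrow> nat \<Rightarrow> nat \<Rightarrow> nat \<Rightarrow> nat" where
  "fstep g t d c E =
    (if t = 0 then
       (if tval (pfst d) E = 1 \<or> tval (psnd d) E = 1 then 1
        else if tval (pfst d) E = tval (psnd d) E then 3 else 2)
     else if t = 1 then
       (if tval (pfst d) E = 1 \<or> tval (psnd d) E = 1 then 1
        else if contained M (tval (pfst d) E - 2) (tval (psnd d) E - 2) then 3 else 2)
     else if c = pair 2 0 then 2
     else if t = 3 then
       (if g (pair (pfst d) E) = 0 \<or> g (pair (psnd d) E) = 0 then 0
        else if g (pair (pfst d) E) = 1 \<or> g (pair (psnd d) E) = 1 then 1
        else if g (pair (pfst d) E) = 2 \<or> g (pair (psnd d) E) = 3 then 3 else 2)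
     else if t = 4 then
       (if \<exists>a<bd d E. g (pair d (pair (Suc a) E)) = 0 then 0
        else if \<exists>a<bd d E. g (pair d (pair (Suc a) E)) = 1 then 1
        else if \<forall>a<bd d E. g (pair d (pair (Suc a) E)) = 3 then 3 else 2)
     else 1)"

definition fdeps :: "nat \<Rightarrow> nat set" where
  "fdeps x = (let t = pfst (pfst x); d = psnd (pfst x); E = psnd x in
     if t = 3 then {pair (pfst d) E, pair (psnd d) E}
     else if t = 4 then (\<lambda>a. pair d (pair (Suc a) E)) ` {..<bd d E} else {})"

lemma scoped_pair: "scoped (pair (Suc a) E) (fv p) \<longleftrightarrow> scoped E (fv (Forall p))"
proof -
  have "lk (pair (Suc a) E) n \<noteq> 0 \<longleftrightarrow> (\<forall>m. n = Suc m \<longrightarrow> lk E m \<noteq> 0)" for n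
    by (cases n) auto
  then show ?thesis by (auto simp: scoped_def)
qed

lemma fstep_correct:
  assumes "\<And>y. y \<in> fdeps x \<Longrightarrow> g y = fval (pfst y) (psnd y)"
  shows "fstep g (pfst (pfst x)) (psnd (pfst x)) (pfst x) (psnd x) = fval (pfst x) (psnd x)"
proof (cases "pfst x \<in> range code_fm")
  case True
  then obtain p where p: "pfst x = code_fm p" by blast
  show ?thesis
  proof (cases p)
    case (Eq s t)
    then show ?thesis using fval_code[of p] by (simp add: p fstep_def code_fm_pair tval_code)
  next
    case (Cont s t)
    then show ?thesis using fval_code[of p] by (simp add: p fstep_def code_fm_pair tval_code)
  next
    case Bot
    then show ?thesis using fval_code[of p] by (simp add: p fstep_def code_fm_pair)
  next
    case (Imp q r)
    then have "g (pair (code_fm q) (psnd x)) = fval (code_fm q) (psnd x)"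
      "g (pair (code_fm r) (psnd x)) = fval (code_fm r) (psnd x)"
      using assms by (simp_all add: fdeps_def Let_def p code_fm_pair)
    then show ?thesis using fval_code[of p] by (simp add: p Imp fstep_def code_fm_pair fval_code)
  next
    case (Forall q)
    let ?E = "psnd x" let ?B = "bd (code_fm q) ?E"
    have g: "g (pair (code_fm q) (pair (Suc a) ?E))
        = (if scoped ?E (fv p) then if sat M (case_nat a (env ?E)) q then 3 else 2 else 1)" if "a < ?B" for a
      using assms that scoped_pair[of a ?E q]
      by (simp add: fdeps_def Let_def p Forall code_fm_pair fval_code env_pair del: fv.simps)
    have B: "\<exists>a. a < ?B" using bd_pos by blast
    show ?thesis
    proof (cases "scoped ?E (fv p)")
      case True
      then have "(\<forall>a\<in>universe M. sat M (case_nat a (env ?E)) q) \<longleftrightarrow>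
          (\<forall>a<?B. sat M (case_nat a (env ?E)) q)"
        using bounded unfolding Forall scoped_def by blast
      moreover have "\<not> (\<exists>a<?B. g (pair (code_fm q) (pair (Suc a) ?E)) = 0)"
        "\<not> (\<exists>a<?B. g (pair (code_fm q) (pair (Suc a) ?E)) = 1)"
        "(\<forall>a<?B. g (pair (code_fm q) (pair (Suc a) ?E)) = 3) \<longleftrightarrow> (\<forall>a<?B. sat M (case_nat a (env ?E)) q)"
        using True g by (auto split: if_splits)
      moreover have "fval (code_fm p) ?E = (if \<forall>a\<in>universe M. sat M (case_nat a (env ?E)) q then 3 else 2)"
        using True unfolding fval_code Forall by simp
      ultimately show ?thesis unfolding p fstep_def by (simp only: Forall code_fm_pair pfst_pair psnd_pair) simp
    next
      case False
      then have "\<not> (\<exists>a<?B. g (pair (code_fm q) (pair (Suc a) ?E)) = 0)"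
        "\<exists>a<?B. g (pair (code_fm q) (pair (Suc a) ?E)) = 1"
        using g B by auto
      moreover have "fval (code_fm p) ?E = 1" using False by (simp add: fval_code)
      ultimately show ?thesis unfolding p fstep_def by (simp only: Forall code_fm_pair pfst_pair psnd_pair) simp
    qed
  qed
next
  case False
  let ?t = "pfst (pfst x)" and ?d = "psnd (pfst x)" and ?E = "psnd x"
  have x: "pfst x = pair ?t ?d" by simp
  have no: "\<lbrakk>?t = a; ?d = b\<rbrakk> \<Longrightarrow> pair a b \<noteq> code_fm p" for a b p using False x by auto
  have tm2: "pfst ?d \<notin> range code_tm \<or> psnd ?d \<notin> range code_tm" if "?t = 0 \<or> ?t = 1"
  proof (rule ccontr)
    assume "\<not> (pfst ?d \<notin> range code_tm \<or> psnd ?d \<notin> range code_tm)"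
    then obtain s s' where "pfst ?d = code_tm s" "psnd ?d = code_tm s'" by auto
    then have "?d = pair (code_tm s) (code_tm s')" by (metis pair_pfst_psnd)
    with that no[of 0 _ "s \<doteq> s'"] no[of 1 _ "s \<sqsubseteq> s'"] show False by (auto simp: code_fm_pair)
  qed
  have 2: "pfst x \<noteq> pair 2 0"
    using no[of 2 0 Bot] by (auto simp: code_fm_pair)
  have 3: "?t = 3 \<Longrightarrow> pfst ?d \<notin> range code_fm \<or> psnd ?d \<notin> range code_fm"
  proof (rule ccontr)
    assume "?t = 3" "\<not> (pfst ?d \<notin> range code_fm \<or> psnd ?d \<notin> range code_fm)"
    then obtain p p' where "pfst ?d = code_fm p" "psnd ?d = code_fm p'" by auto
    then have "?d = pair (code_fm p) (code_fm p')" by (metis pair_pfst_psnd)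
    with \<open>?t = 3\<close> no[of 3 _ "p \<rightharpoonup> p'"] show False by (simp add: code_fm_pair)
  qed
  have 4: "?t = 4 \<Longrightarrow> ?d \<notin> range code_fm"
    using no[of 4 _ "Forall p" for p] by (auto simp: code_fm_pair)
  have "fstep g ?t ?d (pfst x) ?E = 1"
  proof (cases "?t = 4")
    case True
    \<comment> \<open>A body that codes no formula has value 1 under every assignment;
      \<open>bd_pos\<close> provides one such call.\<close>
    have "g (pair ?d (pair (Suc a) ?E)) = 1" if "a < bd ?d ?E" for a
      using assms that 4 True by (simp add: fdeps_def Let_def fval_no_code)
    then have "\<not> (\<exists>a<bd ?d ?E. g (pair ?d (pair (Suc a) ?E)) = 0)"
        "\<exists>a<bd ?d ?E. g (pair ?d (pair (Suc a) ?E)) = 1"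
      using bd_pos by auto
    then show ?thesis using 2 unfolding fstep_def by (simp only: True) simp
  next
    case not4: False
    show ?thesis
    proof (cases "?t = 3")
      case True
      then have "g (pair (pfst ?d) ?E) = fval (pfst ?d) ?E" "g (pair (psnd ?d) ?E) = fval (psnd ?d) ?E"
        using assms by (simp_all add: fdeps_def Let_def)
      then show ?thesis using 2 3[OF True] True by (auto simp: fstep_def fval_no_code)
    next
      case False
      have "tval (pfst ?d) ?E = 1 \<or> tval (psnd ?d) ?E = 1" if "?t = 0 \<or> ?t = 1"
        using tm2[OF that] tval_no_code by blast
      with 2 not4 False show ?thesis by (simp add: fstep_def)
    qed
  qed
  then show ?thesis by (simp add: fval_no_code False)
qed

lemma fdeps_smaller:
  assumes "y \<in> fdeps x" shows "pfst y < pfst x"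
proof (cases "pfst (pfst x) = 3 \<or> pfst (pfst x) = 4")
  case True
  then have "pfst (pfst x) \<noteq> 0" by auto
  note psnd_less_tag[OF this] subcode_less[OF this]
  then show ?thesis using assms by (auto simp: fdeps_def Let_def split: if_splits)
next
  case False
  then show ?thesis using assms by (simp add: fdeps_def Let_def)
qed

lemma fstep_strict:
  assumes "y \<in> fdeps x" "g y = 0"
  shows "fstep g (pfst (pfst x)) (psnd (pfst x)) (pfst x) (psnd x) = 0"
proof -
  have c: "pfst x \<noteq> pair 2 0" if "pfst (pfst x) = n" "n \<noteq> 2" for n
    using that by auto
  consider "pfst (pfst x) = 3" | "pfst (pfst x) = 4"
    using assms(1) by (auto simp: fdeps_def Let_def split: if_splits)
  then show ?thesis
  proof cases
    case 1
    then have "g (pair (pfst (psnd (pfst x))) (psnd x)) = 0 \<or> g (pair (psnd (psnd (pfst x))) (psnd x)) = 0"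
      using assms by (auto simp: fdeps_def Let_def)
    then show ?thesis using c[OF 1] 1 by (simp add: fstep_def)
  next
    case 2
    then have "\<exists>a<bd (psnd (pfst x)) (psnd x). g (pair (psnd (pfst x)) (pair (Suc a) (psnd x))) = 0"
      using assms by (auto simp: fdeps_def Let_def)
    then show ?thesis using c[OF 2] 2 unfolding fstep_def by simp
  qed
qed

lemma rec1_fval: "rec1 f \<Longrightarrow> rec1 g \<Longrightarrow> rec1 (\<lambda>x. fval (f x) (g x))"
proof (rule rec1_pair_arg[of fval])
  show "rec1 (\<lambda>z. fval (pfst z) (psnd z))"
  proof (rule rec1_table[where R = "measure pfst" and D = fdeps
      and step = "\<lambda>g x. fstep g (pfst (pfst x)) (psnd (pfst x)) (pfst x) (psnd x)"])
    show "rec1 (\<lambda>z. fstep (lk (pfst z)) (pfst (pfst (psnd z))) (psnd (pfst (psnd z))) (pfst (psnd z)) (psnd (psnd z)))"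
      unfolding fstep_def
      by (intro rec1_intros rec1_tval rpred_pair_arg[OF rec_contained] rec1_pair_arg[OF rec_bd])
    show "wf (measure pfst)" by simp
    show "fval (pfst x) (psnd x) \<noteq> 0" for x by simp
    show "finite (fdeps x)" for x by (simp add: fdeps_def Let_def)
    show "(y, x) \<in> measure pfst" if "y \<in> fdeps x" for x y
      using fdeps_smaller[OF that] by simp
  qed (fact fstep_strict, rule fstep_correct)
qed

text \<open>The number 0 is the assignment that covers no variable. Under it the value 3 tests three
  things at once: being a code, having no free variables, and truth.\<close>

theorem decidable_Th: "decidable_theory (Th M)"
  unfolding decidable_theory_def
proof (rule recursive_setI)
  have "M \<Turnstile> p \<longleftrightarrow> sat M (env 0) p" if "sentence p" for p
    unfolding sentence_holds_iff[OF that const_env[OF wf]]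
    by (rule sat_cong) (use that in \<open>simp add: sentence_def\<close>)
  then have fval_0: "fval (code_fm p) 0 = 3 \<longleftrightarrow> sentence p \<and> Th M \<turnstile> p" for p
    using Th_derives_iff[OF wf, of p] by (auto simp: fval_code scoped_def sentence_def)
  have "n \<in> code_fm ` {p. sentence p \<and> Th M \<turnstile> p} \<longleftrightarrow> fval n 0 = 3" for n
  proof (cases "n \<in> range code_fm")
    case True
    then show ?thesis by (auto simp: fval_0 code_fm_inject)
  next
    case False
    then show ?thesis by (auto simp: fval_no_code)
  qed
  moreover have "rpred (\<lambda>n. fval n 0 = 3)" by (intro rec1_intros rec1_fval)
  ultimately show "rpred (\<lambda>n. n \<in> code_fm ` {p. sentence p \<and> Th M \<turnstile> p})" by simp
qed

end

section \<open>Linear forms and quantifier bounds\<close>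

definition lin :: "nat \<Rightarrow> (nat \<Rightarrow> int) \<Rightarrow> (nat \<Rightarrow> int) \<Rightarrow> int" where
  "lin k \<alpha> e = (\<Sum>i<k. \<alpha> i * e i)"

text \<open>The back-and-forth invariant. Although the structures have no congruences in their
  language, residues must agree as well: they guarantee that a division by a coefficient possible
  over \<open>e\<close> is possible over \<open>e'\<close>.\<close>

definition lin_equiv :: "int \<Rightarrow> int \<Rightarrow> nat \<Rightarrow> (nat \<Rightarrow> int) \<Rightarrow> (nat \<Rightarrow> int) \<Rightarrow> bool" where
  "lin_equiv K D k e e' \<longleftrightarrow>
     (\<forall>\<alpha> \<beta>. (\<forall>i<k. \<bar>\<alpha> i\<bar> \<le> K) \<longrightarrow> \<bar>\<beta>\<bar> \<le> K \<longrightarrow> sgn (lin k \<alpha> e + \<beta>) = sgn (lin k \<alpha> e' + \<beta>)) \<and>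
     (\<forall>i<k. D dvd e i - e' i)"

lemma lin_equivD:
  "lin_equiv K D k e e' \<Longrightarrow> (\<And>i. i < k \<Longrightarrow> \<bar>\<alpha> i\<bar> \<le> K) \<Longrightarrow> \<bar>\<beta>\<bar> \<le> K \<Longrightarrow>
    sgn (lin k \<alpha> e + \<beta>) = sgn (lin k \<alpha> e' + \<beta>)"
  by (simp add: lin_equiv_def)

lemma lin_equiv_mono: "lin_equiv K D k e e' \<Longrightarrow> K' \<le> K \<Longrightarrow> D' dvd D \<Longrightarrow> lin_equiv K' D' k e e'"
  unfolding lin_equiv_def by (meson dvd_trans order_trans)

lemma lin_equiv_refl: "lin_equiv K D k e e"
  by (simp add: lin_equiv_def)

lemma lin_equiv_sym: "lin_equiv K D k e e' \<Longrightarrow> lin_equiv K D k e' e"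
  unfolding lin_equiv_def by (metis dvd_diff_commute)

lemma lin_equiv_trans:
  assumes "lin_equiv K D k e e'" "lin_equiv K D k e' e''"
  shows "lin_equiv K D k e e''"
proof -
  have "D dvd (e i - e' i) + (e' i - e'' i)" if "i < k" for i
    using assms that by (intro dvd_add) (auto simp: lin_equiv_def)
  then show ?thesis using assms by (simp add: lin_equiv_def)
qed

lemma lin_Suc: "lin (Suc k) \<alpha> (case_nat x e) = \<alpha> 0 * x + lin k (\<lambda>i. \<alpha> (Suc i)) e"
  by (simp add: lin_def sum.lessThan_Suc_shift del: sum.lessThan_Suc)

lemma lin_add: "lin k (\<lambda>i. \<alpha> i + \<beta> i) e = lin k \<alpha> e + lin k \<beta> e"
  by (simp add: lin_def sum.distrib algebra_simps)

lemma lin_scale: "lin k (\<lambda>i. c * \<alpha> i) e = c * lin k \<alpha> e"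
  by (simp add: lin_def sum_distrib_left algebra_simps)

lemma lin_minus: "lin k (\<lambda>i. - \<alpha> i) e = - lin k \<alpha> e"
  using lin_scale[of k "-1"] by simp

lemma lin_zero: "lin k (\<lambda>i. 0) e = 0"
  by (simp add: lin_def)

lemma lin_unit: "j < k \<Longrightarrow> lin k (\<lambda>i. if i = j then 1 else 0) e = e j"
  by (simp add: lin_def if_distrib[of "\<lambda>x. x * _"] cong: if_cong)

lemma lin_dvd_diff: "(\<And>i. i < k \<Longrightarrow> D dvd e i - e' i) \<Longrightarrow> D dvd lin k \<alpha> e - lin k \<alpha> e'"
  by (auto simp: lin_def sum_subtractf[symmetric] right_diff_distrib[symmetric] intro!: dvd_sum)

lemma lin_abs_le:
  assumes "\<And>i. i < k \<Longrightarrow> \<bar>\<alpha> i\<bar> \<le> K" "\<And>i. i < k \<Longrightarrow> \<bar>e i\<bar> \<le> m"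
  shows "\<bar>lin k \<alpha> e\<bar> \<le> K * (int k * m)"
proof -
  have "\<bar>lin k \<alpha> e\<bar> \<le> (\<Sum>i<k. \<bar>\<alpha> i * e i\<bar>)" unfolding lin_def by (rule sum_abs)
  also have "\<dots> \<le> (\<Sum>i<k. K * m)"
  proof (rule sum_mono)
    fix i assume "i \<in> {..<k}"
    then have i: "\<bar>\<alpha> i\<bar> \<le> K" "\<bar>e i\<bar> \<le> m" using assms by auto
    then show "\<bar>\<alpha> i * e i\<bar> \<le> K * m"
      unfolding abs_mult by (intro mult_mono) auto
  qed
  finally show ?thesis by (simp add: mult.left_commute)
qed

text \<open>Among the elements equivalent to \<open>x\<close> over \<open>e\<close>, one of least absolute value changes the sign
  of some form when it is moved by \<open>D\<close> towards 0, so it is within \<open>K * D\<close> of a root of that form.\<close>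

lemma lin_equiv_near_root:
  assumes "1 \<le> K" "1 \<le> D"
  obtains y a \<alpha> j where "lin_equiv K D (Suc k) (case_nat x e) (case_nat y e)" "a \<noteq> 0" "\<bar>a\<bar> \<le> K"
    "\<And>i. i < k \<Longrightarrow> \<bar>\<alpha> i\<bar> \<le> K" "\<bar>j\<bar> \<le> K + K * D" "a * y = lin k \<alpha> e + j"
proof -
  let ?P = "\<lambda>y. lin_equiv K D (Suc k) (case_nat x e) (case_nat y e)"
  have "?P x" by (rule lin_equiv_refl)
  then obtain y where y: "?P y" and least: "\<And>z. ?P z \<Longrightarrow> nat \<bar>y\<bar> \<le> nat \<bar>z\<bar>"
    by (rule exE[OF ex_has_least_nat[of ?P x "\<lambda>y. nat \<bar>y\<bar>"]]) blast
  show thesis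
  proof (cases "\<bar>y\<bar> < D")
    case True
    have "1 * D \<le> K * D" using assms by (intro mult_right_mono) auto
    with True assms have "\<bar>y\<bar> \<le> K + K * D" by linarith
    \<comment> \<open>Close to 0 the element solves the trivial equation
      \<open>1 * y = 0 + y\<close>.\<close>
    with assms show thesis
      by (intro that[OF y, of 1 "\<lambda>_. 0" y]) (auto simp: lin_zero)
  next
    case False
    define z where "z = y - sgn y * D"
    have "\<bar>z\<bar> < \<bar>y\<bar>" using False assms(2) by (auto simp: z_def sgn_if)
    then have "\<not> ?P z" using least[of z] by linarith
    then have "\<not> lin_equiv K D (Suc k) (case_nat y e) (case_nat z e)"
      using lin_equiv_trans[OF y] by blast
    moreover have "D dvd case_nat y e i - case_nat z e i" for i
      by (cases i) (simp_all add: z_def)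
    ultimately obtain \<alpha> \<beta> where \<alpha>: "\<And>i. i < Suc k \<Longrightarrow> \<bar>\<alpha> i\<bar> \<le> K" and \<beta>: "\<bar>\<beta>\<bar> \<le> K"
      and "sgn (lin (Suc k) \<alpha> (case_nat y e) + \<beta>) \<noteq> sgn (lin (Suc k) \<alpha> (case_nat z e) + \<beta>)"
      unfolding lin_equiv_def by blast
    then have sgn: "sgn (\<alpha> 0 * y + (lin k (\<lambda>i. \<alpha> (Suc i)) e + \<beta>))
        \<noteq> sgn (\<alpha> 0 * z + (lin k (\<lambda>i. \<alpha> (Suc i)) e + \<beta>))" (is "sgn (_ + ?R) \<noteq> _")
      by (simp add: lin_Suc algebra_simps)
    have "\<bar>\<alpha> 0\<bar> * D \<le> K * D" using \<alpha>[of 0] assms by simp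
    moreover have "\<bar>\<alpha> 0 * y - \<alpha> 0 * z\<bar> \<le> \<bar>\<alpha> 0\<bar> * D"
      using assms(2) by (auto simp: z_def right_diff_distrib abs_mult sgn_if)
    \<comment> \<open>Values of different sign have 0 between them, so neither exceeds their
      distance in absolute value.\<close>
    moreover have "\<bar>\<alpha> 0 * y + ?R\<bar> \<le> \<bar>\<alpha> 0 * y - \<alpha> 0 * z\<bar>"
      using sgn by (auto simp: sgn_if split: if_splits)
    ultimately have near: "\<bar>\<alpha> 0 * y + ?R\<bar> \<le> K * D" by linarith
    show thesis
    proof (rule that[OF y, of "\<alpha> 0" "\<lambda>i. - \<alpha> (Suc i)" "\<alpha> 0 * y + ?R - \<beta>"])
      show "\<alpha> 0 \<noteq> 0" using sgn by auto
      show "\<bar>\<alpha> 0 * y + ?R - \<beta>\<bar> \<le> K + K * D" using near \<beta> by linarith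
    qed (use \<alpha> in \<open>simp_all add: lin_minus\<close>)
  qed
qed

text \<open>The equation \<open>a * y = lin k \<alpha> e + j\<close> is solved again over
  \<open>e'\<close>: since \<open>a * D\<close> divides \<open>D'\<close>, the quotient
  \<open>y'\<close> exists and is congruent to \<open>y\<close>. Multiplied by \<open>a\<close>, a
  form in \<open>y\<close> and \<open>e\<close> becomes a form in \<open>e\<close> alone, with
  coefficients at most \<open>K * K + K * K\<close> and constant at most
  \<open>K * (K + K * D) + K * K\<close>, which is the origin of
  \<open>K * K * (D + 2)\<close>.\<close>

lemma lin_equiv_transfer:
  assumes equiv: "lin_equiv (K * K * (D + 2)) D' k e e'"
    and K: "1 \<le> K" "0 \<le> D" and D': "\<And>a. a \<noteq> 0 \<Longrightarrow> \<bar>a\<bar> \<le> K \<Longrightarrow> a * D dvd D'"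
    and a: "a \<noteq> 0" "\<bar>a\<bar> \<le> K" and \<alpha>: "\<And>i. i < k \<Longrightarrow> \<bar>\<alpha> i\<bar> \<le> K" and j: "\<bar>j\<bar> \<le> K + K * D"
    and y: "a * y = lin k \<alpha> e + j"
  shows "\<exists>y'. lin_equiv K D (Suc k) (case_nat y e) (case_nat y' e')"
proof -
  have dvd: "D' dvd e i - e' i" if "i < k" for i using equiv that by (simp add: lin_equiv_def)
  have aD: "a * D dvd lin k \<alpha> e - lin k \<alpha> e'"
    by (rule dvd_trans[OF D'[OF a] lin_dvd_diff]) (rule dvd)
  have "a dvd a * y - (lin k \<alpha> e - lin k \<alpha> e')"
    by (intro dvd_diff dvd_triv_left dvd_mult_left[OF aD])
  moreover have "a * y - (lin k \<alpha> e - lin k \<alpha> e') = lin k \<alpha> e' + j" using y by simp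
  ultimately obtain y' where y': "lin k \<alpha> e' + j = a * y'" by (metis dvdE)
  have "a * (y - y') = lin k \<alpha> e - lin k \<alpha> e'" using y y' by (simp add: right_diff_distrib)
  with aD have "a * D dvd a * (y - y')" by simp
  then have Dy: "D dvd y - y'" using a(1) by simp
  have "D dvd D'" using D'[of 1] K(1) by simp
  then have "D dvd case_nat y e i - case_nat y' e' i" if "i < Suc k" for i
    using that dvd Dy dvd_trans by (cases i) auto
  moreover have "sgn (lin (Suc k) \<gamma> (case_nat y e) + \<delta>) = sgn (lin (Suc k) \<gamma> (case_nat y' e') + \<delta>)"
    if \<gamma>: "\<forall>i<Suc k. \<bar>\<gamma> i\<bar> \<le> K" and \<delta>: "\<bar>\<delta>\<bar> \<le> K" for \<gamma> \<delta>
  proof -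
    let ?\<gamma> = "\<lambda>i. \<gamma> 0 * \<alpha> i + a * \<gamma> (Suc i)" and ?\<delta> = "\<gamma> 0 * j + a * \<delta>"
    have mul: "\<bar>u * v\<bar> \<le> K * w" if "\<bar>u\<bar> \<le> K" "\<bar>v\<bar> \<le> w" for u v w :: int
      unfolding abs_mult using that K by (intro mult_mono) auto
    have "\<bar>?\<gamma> i\<bar> \<le> K * K * (D + 2)" if "i < k" for i
    proof -
      have "\<bar>\<gamma> 0 * \<alpha> i\<bar> \<le> K * K" "\<bar>a * \<gamma> (Suc i)\<bar> \<le> K * K"
        using that \<gamma> \<alpha> a by (auto intro!: mul)
      moreover have "0 \<le> K * K * D" using K by simp
      ultimately show ?thesis by (simp add: distrib_left)
    qed
    moreover have "\<bar>?\<delta>\<bar> \<le> K * K * (D + 2)"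
    proof -
      have "\<bar>\<gamma> 0 * j\<bar> \<le> K * (K + K * D)" "\<bar>a * \<delta>\<bar> \<le> K * K"
        using \<gamma> \<delta> j a by (auto intro!: mul)
      then show ?thesis by (simp add: algebra_simps)
    qed
    ultimately have "sgn (lin k ?\<gamma> e + ?\<delta>) = sgn (lin k ?\<gamma> e' + ?\<delta>)"
      by (rule lin_equivD[OF equiv])
    moreover have "a * (lin (Suc k) \<gamma> (case_nat y e) + \<delta>) = lin k ?\<gamma> e + ?\<delta>"
    proof -
      have "a * (lin (Suc k) \<gamma> (case_nat y e) + \<delta>) = \<gamma> 0 * (a * y) + a * lin k (\<lambda>i. \<gamma> (Suc i)) e + a * \<delta>"
        by (simp add: lin_Suc algebra_simps)
      then show ?thesis unfolding y lin_add lin_scale by (simp add: algebra_simps)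
    qed
    moreover have "a * (lin (Suc k) \<gamma> (case_nat y' e') + \<delta>) = lin k ?\<gamma> e' + ?\<delta>"
    proof -
      have "a * (lin (Suc k) \<gamma> (case_nat y' e') + \<delta>) = \<gamma> 0 * (a * y') + a * lin k (\<lambda>i. \<gamma> (Suc i)) e' + a * \<delta>"
        by (simp add: lin_Suc algebra_simps)
      then show ?thesis unfolding y'[symmetric] lin_add lin_scale by (simp add: algebra_simps)
    qed
    ultimately have "sgn a * sgn (lin (Suc k) \<gamma> (case_nat y e) + \<delta>)
        = sgn a * sgn (lin (Suc k) \<gamma> (case_nat y' e') + \<delta>)"
      by (metis sgn_mult)
    then show ?thesis using a(1) by (simp add: sgn_0_0)
  qed
  ultimately show ?thesis unfolding lin_equiv_def by blast
qed

text \<open>\<open>bounds n\<close> codes the pair of the coefficient bound and the modulus at level \<open>n\<close>; each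
  level accommodates the elimination of one more quantifier.\<close>

definition bounds :: "nat \<Rightarrow> nat" where
  "bounds n = rec_nat (pair 1 1) (\<lambda>_ r. pair (pfst r * pfst r * (psnd r + 2)) (psnd r * fact (pfst r))) n"

definition cbound :: "nat \<Rightarrow> nat" where "cbound n = pfst (bounds n)"
definition modulus :: "nat \<Rightarrow> nat" where "modulus n = psnd (bounds n)"

lemma cbound_modulus_simps:
  "cbound 0 = 1" "modulus 0 = 1"
  "cbound (Suc n) = cbound n * cbound n * (modulus n + 2)"
  "modulus (Suc n) = modulus n * fact (cbound n)"
  by (simp_all add: cbound_def modulus_def bounds_def)

lemma modulus_pos: "1 \<le> modulus n"
  by (induction n) (simp_all add: cbound_modulus_simps)

lemma cbound_pos: "1 \<le> cbound n"
proof (induction n)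
  case (Suc n)
  then have "0 < cbound n * cbound n * (modulus n + 2)" by simp
  then show ?case by (simp only: cbound_modulus_simps Suc_le_eq One_nat_def)
qed (simp add: cbound_modulus_simps)

text \<open>Room for one term constructor: \<open>Sing\<close> at most doubles a form and adds 1,
  and adding or subtracting two forms at most doubles the bound. The modulus is positive, so the
  last factor of the recursion is at least 3.\<close>

lemma cbound_Suc_ge: "2 * cbound n + 1 \<le> cbound (Suc n)"
proof -
  have "cbound n * (cbound n * 3) \<le> cbound (Suc n)"
    using modulus_pos[of n] by (simp add: cbound_modulus_simps)
  moreover have "1 * (cbound n * 3) \<le> cbound n * (cbound n * 3)"
    using cbound_pos[of n] by (intro mult_le_mono1)
  ultimately show ?thesis using cbound_pos[of n] by linarith
qed

lemma cbound_mono: "m \<le> n \<Longrightarrow> cbound m \<le> cbound n"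
proof (rule lift_Suc_mono_le[of cbound])
  show "cbound n \<le> cbound (Suc n)" for n using cbound_Suc_ge[of n] by linarith
qed

lemma modulus_dvd: "m \<le> n \<Longrightarrow> modulus m dvd modulus n"
  by (induction n rule: dec_induct) (simp_all add: cbound_modulus_simps)

lemma rec1_fact: "rec1 f \<Longrightarrow> rec1 (\<lambda>x. fact (f x))"
proof -
  assume f: "rec1 f"
  have "fact n = rec_nat 1 (\<lambda>m r. Suc m * r) n" for n :: nat by (induction n) auto
  then show ?thesis by (simp only:) (intro rec1_rec_nat rec1_intros f)
qed

lemma rec1_bounds: "rec1 f \<Longrightarrow> rec1 (\<lambda>x. bounds (f x))"
  unfolding bounds_def by (intro rec1_rec_nat rec1_intros rec1_fact)

section \<open>One quantifier: matching a witness and making it small\<close>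

definition level_equiv :: "nat \<Rightarrow> nat \<Rightarrow> (nat \<Rightarrow> int) \<Rightarrow> (nat \<Rightarrow> int) \<Rightarrow> bool" where
  "level_equiv n = lin_equiv (int (cbound n)) (int (modulus n))"

lemma level_equiv_mono: "level_equiv n k e e' \<Longrightarrow> m \<le> n \<Longrightarrow> level_equiv m k e e'"
  unfolding level_equiv_def
  by (erule lin_equiv_mono) (simp_all add: cbound_mono modulus_dvd)

text \<open>The variable alone is a form with coefficient 1. Sign agreement keeps a matched element
  inside the structure when only nonnegative integers are present.\<close>

lemma level_equiv_sgn: "level_equiv n (Suc k) (case_nat x e) (case_nat y e') \<Longrightarrow> sgn x = sgn y"
  using lin_equivD[of "int (cbound n)" "int (modulus n)" "Suc k" "case_nat x e" "case_nat y e'"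
      "\<lambda>i. if i = 0 then 1 else 0" 0] cbound_pos[of n]
  by (simp add: level_equiv_def lin_unit)

lemma level_equiv_step:
  assumes "level_equiv (Suc n) k e e'"
  shows "\<exists>y'. level_equiv n (Suc k) (case_nat x e) (case_nat y' e')"
proof -
  let ?K = "int (cbound n)" and ?D = "int (modulus n)"
  have KD: "1 \<le> ?K" "1 \<le> ?D" using cbound_pos[of n] modulus_pos[of n] by simp_all
  obtain y a \<alpha> j where y: "lin_equiv ?K ?D (Suc k) (case_nat x e) (case_nat y e)" "a \<noteq> 0" "\<bar>a\<bar> \<le> ?K"
    "\<And>i. i < k \<Longrightarrow> \<bar>\<alpha> i\<bar> \<le> ?K" "\<bar>j\<bar> \<le> ?K + ?K * ?D" "a * y = lin k \<alpha> e + j"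
    using lin_equiv_near_root[OF KD] by blast
  \<comment> \<open>Every nonzero coefficient of absolute value at most \<open>cbound n\<close>
    divides \<open>fact (cbound n)\<close>, the factor put into the next modulus for this
    purpose.\<close>
  have "a * ?D dvd int (modulus (Suc n))" if "a \<noteq> 0" "\<bar>a\<bar> \<le> ?K" for a
  proof -
    have "nat \<bar>a\<bar> dvd fact (cbound n)" using that by (intro dvd_fact) auto
    then have "int (nat \<bar>a\<bar>) dvd int (fact (cbound n))" by (simp only: of_nat_dvd_iff)
    then have "a dvd int (fact (cbound n))" by simp
    then show ?thesis by (simp add: cbound_modulus_simps mult.commute mult_dvd_mono del: of_nat_fact)
  qed
  moreover have "lin_equiv (?K * ?K * (?D + 2)) (int (modulus (Suc n))) k e e'"
  proof -
    have "int (cbound (Suc n)) = ?K * ?K * (?D + 2)"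
      by (simp add: cbound_modulus_simps algebra_simps)
    then show ?thesis using assms by (simp only: level_equiv_def)
  qed
  ultimately obtain y' where "lin_equiv ?K ?D (Suc k) (case_nat y e) (case_nat y' e')"
    using lin_equiv_transfer[of ?K ?D "int (modulus (Suc n))" k e e' a \<alpha> j y] y(2-) KD by fastforce
  with y(1) show ?thesis unfolding level_equiv_def using lin_equiv_trans by blast
qed

text \<open>A root of a small form over bounded entries is bounded, since dividing by a nonzero
  integer does not enlarge it.\<close>

lemma level_equiv_small:
  assumes "\<And>i. i < k \<Longrightarrow> \<bar>e i\<bar> \<le> m"
  shows "\<exists>y. level_equiv n (Suc k) (case_nat x e) (case_nat y e) \<and>
    \<bar>y\<bar> \<le> int (cbound n) * (int k * m + 1 + int (modulus n))"
proof -
  let ?K = "int (cbound n)" and ?D = "int (modulus n)"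
  have KD: "1 \<le> ?K" "1 \<le> ?D" using cbound_pos[of n] modulus_pos[of n] by simp_all
  obtain y a \<alpha> j where y: "lin_equiv ?K ?D (Suc k) (case_nat x e) (case_nat y e)" "a \<noteq> 0" "\<bar>a\<bar> \<le> ?K"
    "\<And>i. i < k \<Longrightarrow> \<bar>\<alpha> i\<bar> \<le> ?K" "\<bar>j\<bar> \<le> ?K + ?K * ?D" "a * y = lin k \<alpha> e + j"
    using lin_equiv_near_root[OF KD] by blast
  have "\<bar>lin k \<alpha> e\<bar> \<le> ?K * (int k * m)" using y(4) assms by (intro lin_abs_le) auto
  moreover have "\<bar>y\<bar> \<le> \<bar>a * y\<bar>"
    using y(2) mult_right_mono[of 1 "\<bar>a\<bar>" "\<bar>y\<bar>"] by (simp add: abs_mult)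
  ultimately have "\<bar>y\<bar> \<le> ?K * (int k * m) + (?K + ?K * ?D)" using y(5,6) by linarith
  then show ?thesis using y(1) by (auto simp: level_equiv_def algebra_simps)
qed

text \<open>Elements are numbers that stand for integers through \<open>dec\<close>, in practice
  \<open>int\<close> or \<open>int_decode\<close>. By \<open>dec_range\<close> the sign alone
  decides whether an integer is present. In \<open>dec_plus\<close> the coefficients are chosen for
  both pairs at once, which admits \<open>max\<close>. The sign of \<open>dec y\<close> in
  \<open>contained_sgn\<close> lets containment depend on whether \<open>y\<close> is empty.
  \<open>le_dec\<close> turns bounds on integers into bounds on their codes.\<close>

locale linear_struct =
  fixes M :: "nat struct" and dec :: "nat \<Rightarrow> int" and a b :: int
  assumes universe: "universe M = UNIV"
    and dec_inject: "dec x = dec y \<longleftrightarrow> x = y"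
    and dec_range: "sgn u = sgn (dec x) \<Longrightarrow> u \<in> range dec"
    and dec_le: "\<bar>dec x\<bar> \<le> int x" and le_dec: "int x \<le> 2 * \<bar>dec x\<bar> + 1"
    and dec_emp: "dec (emp M) = 0"
    and dec_sing: "dec (sing M x) = a * dec x + b" and a: "\<bar>a\<bar> \<le> 2" and b: "\<bar>b\<bar> \<le> 1"
    and dec_plus: "sgn (dec x - dec y) = sgn (dec x' - dec y') \<Longrightarrow> \<exists>p q. \<bar>p\<bar> \<le> 1 \<and> \<bar>q\<bar> \<le> 1 \<and>
      dec (plus M x y) = p * dec x + q * dec y \<and> dec (plus M x' y') = p * dec x' + q * dec y'"
    and contained_sgn: "sgn (dec x - dec y) = sgn (dec x' - dec y') \<Longrightarrow> sgn (dec y) = sgn (dec y') \<Longrightarrow>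
      contained M x y \<longleftrightarrow> contained M x' y'"
    and recursive_sing: "rec1 (sing M)"
    and recursive_plus: "rec1 (\<lambda>z. plus M (pfst z) (psnd z))"
    and recursive_contained: "rpred (\<lambda>z. contained M (pfst z) (psnd z))"
begin

lemma wf_linear: "wf_struct M"
  by (simp add: wf_struct_def universe)

section \<open>Terms and formulas under equivalent assignments\<close>

lemma cbound_subcode: "m < n \<Longrightarrow> 2 * int (cbound m) + 1 \<le> int (cbound n)"
  using cbound_Suc_ge[of m] cbound_mono[of "Suc m" n] by linarith

lemma code_less:
  "code_tm t < code_tm (Sing t)" "code_tm s < code_tm (s \<uplus> t)" "code_tm t < code_tm (s \<uplus> t)"
  "code_tm s < code_fm (Cont s t)" "code_tm t < code_fm (Cont s t)"
  "code_fm p < code_fm (p \<rightharpoonup> q)" "code_fm q < code_fm (p \<rightharpoonup> q)" "code_fm p < code_fm (Forall p)"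
  using psnd_less_tag[of "code_tm (Sing t)"] subcode_less[of "code_tm (s \<uplus> t)"]
    subcode_less[of "code_fm (Cont s t)"] subcode_less[of "code_fm (p \<rightharpoonup> q)"] psnd_less_tag[of "code_fm (Forall p)"]
  by (simp_all add: code_tm_pair code_fm_pair)

text \<open>Equations have tag 0, so the inequality is weak: \<open>Var 0\<close> and its equation
  with itself both have code 0. Formulas are therefore compared at level
  \<open>Suc (code_fm p)\<close>.\<close>

lemma code_le: "code_tm s \<le> code_fm (Eq s t)" "code_tm t \<le> code_fm (Eq s t)"
  using pfst_le[of "pair (code_tm s) (code_tm t)"] psnd_le[of "pair (code_tm s) (code_tm t)"]
    psnd_le[of "pair 0 (pair (code_tm s) (code_tm t))"]
  by (simp_all add: code_fm_pair)

text \<open>The same coefficients describe both values, but they may depend on the pair of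
  assignments, since a term with \<open>max\<close> is linear only branch by branch.\<close>

definition form :: "nat \<Rightarrow> nat \<Rightarrow> (nat \<Rightarrow> nat) \<Rightarrow> (nat \<Rightarrow> nat) \<Rightarrow> nat \<Rightarrow> nat \<Rightarrow> bool" where
  "form n k e e' x x' \<longleftrightarrow> (\<exists>\<alpha> \<beta>. (\<forall>i<k. \<bar>\<alpha> i\<bar> \<le> int (cbound n)) \<and> \<bar>\<beta>\<bar> \<le> int (cbound n) \<and>
     dec x = lin k \<alpha> (\<lambda>i. dec (e i)) + \<beta> \<and> dec x' = lin k \<alpha> (\<lambda>i. dec (e' i)) + \<beta>)"

lemma formI:
  assumes "\<And>i. i < k \<Longrightarrow> \<bar>\<alpha> i\<bar> \<le> int (cbound n)" "\<bar>\<beta>\<bar> \<le> int (cbound n)"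
    "dec x = lin k \<alpha> (\<lambda>i. dec (e i)) + \<beta>" "dec x' = lin k \<alpha> (\<lambda>i. dec (e' i)) + \<beta>"
  shows "form n k e e' x x'"
  using assms by (auto simp: form_def)

text \<open>The difference is again one form, with coefficients at most
  \<open>cbound m + cbound m'\<close>.\<close>

lemma form_sgn_diff:
  assumes "form m k e e' x x'" "form m' k e e' y y'"
    and "2 * cbound m \<le> cbound n" "2 * cbound m' \<le> cbound n"
    and equiv: "level_equiv n k (\<lambda>i. dec (e i)) (\<lambda>i. dec (e' i))"
  shows "sgn (dec x - dec y) = sgn (dec x' - dec y')"
proof -
  obtain \<alpha> \<beta> where 1: "\<forall>i<k. \<bar>\<alpha> i\<bar> \<le> int (cbound m)" "\<bar>\<beta>\<bar> \<le> int (cbound m)"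
    "dec x = lin k \<alpha> (\<lambda>i. dec (e i)) + \<beta>" "dec x' = lin k \<alpha> (\<lambda>i. dec (e' i)) + \<beta>"
    using assms(1) by (auto simp: form_def)
  obtain \<gamma> \<delta> where 2: "\<forall>i<k. \<bar>\<gamma> i\<bar> \<le> int (cbound m')" "\<bar>\<delta>\<bar> \<le> int (cbound m')"
    "dec y = lin k \<gamma> (\<lambda>i. dec (e i)) + \<delta>" "dec y' = lin k \<gamma> (\<lambda>i. dec (e' i)) + \<delta>"
    using assms(2) by (auto simp: form_def)
  have "sgn (lin k (\<lambda>i. \<alpha> i + - \<gamma> i) (\<lambda>i. dec (e i)) + (\<beta> - \<delta>))
      = sgn (lin k (\<lambda>i. \<alpha> i + - \<gamma> i) (\<lambda>i. dec (e' i)) + (\<beta> - \<delta>))"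
  proof (rule lin_equivD[OF equiv[unfolded level_equiv_def]])
    show "\<bar>\<alpha> i + - \<gamma> i\<bar> \<le> int (cbound n)" if "i < k" for i
      using 1(1)[rule_format, OF that] 2(1)[rule_format, OF that] assms(3,4) by linarith
    show "\<bar>\<beta> - \<delta>\<bar> \<le> int (cbound n)" using 1(2) 2(2) assms(3,4) by linarith
  qed
  then show ?thesis unfolding 1(3,4) 2(3,4) lin_add lin_minus by (simp add: algebra_simps)
qed

lemma form_val:
  assumes "level_equiv (code_tm t) k (\<lambda>i. dec (e i)) (\<lambda>i. dec (e' i))" "fv_tm t \<subseteq> {..<k}"
  shows "form (code_tm t) k e e' (val M e t) (val M e' t)"
  using assms
proof (induction t)
  case (Var n)
  then show ?case using cbound_pos[of "code_tm (Var n)"]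
    by (intro formI[of k "\<lambda>i. if i = n then 1 else 0" _ 0]) (simp_all add: lin_unit)
next
  case Emp
  then show ?case
    by (intro formI[of k "\<lambda>i. 0" _ 0]) (simp_all add: lin_zero dec_emp)
next
  case (Sing t)
  have "form (code_tm t) k e e' (val M e t) (val M e' t)"
    using Sing code_less(1) by (auto intro: Sing.IH level_equiv_mono less_imp_le)
  then obtain \<alpha> \<beta> where 1: "\<forall>i<k. \<bar>\<alpha> i\<bar> \<le> int (cbound (code_tm t))" "\<bar>\<beta>\<bar> \<le> int (cbound (code_tm t))"
    "dec (val M e t) = lin k \<alpha> (\<lambda>i. dec (e i)) + \<beta>" "dec (val M e' t) = lin k \<alpha> (\<lambda>i. dec (e' i)) + \<beta>"
    by (auto simp: form_def)
  have a_mult: "\<bar>a * u\<bar> \<le> 2 * w" if "\<bar>u\<bar> \<le> w" for u w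
    unfolding abs_mult using a that by (intro mult_mono) auto
  note K = cbound_subcode[OF code_less(1)[of t]]
  show ?case
  proof (rule formI[of k "\<lambda>i. a * \<alpha> i" _ "a * \<beta> + b"])
    show "\<bar>a * \<alpha> i\<bar> \<le> int (cbound (code_tm (Sing t)))" if "i < k" for i
      using a_mult[OF 1(1)[rule_format, OF that]] K by linarith
    show "\<bar>a * \<beta> + b\<bar> \<le> int (cbound (code_tm (Sing t)))"
      using a_mult[OF 1(2)] b K by linarith
  qed (simp_all add: dec_sing 1 lin_scale algebra_simps)
next
  case (Plus s t)
  have f: "form (code_tm s) k e e' (val M e s) (val M e' s)" "form (code_tm t) k e e' (val M e t) (val M e' t)"
    using Plus.IH(1)[OF level_equiv_mono[OF Plus.prems(1) less_imp_le[OF code_less(2)]]]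
      Plus.IH(2)[OF level_equiv_mono[OF Plus.prems(1) less_imp_le[OF code_less(3)]]] Plus.prems(2)
    by simp_all
  note K = cbound_subcode[OF code_less(2)[of s t]] cbound_subcode[OF code_less(3)[of t s]]
  \<comment> \<open>Agreeing signs of the difference select the same linear branch of the sum under
    both assignments.\<close>
  have "sgn (dec (val M e s) - dec (val M e t)) = sgn (dec (val M e' s) - dec (val M e' t))"
    by (rule form_sgn_diff[OF f _ _ Plus.prems(1)]) (use K in linarith)+
  from dec_plus[OF this] obtain p q where pq: "\<bar>p\<bar> \<le> 1" "\<bar>q\<bar> \<le> 1"
    "dec (val M e (s \<uplus> t)) = p * dec (val M e s) + q * dec (val M e t)"
    "dec (val M e' (s \<uplus> t)) = p * dec (val M e' s) + q * dec (val M e' t)" by auto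
  obtain \<alpha> \<beta> where 1: "\<forall>i<k. \<bar>\<alpha> i\<bar> \<le> int (cbound (code_tm s))" "\<bar>\<beta>\<bar> \<le> int (cbound (code_tm s))"
    "dec (val M e s) = lin k \<alpha> (\<lambda>i. dec (e i)) + \<beta>" "dec (val M e' s) = lin k \<alpha> (\<lambda>i. dec (e' i)) + \<beta>"
    using f(1) by (auto simp: form_def)
  obtain \<gamma> \<delta> where 2: "\<forall>i<k. \<bar>\<gamma> i\<bar> \<le> int (cbound (code_tm t))" "\<bar>\<delta>\<bar> \<le> int (cbound (code_tm t))"
    "dec (val M e t) = lin k \<gamma> (\<lambda>i. dec (e i)) + \<delta>" "dec (val M e' t) = lin k \<gamma> (\<lambda>i. dec (e' i)) + \<delta>"
    using f(2) by (auto simp: form_def)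
  have mult: "\<bar>r * u\<bar> \<le> w" if "\<bar>r\<bar> \<le> 1" "\<bar>u\<bar> \<le> w" for r u w :: int
    using mult_mono[OF that(1) that(2)] by (simp add: abs_mult)
  show ?case
  proof (rule formI[of k "\<lambda>i. p * \<alpha> i + q * \<gamma> i" _ "p * \<beta> + q * \<delta>"])
    show "\<bar>p * \<alpha> i + q * \<gamma> i\<bar> \<le> int (cbound (code_tm (s \<uplus> t)))" if "i < k" for i
      using mult[OF pq(1) 1(1)[rule_format, OF that]] mult[OF pq(2) 2(1)[rule_format, OF that]] K
      by linarith
    show "\<bar>p * \<beta> + q * \<delta>\<bar> \<le> int (cbound (code_tm (s \<uplus> t)))"
      using mult[OF pq(1) 1(2)] mult[OF pq(2) 2(2)] K by linarith
  qed (simp_all only: pq(3,4) 1(3,4) 2(3,4) lin_add lin_scale, simp_all add: algebra_simps)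
qed

lemma sgn_val_diff:
  assumes "level_equiv n k (\<lambda>i. dec (e i)) (\<lambda>i. dec (e' i))"
    and "code_tm s < n" "code_tm t < n" "fv_tm s \<subseteq> {..<k}" "fv_tm t \<subseteq> {..<k}"
  shows "sgn (dec (val M e s) - dec (val M e t)) = sgn (dec (val M e' s) - dec (val M e' t))"
    and "sgn (dec (val M e t)) = sgn (dec (val M e' t))"
proof -
  note equiv = level_equiv_mono[OF assms(1) less_imp_le]
  note f = form_val[OF equiv[OF assms(2)] assms(4)] form_val[OF equiv[OF assms(3)] assms(5)]
  have K: "2 * cbound (code_tm s) \<le> cbound n" "2 * cbound (code_tm t) \<le> cbound n" "2 * cbound 0 \<le> cbound n"
    using cbound_subcode[OF assms(2)] cbound_subcode[OF assms(3)] cbound_subcode[of 0 n] assms(2)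
    by linarith+
  show "sgn (dec (val M e s) - dec (val M e t)) = sgn (dec (val M e' s) - dec (val M e' t))"
    by (rule form_sgn_diff[OF f K(1,2) assms(1)])
  \<comment> \<open>The empty element is the zero form, so the sign of one value is the sign of a
    difference of forms.\<close>
  have "form 0 k e e' (emp M) (emp M)"
    by (rule formI[of k "\<lambda>_. 0" _ 0]) (simp_all add: lin_zero dec_emp)
  from form_sgn_diff[OF f(2) this K(2,3) assms(1)]
  show "sgn (dec (val M e t)) = sgn (dec (val M e' t))" by (simp add: dec_emp)
qed

lemma dec_case_nat: "(\<lambda>i. dec (case_nat x e i)) = case_nat (dec x) (\<lambda>i. dec (e i))"
  by (rule ext) (simp split: nat.split)

lemma sat_level_equiv:
  "level_equiv (Suc (code_fm p)) k (\<lambda>i. dec (e i)) (\<lambda>i. dec (e' i)) \<Longrightarrow> fv p \<subseteq> {..<k} \<Longrightarrow>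
    sat M e p \<longleftrightarrow> sat M e' p"
proof (induction p arbitrary: k e e')
  case (Eq s t)
  have "sgn (dec (val M e s) - dec (val M e t)) = sgn (dec (val M e' s) - dec (val M e' t))"
    by (rule sgn_val_diff[OF Eq.prems(1)]) (use Eq.prems(2) code_le(1)[of s t] code_le(2)[of t s] in auto)
  then have "dec (val M e s) - dec (val M e t) = 0 \<longleftrightarrow> dec (val M e' s) - dec (val M e' t) = 0"
    by (metis sgn_0_0)
  then show ?case by (simp add: dec_inject)
next
  case (Cont s t)
  note sgns = sgn_val_diff[OF Cont.prems(1), of s t]
  show ?case unfolding sat.simps
    by (rule contained_sgn; rule sgns) (use Cont.prems(2) code_less(4,5)[of s t] code_less(4,5)[of t s] in auto)
next
  case Bot
  show ?case by simp
next
  case (Imp p q)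
  have "level_equiv (Suc (code_fm p)) k (\<lambda>i. dec (e i)) (\<lambda>i. dec (e' i))"
    "level_equiv (Suc (code_fm q)) k (\<lambda>i. dec (e i)) (\<lambda>i. dec (e' i))"
    using code_less(6)[of p q] code_less(7)[of q p] by (auto intro: level_equiv_mono[OF Imp.prems(1)])
  with Imp.IH Imp.prems(2) show ?case by fastforce
next
  case (Forall p)
  \<comment> \<open>Stated for arbitrary assignments and used in both directions by symmetry: an
    element \<open>x'\<close> over \<open>e'\<close> is answered by some \<open>x\<close> over
    \<open>e\<close>, one level lower.\<close>
  have imp: "sat M (case_nat x' e') p"
    if equiv: "level_equiv (Suc (code_fm (Forall p))) k (\<lambda>i. dec (e' i)) (\<lambda>i. dec (e i))"
      and all: "\<And>x. sat M (case_nat x e) p" for e e' x'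
  proof -
    have "level_equiv (Suc (Suc (code_fm p))) k (\<lambda>i. dec (e' i)) (\<lambda>i. dec (e i))"
      by (rule level_equiv_mono[OF equiv]) (use code_less(8)[of p] in simp)
    from level_equiv_step[OF this] obtain y where
      y: "level_equiv (Suc (code_fm p)) (Suc k) (case_nat (dec x') (\<lambda>i. dec (e' i))) (case_nat y (\<lambda>i. dec (e i)))"
      by blast
    from level_equiv_sgn[OF y] obtain x where x: "y = dec x" using dec_range[of y x'] by auto
    have "fv p \<subseteq> {..<Suc k}"
    proof
      fix n assume "n \<in> fv p"
      then show "n \<in> {..<Suc k}" using Forall.prems(2) by (cases n) auto
    qed
    from Forall.IH[OF y[unfolded x, folded dec_case_nat] this] all show ?thesis by simp
  qed
  have sym: "level_equiv (Suc (code_fm (Forall p))) k (\<lambda>i. dec (e' i)) (\<lambda>i. dec (e i))"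
    using Forall.prems(1) unfolding level_equiv_def by (rule lin_equiv_sym)
  show ?case using imp[OF sym] imp[OF Forall.prems(1)] by (auto simp: universe)
qed

text \<open>The bound on a small witness with \<open>E\<close> for both the number of variables and
  the size of their values; doubling and adding 2 passes from \<open>\<bar>dec z\<bar>\<close> to a
  strict bound on \<open>z\<close>, by \<open>le_dec\<close>.\<close>

definition bd :: "nat \<Rightarrow> nat \<Rightarrow> nat" where
  "bd c E = 2 * (cbound (Suc c) * (E * E + 1 + modulus (Suc c))) + 2"

lemma lk_le: "lk E n \<le> E"
proof -
  have "(psnd ^^ n) E \<le> E"
    by (induction n) (use psnd_le order_trans in auto)
  then show ?thesis using pfst_le order_trans unfolding lk_def by blast
qed

lemma bd_sufficient:
  assumes "\<forall>n\<in>fv (Forall p). lk E n \<noteq> 0"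
  shows "(\<forall>x. sat M (case_nat x (env E)) p) \<longleftrightarrow> (\<forall>x<bd (code_fm p) E. sat M (case_nat x (env E)) p)"
proof (intro iffI allI)
  fix x assume small: "\<forall>x<bd (code_fm p) E. sat M (case_nat x (env E)) p"
  let ?n = "Suc (code_fm p)" and ?e = "\<lambda>i. dec (env E i)"
  have "\<bar>?e i\<bar> \<le> int E" for i
    using dec_le[of "env E i"] lk_le[of E i] by (simp add: env_def)
  then obtain y where y: "level_equiv ?n (Suc E) (case_nat (dec x) ?e) (case_nat y ?e)"
    "\<bar>y\<bar> \<le> int (cbound ?n) * (int E * int E + 1 + int (modulus ?n))"
    using level_equiv_small[of E ?e "int E" ?n "dec x"] by auto
  from level_equiv_sgn[OF y(1)] obtain z where z: "y = dec z" using dec_range[of y x] by auto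
  have "int z \<le> 2 * \<bar>y\<bar> + 1" unfolding z by (rule le_dec)
  also have "\<dots> < int (bd (code_fm p) E)" using y(2) by (simp add: bd_def algebra_simps)
  finally have "sat M (case_nat z (env E)) p" using small by simp
  moreover have "fv p \<subseteq> {..<Suc E}"
  proof
    fix n assume "n \<in> fv p"
    then show "n \<in> {..<Suc E}" using assms by (cases n) (auto dest!: bspec intro: lk_nonzero_less)
  qed
  ultimately show "sat M (case_nat x (env E)) p"
    using sat_level_equiv[OF y(1)[unfolded z, folded dec_case_nat]] by blast
qed simp

lemma rec1_bd: "rec1 (\<lambda>z. bd (pfst z) (psnd z))"
  unfolding bd_def cbound_def modulus_def by (intro rec1_intros rec1_bounds)

sublocale bounded_struct M bd
  by unfold_locales
    (simp_all add: wf_linear recursive_sing recursive_plus recursive_contained rec1_bd bd_sufficient universe, simp add: bd_def)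

end

section \<open>The models\<close>

lemma independence:
  fixes M :: "nat struct"
  assumes wf: "wf_struct M" and ax: "\<And>j. j \<in> {1..9} \<Longrightarrow> j \<noteq> i \<Longrightarrow> M \<Turnstile> ax j" and not: "\<not> M \<Turnstile> ax i"
    and dec: "decidable_theory (Th M)" and rep: "finite (universe M) \<or> presburger_definable M"
  shows "\<not> (F_minus - {ax i}) \<turnstile> ax i \<and>
      (\<exists>T. extends T (F_minus - {ax i}) \<and> consistent_theory T \<and> complete_theory T \<and> decidable_theory T \<and>
        (\<exists>M :: nat struct. model_of M (F_minus - {ax i}) \<and> Th M = T \<and>
          (finite (universe M) \<or> presburger_definable M)))"
proof -
  have "M \<Turnstile> p" if "p \<in> F_minus - {ax i}" for p
  proof -
    from that obtain j where "p = ax j" "j \<in> {1..9}" "j \<noteq> i" unfolding F_minus_def by blast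
    with ax show ?thesis by blast
  qed
  then have M: "model_of M (F_minus - {ax i})" using wf by (simp add: model_of_def)
  with not soundness_model have "\<not> (F_minus - {ax i}) \<turnstile> ax i" by blast
  moreover note Th_extends[OF M] Th_consistent[OF wf] Th_complete[OF wf] dec M rep
  ultimately show ?thesis by blast
qed

lemma axiom_cases:
  assumes "j \<in> {1..9}"
  shows "j = 1 \<or> j = 2 \<or> j = 3 \<or> j = 4 \<or> j = 5 \<or> j = 6 \<or> j = 7 \<or> j = 8 \<or> j = (9 :: nat)"
  using assms by (simp only: atLeastAtMost_iff) presburger

section \<open>Formulas over (N, +)\<close>

definition PNot :: "pfm \<Rightarrow> pfm" where "PNot p = PImp p PBot"
definition POr :: "pfm \<Rightarrow> pfm \<Rightarrow> pfm" where "POr p q = PImp (PNot p) q"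
definition PAnd :: "pfm \<Rightarrow> pfm \<Rightarrow> pfm" where "PAnd p q = PNot (PImp p (PNot q))"
definition PEx :: "pfm \<Rightarrow> pfm" where "PEx p = PNot (PForall (PNot p))"
definition PZero :: "nat \<Rightarrow> pfm" where "PZero n = PEq (PAdd (PVar n) (PVar n)) (PVar n)"
text \<open>1 is the only nonzero number that is not a sum of two nonzero numbers;
  \<open>Suc (Suc n)\<close> addresses the variable from under two quantifiers.\<close>

definition POne :: "nat \<Rightarrow> pfm" where
  "POne n = PAnd (PNot (PZero n)) (PForall (PForall (PImp
     (PEq (PAdd (PVar 0) (PVar 1)) (PVar (Suc (Suc n)))) (POr (PZero 0) (PZero 1)))))"

lemma psat_connectives [simp]:
  "psat e (PNot p) \<longleftrightarrow> \<not> psat e p"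
  "psat e (POr p q) \<longleftrightarrow> psat e p \<or> psat e q"
  "psat e (PAnd p q) \<longleftrightarrow> psat e p \<and> psat e q"
  "psat e (PEx p) \<longleftrightarrow> (\<exists>a. psat (case_nat a e) p)"
  "psat e (PZero n) \<longleftrightarrow> e n = 0"
  by (auto simp: PNot_def POr_def PAnd_def PEx_def PZero_def)

lemma psat_POne [simp]: "psat e (POne n) \<longleftrightarrow> e n = 1"
proof -
  have "x \<noteq> 0 \<and> (\<forall>y z. z + y = x \<longrightarrow> z = 0 \<or> y = 0) \<longleftrightarrow> x = 1" for x :: nat
  proof
    assume x: "x \<noteq> 0 \<and> (\<forall>y z. z + y = x \<longrightarrow> z = 0 \<or> y = 0)"
    then have "1 + (x - 1) = x" by simp
    then have "x - 1 = 0" using x by (metis zero_neq_one)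
    then show "x = 1" using x by simp
  qed auto
  then show ?thesis by (simp add: POne_def)
qed

lemma pfv_connectives [simp]:
  "pfv (PNot p) = pfv p" "pfv (POr p q) = pfv p \<union> pfv q" "pfv (PAnd p q) = pfv p \<union> pfv q"
  "pfv (PEx p) = {n. Suc n \<in> pfv p}" "pfv (PZero n) = {n}" "pfv (POne n) = {n}"
  by (auto simp: PNot_def POr_def PAnd_def PEx_def PZero_def POne_def)

text \<open>Replaces lists by assignments, where the second and third tuple are the blocks shifted
  by \<open>k\<close> and \<open>2 * k\<close>; \<open>cong\<close> makes \<open>H\<close> depend on
  one block only. The domain consists of all \<open>k\<close>-tuples.\<close>

lemma presburger_definableI:
  fixes H :: "(nat \<Rightarrow> nat) \<Rightarrow> 'a"
  assumes k: "0 < k" and cong: "\<And>e e'. (\<And>i. i < k \<Longrightarrow> e i = e' i) \<Longrightarrow> H e = H e'"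
    and H: "range H = universe M"
    and eq: "pfv p_eq \<subseteq> {..<2 * k}" "\<And>e. psat e p_eq \<longleftrightarrow> H e = H (\<lambda>i. e (i + k))"
    and emp: "pfv p_emp \<subseteq> {..<k}" "\<And>e. psat e p_emp \<longleftrightarrow> H e = emp M"
    and sing: "pfv p_sing \<subseteq> {..<2 * k}" "\<And>e. psat e p_sing \<longleftrightarrow> sing M (H e) = H (\<lambda>i. e (i + k))"
    and plus: "pfv p_plus \<subseteq> {..<3 * k}"
      "\<And>e. psat e p_plus \<longleftrightarrow> plus M (H e) (H (\<lambda>i. e (i + k))) = H (\<lambda>i. e (i + 2 * k))"
    and cont: "pfv p_cont \<subseteq> {..<2 * k}" "\<And>e. psat e p_cont \<longleftrightarrow> contained M (H e) (H (\<lambda>i. e (i + k)))"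
  shows "presburger_definable M"
proof -
  define D :: "nat list set" where "D = {xs. length xs = k}"
  define h where "h xs = H (\<lambda>i. xs ! i)" for xs
  have h_append: "h (xs @ ys) = h xs" if "length xs = k" for xs ys
    unfolding h_def by (rule cong) (simp add: nth_append that)
  have h_drop: "H (\<lambda>i. (xs @ ys) ! (i + length xs)) = h ys" for xs ys
    unfolding h_def by (simp add: nth_append)
  have binary: "presburger_rel (2 * k) {xs @ ys |xs ys. xs \<in> D \<and> ys \<in> D \<and> R (h xs) (h ys)}"
    if "pfv p \<subseteq> {..<2 * k}" "\<And>e. psat e p \<longleftrightarrow> R (H e) (H (\<lambda>i. e (i + k)))" for p R
    unfolding presburger_rel_def
  proof (intro exI[of _ p] conjI that(1) set_eqI iffI)
    fix zs assume "zs \<in> {xs @ ys |xs ys. xs \<in> D \<and> ys \<in> D \<and> R (h xs) (h ys)}"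
    then obtain xs ys where zs: "zs = xs @ ys" "length xs = k" "length ys = k" "R (h xs) (h ys)"
      by (auto simp: D_def)
    then show "zs \<in> {xs. length xs = 2 * k \<and> psat ((!) xs) p}"
      using h_append[of xs ys] h_drop[of xs ys] by (simp add: that(2) h_def)
  next
    fix zs assume zs: "zs \<in> {xs. length xs = 2 * k \<and> psat ((!) xs) p}"
    let ?xs = "take k zs" and ?ys = "drop k zs"
    have "zs = ?xs @ ?ys" "length ?xs = k" "length ?ys = k" using zs by auto
    moreover from this have "R (h ?xs) (h ?ys)"
      using zs h_append[of ?xs ?ys] h_drop[of ?xs ?ys] that(2)[of "(!) zs"] by (simp add: h_def)
    ultimately show "zs \<in> {xs @ ys |xs ys. xs \<in> D \<and> ys \<in> D \<and> R (h xs) (h ys)}"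
      unfolding D_def by blast
  qed
  have ternary: "presburger_rel (3 * k) {xs @ ys @ zs |xs ys zs. xs \<in> D \<and> ys \<in> D \<and> zs \<in> D \<and> plus M (h xs) (h ys) = h zs}"
    unfolding presburger_rel_def
  proof (intro exI[of _ p_plus] conjI plus(1) set_eqI iffI)
    fix ws assume "ws \<in> {xs @ ys @ zs |xs ys zs. xs \<in> D \<and> ys \<in> D \<and> zs \<in> D \<and> plus M (h xs) (h ys) = h zs}"
    then obtain xs ys zs where ws: "ws = xs @ ys @ zs" "length xs = k" "length ys = k" "length zs = k"
      "plus M (h xs) (h ys) = h zs"
      by (auto simp: D_def)
    then show "ws \<in> {xs. length xs = 3 * k \<and> psat ((!) xs) p_plus}"
      using h_append[of xs "ys @ zs"] h_drop[of xs "ys @ zs"] h_append[of ys zs] h_drop[of "xs @ ys" zs]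
      by (simp add: plus(2) h_def mult_2)
  next
    fix ws assume ws: "ws \<in> {xs. length xs = 3 * k \<and> psat ((!) xs) p_plus}"
    let ?xs = "take k ws" and ?ys = "take k (drop k ws)" and ?zs = "drop (2 * k) ws"
    have split: "ws = ?xs @ ?ys @ ?zs"
      by (metis append_take_drop_id drop_drop mult_2)
    moreover have len: "length ?xs = k" "length ?ys = k" "length ?zs = k" using ws by auto
    moreover have "plus M (h ?xs) (h ?ys) = h ?zs"
      using ws plus(2)[of "(!) ws"] h_append[of ?xs "?ys @ ?zs"] h_drop[of ?xs "?ys @ ?zs"]
        h_append[of ?ys ?zs] h_drop[of "?xs @ ?ys" ?zs] split[symmetric] len
      by (simp add: h_def mult_2)
    ultimately show "ws \<in> {xs @ ys @ zs |xs ys zs. xs \<in> D \<and> ys \<in> D \<and> zs \<in> D \<and> plus M (h xs) (h ys) = h zs}"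
      unfolding D_def by blast
  qed
  have "h ` D = universe M"
  proof -
    have "H e \<in> h ` D" for e
      by (rule image_eqI[of _ _ "map e [0..<k]"]) (auto simp: h_def D_def intro: cong)
    then show ?thesis unfolding H[symmetric] by (auto simp: h_def)
  qed
  moreover have "presburger_rel k D"
    unfolding presburger_rel_def D_def
    by (rule exI[of _ "PEq (PVar 0) (PVar 0)"]) (use k in auto)
  moreover have "presburger_rel k {xs \<in> D. h xs = emp M}"
    unfolding presburger_rel_def D_def h_def
    by (rule exI[of _ p_emp]) (use emp in auto)
  ultimately show ?thesis
    unfolding presburger_definable_def
    using k binary[OF eq] binary[OF sing] ternary binary[OF cont] by blast
qed

lemma presburger_definable_nat:
  fixes M :: "nat struct"
  assumes "universe M = UNIV"
    and "pfv p_emp \<subseteq> {..<1}" "\<And>e. psat e p_emp \<longleftrightarrow> e 0 = emp M"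
    and "pfv p_sing \<subseteq> {..<2}" "\<And>e. psat e p_sing \<longleftrightarrow> sing M (e 0) = e 1"
    and "pfv p_plus \<subseteq> {..<3}" "\<And>e. psat e p_plus \<longleftrightarrow> plus M (e 0) (e 1) = e 2"
    and "pfv p_cont \<subseteq> {..<2}" "\<And>e. psat e p_cont \<longleftrightarrow> contained M (e 0) (e 1)"
  shows "presburger_definable M"
proof (rule presburger_definableI[of 1 "\<lambda>e. e 0" M "PEq (PVar 0) (PVar 1)" p_emp p_sing p_plus p_cont])
  show "range (\<lambda>e :: nat \<Rightarrow> nat. e 0) = universe M"
    using assms(1) by (auto intro: image_eqI[of _ _ "\<lambda>_. _"])
qed (use assms in \<open>auto simp: numeral_2_eq_2\<close>)

section \<open>The five structures\<close>

definition max_struct :: "nat struct" where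
  "max_struct = \<lparr>universe = UNIV, emp = 0, sing = Suc, plus = max, contained = (\<le>)\<rparr>"

definition point_struct :: "nat struct" where
  "point_struct = \<lparr>universe = {0}, emp = 0, sing = \<lambda>_. 0, plus = \<lambda>_ _. 0, contained = \<lambda>_ _. True\<rparr>"

text \<open>The group of integers, with \<open>\<langle>x\<rangle> = 2 * x + 1\<close>, along \<^const>\<open>int_decode\<close>.\<close>

definition int_struct :: "nat struct" where
  "int_struct = \<lparr>universe = UNIV, emp = 0,
     sing = \<lambda>x. if even x then 2 * x + 2 else 2 * x - 1,
     plus = \<lambda>x y. if even x then (if even y then x + y else if y < x then x - y - 1 else y - x)
       else (if even y then (if x < y then y - x - 1 else x - y) else x + y + 1),
     contained = \<lambda>_ _. True\<rparr>"

text \<open>F_9 leaves no choice for containment here: a nonzero \<open>t\<close> is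
  \<open>w + <u>\<close> for every \<open>u\<close>, so \<open>u\<close> may be \<open>x\<close>
  itself, and 0 contains only itself.\<close>

definition const_struct :: "nat struct" where
  "const_struct = \<lparr>universe = UNIV, emp = 0, sing = \<lambda>_. 1, plus = (+), contained = \<lambda>x y. x = y \<or> y \<noteq> 0\<rparr>"

definition succ_struct :: "nat struct" where
  "succ_struct = \<lparr>universe = UNIV, emp = 0, sing = Suc, plus = (+), contained = (\<le>)\<rparr>"

lemma range_int: "sgn u = sgn (int x) \<Longrightarrow> u \<in> range int"
  by (rule range_eqI[of _ _ "nat u"]) (auto simp: sgn_if split: if_splits)

lemma rec1_max: "rec1 (\<lambda>z. max (pfst z) (psnd z))"
  unfolding max_def by (intro rec1_intros)

lemma rpred_even: "rec1 f \<Longrightarrow> rpred (\<lambda>x. even (f x))"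
proof -
  assume f: "rec1 f"
  have "even n \<longleftrightarrow> (\<exists>m<Suc n. n = 2 * m)" for n :: nat by (auto elim!: evenE)
  then show ?thesis by (simp only:) (intro rec1_intros rec1_rec1[OF f])
qed

interpretation max_struct: linear_struct max_struct int 1 1
proof unfold_locales
  fix x y x' y' :: nat
  assume "sgn (int x - int y) = sgn (int x' - int y')"
  then have "x \<le> y \<longleftrightarrow> x' \<le> y'" by (auto simp: sgn_if split: if_splits)
  then consider "x \<le> y" "x' \<le> y'" | "y \<le> x" "y' \<le> x'" by linarith
  then show "\<exists>p q. \<bar>p\<bar> \<le> 1 \<and> \<bar>q\<bar> \<le> 1 \<and> int (plus max_struct x y) = p * int x + q * int y \<and>
      int (plus max_struct x' y') = p * int x' + q * int y'"
  proof cases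
    case 1
    then show ?thesis by (intro exI[of _ 0] exI[of _ 1]) (simp add: max_struct_def)
  next
    case 2
    then show ?thesis by (intro exI[of _ 1] exI[of _ 0]) (simp add: max_struct_def)
  qed
  show "contained max_struct x y = contained max_struct x' y'"
    using \<open>x \<le> y \<longleftrightarrow> x' \<le> y'\<close> by (simp add: max_struct_def)
qed (auto simp: max_struct_def range_int rec1_Suc rec1_max intro: rec1_intros)

interpretation const_struct: linear_struct const_struct int 0 1
proof unfold_locales
  fix x y x' y' :: nat
  show "\<exists>p q. \<bar>p\<bar> \<le> 1 \<and> \<bar>q\<bar> \<le> 1 \<and> int (plus const_struct x y) = p * int x + q * int y \<and>
      int (plus const_struct x' y') = p * int x' + q * int y'"
    by (intro exI[of _ 1]) (simp add: const_struct_def)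
  assume "sgn (int x - int y) = sgn (int x' - int y')" "sgn (int y) = sgn (int y')"
  then show "contained const_struct x y = contained const_struct x' y'"
    by (auto simp: const_struct_def sgn_if split: if_splits)
next
  show "rpred (\<lambda>z. contained const_struct (pfst z) (psnd z))"
    by (simp only: const_struct_def struct.simps) (intro rec1_intros)
  show "rec1 (\<lambda>z. plus const_struct (pfst z) (psnd z))"
    by (simp only: const_struct_def struct.simps) (intro rec1_intros)
qed (auto simp: const_struct_def range_int rec1_const)

interpretation succ_struct: linear_struct succ_struct int 1 1
proof unfold_locales
  fix x y x' y' :: nat
  show "\<exists>p q. \<bar>p\<bar> \<le> 1 \<and> \<bar>q\<bar> \<le> 1 \<and> int (plus succ_struct x y) = p * int x + q * int y \<and>
      int (plus succ_struct x' y') = p * int x' + q * int y'"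
    by (intro exI[of _ 1]) (simp add: succ_struct_def)
  assume "sgn (int x - int y) = sgn (int x' - int y')"
  then show "contained succ_struct x y = contained succ_struct x' y'"
    by (auto simp: succ_struct_def sgn_if split: if_splits)
next
  show "rpred (\<lambda>z. contained succ_struct (pfst z) (psnd z))"
    by (simp only: succ_struct_def struct.simps) (intro rec1_intros)
  show "rec1 (\<lambda>z. plus succ_struct (pfst z) (psnd z))"
    by (simp only: succ_struct_def struct.simps) (intro rec1_intros)
qed (auto simp: succ_struct_def range_int rec1_Suc)

lemma int_decode_even_odd: "int_decode n = (if even n then int (n div 2) else - int (n div 2) - 1)"
  by (simp add: int_decode_def sum_decode_def)

text \<open>Even codes are the nonnegative integers, odd codes the negative ones. For mixed parity
  the code \<open>2 * m\<close> meets \<open>2 * n + 1\<close>, the sum is \<open>m - n - 1\<close>,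
  and the comparison of \<open>n\<close> with \<open>m\<close> gives its sign, hence the parity of
  the result.\<close>

lemma int_decode_plus: "int_decode (plus int_struct x y) = int_decode x + int_decode y"
proof -
  have odd: "odd n \<Longrightarrow> \<exists>m. n = 2 * m + 1" for n :: nat by (auto elim: oddE)
  consider (ee) m n where "x = 2 * m" "y = 2 * n" | (eo) m n where "x = 2 * m" "y = 2 * n + 1"
    | (oe) m n where "x = 2 * m + 1" "y = 2 * n" | (oo) m n where "x = 2 * m + 1" "y = 2 * n + 1"
    by (metis evenE odd)
  then show ?thesis
  proof cases
    case ee
    then show ?thesis by (simp add: int_struct_def int_decode_even_odd)
  next
    case eo
    show ?thesis
    proof (cases "n < m")
      case True
      then have "2 * m - (2 * n + 1) - 1 = 2 * (m - n - 1)" by simp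
      with eo True show ?thesis by (simp add: int_struct_def int_decode_even_odd of_nat_diff)
    next
      case False
      then have "2 * n + 1 - 2 * m = 2 * (n - m) + 1" by simp
      with eo False show ?thesis by (simp add: int_struct_def int_decode_even_odd of_nat_diff)
    qed
  next
    case oe
    show ?thesis
    proof (cases "m < n")
      case True
      then have "2 * n - (2 * m + 1) - 1 = 2 * (n - m - 1)" by simp
      with oe True show ?thesis by (simp add: int_struct_def int_decode_even_odd of_nat_diff)
    next
      case False
      then have "2 * m + 1 - 2 * n = 2 * (m - n) + 1" by simp
      with oe False show ?thesis by (simp add: int_struct_def int_decode_even_odd of_nat_diff)
    qed
  next
    case oo
    then have "x + y + 1 = 2 * (m + n + 1) + 1" by simp
    with oo show ?thesis by (simp add: int_struct_def int_decode_even_odd)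
  qed
qed

lemma int_decode_sing: "int_decode (sing int_struct x) = 2 * int_decode x + 1"
proof (cases "even x")
  case True
  then obtain m where "x = 2 * m" by blast
  then show ?thesis by (simp add: int_struct_def int_decode_even_odd)
next
  case False
  then obtain m where m: "x = 2 * m + 1" by (blast elim: oddE)
  then have "2 * x - 1 = 2 * (2 * m) + 1" by simp
  with m show ?thesis by (simp add: int_struct_def int_decode_even_odd)
qed

lemma int_decode_0: "int_decode 0 = 0"
  by (simp add: int_decode_even_odd)

interpretation int_struct: linear_struct int_struct int_decode 2 1
proof unfold_locales
  show "int_decode x = int_decode y \<longleftrightarrow> x = y" for x y
    by (rule int_decode_eq)
  show "u \<in> range int_decode" for u
    by (simp add: surj_int_decode)
  fix x :: nat
  have "x = 2 * (x div 2) \<or> x = 2 * (x div 2) + 1" by presburger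
  then obtain m where "x = 2 * m \<or> x = 2 * m + 1" by blast
  then show "\<bar>int_decode x\<bar> \<le> int x" "int x \<le> 2 * \<bar>int_decode x\<bar> + 1"
    by (elim disjE; simp add: int_decode_even_odd)+
  fix y x' y' :: nat
  show "\<exists>p q. \<bar>p\<bar> \<le> 1 \<and> \<bar>q\<bar> \<le> 1 \<and>
      int_decode (plus int_struct x y) = p * int_decode x + q * int_decode y \<and>
      int_decode (plus int_struct x' y') = p * int_decode x' + q * int_decode y'"
    by (intro exI[of _ 1]) (simp add: int_decode_plus)
next
  show "rec1 (sing int_struct)"
    by (simp only: int_struct_def struct.simps) (intro rec1_intros rpred_even)
  show "rec1 (\<lambda>z. plus int_struct (pfst z) (psnd z))"
    by (simp only: int_struct_def struct.simps) (intro rec1_intros rpred_even)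
qed (simp_all add: int_struct_def int_decode_0 rpred_const int_decode_sing[unfolded int_struct_def, simplified])

interpretation point_struct: bounded_struct point_struct "\<lambda>_ _. 1"
proof unfold_locales
  fix p E
  show "(\<forall>a\<in>universe point_struct. sat point_struct (case_nat a (env E)) p) \<longleftrightarrow>
      (\<forall>a<1. sat point_struct (case_nat a (env E)) p)"
    by (simp add: point_struct_def)
qed (auto simp: point_struct_def wf_struct_def rec1_const rpred_const)

section \<open>The axioms in each structure\<close>

lemma max_struct_axioms:
  assumes "j \<in> {1..9}" "j \<noteq> 4" shows "max_struct \<Turnstile> ax j"
proof -
  have 1: "max_struct \<Turnstile> ax 1"
    unfolding holds_ax1[OF max_struct.wf] by (auto simp: max_struct_def max.assoc)
  have 2: "max_struct \<Turnstile> ax 2"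
    unfolding holds_ax2[OF max_struct.wf] by (auto simp: max_struct_def max.commute)
  have 3: "max_struct \<Turnstile> ax 3"
    unfolding holds_ax3[OF max_struct.wf] by (auto simp: max_struct_def)
  have 5: "max_struct \<Turnstile> ax 5"
    unfolding holds_ax5[OF max_struct.wf] by (auto simp: max_struct_def)
  have 6: "max_struct \<Turnstile> ax 6"
    unfolding holds_ax6[OF max_struct.wf] by (auto simp: max_struct_def max_def split: if_splits)
  have 7: "max_struct \<Turnstile> ax 7"
    unfolding holds_ax7[OF max_struct.wf] by (auto simp: max_struct_def)
  have 8: "max_struct \<Turnstile> ax 8"
    unfolding holds_ax8[OF max_struct.wf]
  proof (intro ballI impI)
    fix u v x w assume "plus max_struct u v = plus max_struct (sing max_struct x) w"
    \<comment> \<open>The maximum is attained at \<open>u\<close> or \<open>v\<close>, which is then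
      at least \<open>Suc x\<close> and can serve as its own \<open>w'\<close>.\<close>
    then have "u = max (Suc x) u \<or> v = max (Suc x) v" by (simp add: max_struct_def) linarith
    then show "\<exists>w'\<in>universe max_struct. u = plus max_struct (sing max_struct x) w' \<or>
        v = plus max_struct (sing max_struct x) w'"
      by (simp add: max_struct_def) metis
  qed
  have 9: "max_struct \<Turnstile> ax 9"
    unfolding holds_ax9[OF max_struct.wf]
  proof (intro ballI)
    fix x t :: nat
    have "t = max 0 (Suc (t - 1)) \<and> x \<le> t - 1" if "x < t" using that by simp
    then have "x \<le> t \<longleftrightarrow> x = t \<or> (\<exists>w u. t = max w (Suc u) \<and> x \<le> u)"
      by (metis le_SucI le_eq_less_or_eq max.coboundedI2)
    then show "contained max_struct x t \<longleftrightarrow> x = t \<or> (\<exists>w\<in>universe max_struct. \<exists>u\<in>universe max_struct.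
        t = plus max_struct w (sing max_struct u) \<and> contained max_struct x u)"
      by (simp add: max_struct_def)
  qed
  show ?thesis
    using axiom_cases[OF assms(1)] assms(2) 1 2 3 5 6 7 8 9 by (elim disjE) (simp_all only:)
qed

lemma const_struct_axioms:
  assumes "j \<in> {1..9}" "j \<noteq> 7" shows "const_struct \<Turnstile> ax j"
proof -
  have 1: "const_struct \<Turnstile> ax 1"
    unfolding holds_ax1[OF const_struct.wf] by (auto simp: const_struct_def)
  have 2: "const_struct \<Turnstile> ax 2"
    unfolding holds_ax2[OF const_struct.wf] by (auto simp: const_struct_def)
  have 3: "const_struct \<Turnstile> ax 3"
    unfolding holds_ax3[OF const_struct.wf] by (auto simp: const_struct_def)
  have 4: "const_struct \<Turnstile> ax 4"
    unfolding holds_ax4[OF const_struct.wf] by (auto simp: const_struct_def)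
  have 5: "const_struct \<Turnstile> ax 5"
    unfolding holds_ax5[OF const_struct.wf] by (auto simp: const_struct_def)
  have 6: "const_struct \<Turnstile> ax 6"
    unfolding holds_ax6[OF const_struct.wf] by (auto simp: const_struct_def)
  have 8: "const_struct \<Turnstile> ax 8"
    unfolding holds_ax8[OF const_struct.wf]
  proof (intro ballI impI)
    fix u v x w assume "plus const_struct u v = plus const_struct (sing const_struct x) w"
    then have "u = 1 + (u - 1) \<or> v = 1 + (v - 1)" by (simp add: const_struct_def) linarith
    then show "\<exists>w'\<in>universe const_struct. u = plus const_struct (sing const_struct x) w' \<or>
        v = plus const_struct (sing const_struct x) w'"
      by (simp add: const_struct_def) metis
  qed
  have 9: "const_struct \<Turnstile> ax 9"
    unfolding holds_ax9[OF const_struct.wf]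
  proof (intro ballI)
    fix x t :: nat
    have "t = t - 1 + 1" if "t \<noteq> 0" using that by simp
    then have "x = t \<or> t \<noteq> 0 \<longleftrightarrow> x = t \<or> (\<exists>w u. t = w + 1 \<and> (x = u \<or> u \<noteq> 0))"
      by (metis add_eq_0_iff_both_eq_0 zero_neq_one)
    then show "contained const_struct x t \<longleftrightarrow> x = t \<or> (\<exists>w\<in>universe const_struct. \<exists>u\<in>universe const_struct.
        t = plus const_struct w (sing const_struct u) \<and> contained const_struct x u)"
      by (simp add: const_struct_def)
  qed
  show ?thesis
    using axiom_cases[OF assms(1)] assms(2) 1 2 3 4 5 6 8 9 by (elim disjE) (simp_all only:)
qed

lemma succ_struct_axioms:
  assumes "j \<in> {1..9}" "j \<noteq> 8" shows "succ_struct \<Turnstile> ax j"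
proof -
  have 1: "succ_struct \<Turnstile> ax 1"
    unfolding holds_ax1[OF succ_struct.wf] by (auto simp: succ_struct_def)
  have 2: "succ_struct \<Turnstile> ax 2"
    unfolding holds_ax2[OF succ_struct.wf] by (auto simp: succ_struct_def)
  have 3: "succ_struct \<Turnstile> ax 3"
    unfolding holds_ax3[OF succ_struct.wf] by (auto simp: succ_struct_def)
  have 4: "succ_struct \<Turnstile> ax 4"
    unfolding holds_ax4[OF succ_struct.wf] by (auto simp: succ_struct_def)
  have 5: "succ_struct \<Turnstile> ax 5"
    unfolding holds_ax5[OF succ_struct.wf] by (auto simp: succ_struct_def)
  have 6: "succ_struct \<Turnstile> ax 6"
    unfolding holds_ax6[OF succ_struct.wf] by (auto simp: succ_struct_def)
  have 7: "succ_struct \<Turnstile> ax 7"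
    unfolding holds_ax7[OF succ_struct.wf] by (auto simp: succ_struct_def)
  have 9: "succ_struct \<Turnstile> ax 9"
    unfolding holds_ax9[OF succ_struct.wf]
  proof (intro ballI)
    fix x t :: nat
    have "t = 0 + Suc (t - 1) \<and> x \<le> t - 1" if "x < t" using that by simp
    then have "x \<le> t \<longleftrightarrow> x = t \<or> (\<exists>w u. t = w + Suc u \<and> x \<le> u)"
      by (metis le_SucI le_eq_less_or_eq trans_le_add2)
    then show "contained succ_struct x t \<longleftrightarrow> x = t \<or> (\<exists>w\<in>universe succ_struct. \<exists>u\<in>universe succ_struct.
        t = plus succ_struct w (sing succ_struct u) \<and> contained succ_struct x u)"
      by (simp add: succ_struct_def)
  qed
  show ?thesis
    using axiom_cases[OF assms(1)] assms(2) 1 2 3 4 5 6 7 9 by (elim disjE) (simp_all only:)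
qed

lemma point_struct_axioms:
  assumes "j \<in> {1..9}" "j \<noteq> 5" shows "point_struct \<Turnstile> ax j"
proof -
  have 1: "point_struct \<Turnstile> ax 1"
    unfolding holds_ax1[OF point_struct.wf] by (auto simp: point_struct_def)
  have 2: "point_struct \<Turnstile> ax 2"
    unfolding holds_ax2[OF point_struct.wf] by (auto simp: point_struct_def)
  have 3: "point_struct \<Turnstile> ax 3"
    unfolding holds_ax3[OF point_struct.wf] by (auto simp: point_struct_def)
  have 4: "point_struct \<Turnstile> ax 4"
    unfolding holds_ax4[OF point_struct.wf] by (auto simp: point_struct_def)
  have 6: "point_struct \<Turnstile> ax 6"
    unfolding holds_ax6[OF point_struct.wf] by (auto simp: point_struct_def)
  have 7: "point_struct \<Turnstile> ax 7"
    unfolding holds_ax7[OF point_struct.wf] by (auto simp: point_struct_def)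
  have 8: "point_struct \<Turnstile> ax 8"
    unfolding holds_ax8[OF point_struct.wf] by (auto simp: point_struct_def)
  have 9: "point_struct \<Turnstile> ax 9"
    unfolding holds_ax9[OF point_struct.wf] by (auto simp: point_struct_def)
  show ?thesis
    using axiom_cases[OF assms(1)] assms(2) 1 2 3 4 6 7 8 9 by (elim disjE) (simp_all only:)
qed

lemma int_struct_eq_iff: "x = y \<longleftrightarrow> int_decode x = int_decode y"
  by (simp add: int_decode_eq)

lemma int_struct_axioms:
  assumes "j \<in> {1..9}" "j \<noteq> 6" shows "int_struct \<Turnstile> ax j"
proof -
  \<comment> \<open>In a group every \<open>u\<close> is a sum with any prescribed \<open>v\<close>.
    F_8 is then immediate, and so is F_9, because containment is total.\<close>
  have split: "u = plus int_struct v (int_encode (int_decode u - int_decode v))" for u v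
    by (simp add: int_struct_eq_iff int_decode_plus)
  have emp: "emp int_struct = 0" by (simp add: int_struct_def)
  have odd: "2 * z + 1 \<noteq> (0 :: int)" for z by presburger
  have 1: "int_struct \<Turnstile> ax 1"
    unfolding holds_ax1[OF int_struct.wf]
    by (simp add: int_struct_eq_iff int_decode_plus int_decode_sing emp int_decode_0 odd)
  have 2: "int_struct \<Turnstile> ax 2"
    unfolding holds_ax2[OF int_struct.wf]
    by (simp add: int_struct_eq_iff int_decode_plus int_decode_sing emp int_decode_0 odd)
  have 3: "int_struct \<Turnstile> ax 3"
    unfolding holds_ax3[OF int_struct.wf]
    by (simp add: int_struct_eq_iff int_decode_plus int_decode_sing emp int_decode_0 odd)
  have 4: "int_struct \<Turnstile> ax 4"
    unfolding holds_ax4[OF int_struct.wf]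
    by (simp add: int_struct_eq_iff int_decode_plus int_decode_sing emp int_decode_0 odd)
  have 5: "int_struct \<Turnstile> ax 5"
    unfolding holds_ax5[OF int_struct.wf]
    by (simp add: int_struct_eq_iff int_decode_plus int_decode_sing emp int_decode_0 odd)
  have 7: "int_struct \<Turnstile> ax 7"
    unfolding holds_ax7[OF int_struct.wf]
    by (simp add: int_struct_eq_iff int_decode_plus int_decode_sing emp int_decode_0 odd)
  have 8: "int_struct \<Turnstile> ax 8"
    unfolding holds_ax8[OF int_struct.wf] using split int_struct.universe by blast
  have 9: "int_struct \<Turnstile> ax 9"
    unfolding holds_ax9[OF int_struct.wf]
  proof (intro ballI)
    fix x t
    have "t = plus int_struct (int_encode (int_decode t - int_decode (sing int_struct 0))) (sing int_struct 0)"
      by (simp add: int_struct_eq_iff int_decode_plus)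
    moreover have "contained int_struct u v" for u v by (simp add: int_struct_def)
    ultimately show "contained int_struct x t \<longleftrightarrow> x = t \<or> (\<exists>w\<in>universe int_struct. \<exists>u\<in>universe int_struct.
        t = plus int_struct w (sing int_struct u) \<and> contained int_struct x u)"
      using int_struct.universe by blast
  qed
  show ?thesis
    using axiom_cases[OF assms(1)] assms(2) 1 2 3 4 5 7 8 9 by (elim disjE) (simp_all only:)
qed

section \<open>Interpretations in (N, +)\<close>

lemma ex_add_eq: "(\<exists>a. x + a = y) \<longleftrightarrow> x \<le> (y :: nat)"
  by (auto simp: le_iff_add)

lemma max_struct_definable: "presburger_definable max_struct"
proof (rule presburger_definable_nat)
  show "psat e (PZero 0) \<longleftrightarrow> e 0 = emp max_struct" for e
    by (simp add: max_struct_def)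
  show "psat e (PEx (PAnd (POne 0) (PEq (PAdd (PVar 1) (PVar 0)) (PVar 2)))) \<longleftrightarrow> sing max_struct (e 0) = e 1" for e
    by (simp add: max_struct_def numeral_2_eq_2)
  \<comment> \<open>Inside \<open>PEx\<close> the free indices are one higher: the two existential
    formulas compare \<open>e 0\<close> with \<open>e 1\<close>, whereas the equations outside name
    the result \<open>e 2\<close>.\<close>
  show "psat e (POr (PAnd (PEx (PEq (PAdd (PVar 1) (PVar 0)) (PVar 2))) (PEq (PVar 1) (PVar 2)))
      (PAnd (PEx (PEq (PAdd (PVar 2) (PVar 0)) (PVar 1))) (PEq (PVar 0) (PVar 2))))
    \<longleftrightarrow> plus max_struct (e 0) (e 1) = e 2" for e
    by (auto simp: max_struct_def numeral_2_eq_2 max_def ex_add_eq)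
  show "psat e (PEx (PEq (PAdd (PVar 1) (PVar 0)) (PVar 2))) \<longleftrightarrow> contained max_struct (e 0) (e 1)" for e
    by (auto simp: max_struct_def numeral_2_eq_2 ex_add_eq)
qed (auto simp: max_struct_def)

lemma const_struct_definable: "presburger_definable const_struct"
proof (rule presburger_definable_nat)
  show "psat e (PZero 0) \<longleftrightarrow> e 0 = emp const_struct" for e
    by (simp add: const_struct_def)
  show "psat e (POne 1) \<longleftrightarrow> sing const_struct (e 0) = e 1" for e
    by (auto simp: const_struct_def)
  show "psat e (PEq (PAdd (PVar 0) (PVar 1)) (PVar 2)) \<longleftrightarrow> plus const_struct (e 0) (e 1) = e 2" for e
    by (simp add: const_struct_def)
  show "psat e (POr (PEq (PVar 0) (PVar 1)) (PNot (PZero 1))) \<longleftrightarrow> contained const_struct (e 0) (e 1)" for e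
    by (simp add: const_struct_def)
qed (auto simp: const_struct_def)

lemma succ_struct_definable: "presburger_definable succ_struct"
proof (rule presburger_definable_nat)
  show "psat e (PZero 0) \<longleftrightarrow> e 0 = emp succ_struct" for e
    by (simp add: succ_struct_def)
  show "psat e (PEx (PAnd (POne 0) (PEq (PAdd (PVar 1) (PVar 0)) (PVar 2)))) \<longleftrightarrow> sing succ_struct (e 0) = e 1" for e
    by (simp add: succ_struct_def numeral_2_eq_2)
  show "psat e (PEq (PAdd (PVar 0) (PVar 1)) (PVar 2)) \<longleftrightarrow> plus succ_struct (e 0) (e 1) = e 2" for e
    by (simp add: succ_struct_def)
  show "psat e (PEx (PEq (PAdd (PVar 1) (PVar 0)) (PVar 2))) \<longleftrightarrow> contained succ_struct (e 0) (e 1)" for e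
    by (auto simp: succ_struct_def numeral_2_eq_2 ex_add_eq)
qed (auto simp: succ_struct_def)

lemma int_struct_encode:
  "plus int_struct (int_encode u) (int_encode v) = int_encode (u + v)"
  "sing int_struct (int_encode u) = int_encode (2 * u + 1)"
  "emp int_struct = int_encode 0"
  by (simp_all only: int_struct_eq_iff int_decode_plus int_decode_sing int_struct.dec_emp int_encode_inverse)

text \<open>Integers are differences of naturals, so the interpretation has dimension 2 and a proper
  equality: the pairs (a, b) and (c, d) agree iff a + d = c + b. All equations are rearranged into
  sums of naturals in this way.\<close>

lemma int_struct_definable: "presburger_definable int_struct"
proof (rule presburger_definableI)
  let ?H = "\<lambda>e :: nat \<Rightarrow> nat. int_encode (int (e 0) - int (e 1))"
  show "0 < (2 :: nat)" by simp
  show "(\<And>i. i < 2 \<Longrightarrow> e i = e' i) \<Longrightarrow> ?H e = ?H e'" for e e' by simp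
  have "n \<in> range ?H" for n
  proof (cases "0 \<le> int_decode n")
    case True
    then show ?thesis by (intro image_eqI[of _ _ "case_nat (nat (int_decode n)) (\<lambda>_. 0)"]) simp_all
  next
    case False
    then show ?thesis by (intro image_eqI[of _ _ "case_nat 0 (\<lambda>_. nat (- int_decode n))"]) simp_all
  qed
  then show "range ?H = universe int_struct" using int_struct.universe by auto
  show "psat e (PEq (PAdd (PVar 0) (PVar 3)) (PAdd (PVar 2) (PVar 1))) \<longleftrightarrow> ?H e = ?H (\<lambda>i. e (i + 2))" for e
    by (auto simp: int_encode_eq eval_nat_numeral)
  show "psat e (PEq (PVar 0) (PVar 1)) \<longleftrightarrow> ?H e = emp int_struct" for e
    by (auto simp: int_struct_encode int_encode_eq)
  \<comment> \<open>From 2(a - b) + 1 = c - d one gets 2a + 1 + d = 2b + c; the quantified index 0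
    is the number 1 and shifts a, b, c, d to the indices 1 to 4.\<close>
  show "psat e (PEx (PAnd (POne 0) (PEq (PAdd (PAdd (PAdd (PVar 1) (PVar 1)) (PVar 0)) (PVar 4))
      (PAdd (PAdd (PVar 2) (PVar 2)) (PVar 3))))) \<longleftrightarrow> sing int_struct (?H e) = ?H (\<lambda>i. e (i + 2))" for e
    by (auto simp: int_struct_encode int_encode_eq eval_nat_numeral)
  show "psat e (PEq (PAdd (PAdd (PVar 0) (PVar 2)) (PVar 5)) (PAdd (PAdd (PVar 4) (PVar 1)) (PVar 3))) \<longleftrightarrow>
      plus int_struct (?H e) (?H (\<lambda>i. e (i + 2))) = ?H (\<lambda>i. e (i + 2 * 2))" for e
    by (auto simp: int_struct_encode int_encode_eq eval_nat_numeral)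
  show "psat e (PEq (PVar 0) (PVar 0)) \<longleftrightarrow> contained int_struct (?H e) (?H (\<lambda>i. e (i + 2)))" for e
    by (simp add: int_struct_def)
qed auto

theorem theoremC:
  "(\<forall>i\<in>{4, 5, 6, 7, 8}.
      \<not> (F_minus - {ax i}) \<turnstile> ax i \<and>
      (\<exists>T. extends T (F_minus - {ax i}) \<and> consistent_theory T \<and> complete_theory T \<and> decidable_theory T \<and>
        (\<exists>M :: nat struct. model_of M (F_minus - {ax i}) \<and> Th M = T \<and>
          (finite (universe M) \<or> presburger_definable M)))) \<and>
   (\<forall>p. sentence p \<longrightarrow> cont_free p \<longrightarrow> F_minus \<turnstile> p \<longrightarrow> ax ` {1..8} \<turnstile> p)"
proof (intro conjI ballI)
  show "\<forall>p. sentence p \<longrightarrow> cont_free p \<longrightarrow> F_minus \<turnstile> p \<longrightarrow> ax ` {1..8} \<turnstile> p"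
    using containment_conservative by blast
next
  have "plus max_struct 0 1 = plus max_struct 1 1" "0 \<in> universe max_struct" "1 \<in> universe max_struct"
    by (simp_all add: max_struct_def)
  then have 4: "\<not> max_struct \<Turnstile> ax 4"
    unfolding holds_ax4[OF max_struct.wf] by (metis zero_neq_one)
  have 5: "\<not> point_struct \<Turnstile> ax 5"
    unfolding holds_ax5[OF point_struct.wf] by (simp add: point_struct_def)
  have "plus int_struct (int_encode 1) (int_encode (- 1)) = emp int_struct"
    "int_encode 1 \<noteq> emp int_struct"
    by (simp_all add: int_struct_eq_iff int_decode_plus int_struct.dec_emp)
  then have 6: "\<not> int_struct \<Turnstile> ax 6"
    unfolding holds_ax6[OF int_struct.wf] using int_struct.universe by blast
  have "sing const_struct 0 = sing const_struct 1" "0 \<in> universe const_struct" "1 \<in> universe const_struct"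
    by (simp_all add: const_struct_def)
  then have 7: "\<not> const_struct \<Turnstile> ax 7"
    unfolding holds_ax7[OF const_struct.wf] by (metis zero_neq_one)
  \<comment> \<open>Both sides are 4, but neither summand 2 reaches the singleton of 3, which is
    4.\<close>
  have "plus succ_struct 2 2 = plus succ_struct (sing succ_struct 3) 0"
    "\<And>w. 2 \<noteq> plus succ_struct (sing succ_struct 3) w" "\<And>n. n \<in> universe succ_struct"
    by (simp_all add: succ_struct_def)
  then have 8: "\<not> succ_struct \<Turnstile> ax 8"
    unfolding holds_ax8[OF succ_struct.wf] by metis
  have point_finite: "finite (universe point_struct) \<or> presburger_definable point_struct"
    by (simp add: point_struct_def)
  fix i :: nat assume "i \<in> {4, 5, 6, 7, 8}"
  then have "i = 4 \<or> i = 5 \<or> i = 6 \<or> i = 7 \<or> i = 8" by simp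
  then have "\<not> (F_minus - {ax i}) \<turnstile> ax i \<and>
      (\<exists>T. extends T (F_minus - {ax i}) \<and> consistent_theory T \<and> complete_theory T \<and> decidable_theory T \<and>
        (\<exists>M :: nat struct. model_of M (F_minus - {ax i}) \<and> Th M = T \<and>
          (finite (universe M) \<or> presburger_definable M)))" (is "?P i")
  proof (elim disjE)
    show ?thesis if "i = 4" unfolding that
      by (rule independence[OF max_struct.wf _ 4 max_struct.decidable_Th disjI2[OF max_struct_definable]]) (rule max_struct_axioms)
    show ?thesis if "i = 5" unfolding that
      by (rule independence[OF point_struct.wf _ 5 point_struct.decidable_Th point_finite]) (rule point_struct_axioms)
    show ?thesis if "i = 6" unfolding that
      by (rule independence[OF int_struct.wf _ 6 int_struct.decidable_Th disjI2[OF int_struct_definable]]) (rule int_struct_axioms)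
    show ?thesis if "i = 7" unfolding that
      by (rule independence[OF const_struct.wf _ 7 const_struct.decidable_Th disjI2[OF const_struct_definable]]) (rule const_struct_axioms)
    show ?thesis if "i = 8" unfolding that
      by (rule independence[OF succ_struct.wf _ 8 succ_struct.decidable_Th disjI2[OF succ_struct_definable]]) (rule succ_struct_axioms)
  qed
  then show "\<not> (F_minus - {ax i}) \<turnstile> ax i" and "\<exists>T. extends T (F_minus - {ax i}) \<and> consistent_theory T \<and> complete_theory T \<and> decidable_theory T \<and>
        (\<exists>M :: nat struct. model_of M (F_minus - {ax i}) \<and> Th M = T \<and>
          (finite (universe M) \<or> presburger_definable M))" by blast+
qed

end
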